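(* Let $K\ge 1$ and $1\le J\le K$ be integers, and let $\Gamma>0$, $\Lambda>0$. Consider the frequency hopping (FH) channel with $K$ subchannels, $\mathcal K=\{1,\dots,K\}$, in which the jammer can influence $J$ subchannels at a time, with independent zero-mean noise variables $N_1,\dots,N_K$ of variances $\sigma_1^2,\dots,\sigma_K^2$. Let $C_r(\Gamma,\Lambda)$ be its common randomness assisted $(\Gamma,\Lambda)$-capacity. (1) Let $\Lambda_1,\dots,\Lambda_K$ be nonnegative numbers satisfying $$\begin{cases}\sigma_k^2+\Lambda_k=c & \text{if }\sigma_k^2<c,\\ \Lambda_k=0 & \text{if }\sigma_k^2\ge c,\end{cases}$$ with $c$ such that $\Lambda_1+\cdots+\Lambda_K=\Lambda$. Then $$C_r(\Gamma,\Lambda)\ge\frac12\log\left(1+\frac{\Gamma}{c}\right).$$ In particular, $C_r(\Gamma,\Lambda)>0$. (2) With the same $c$, if the noise is Gaussian (i.e. every $N_k$ is Gaussian) and $J\ge|\{k\in\mathcal K:\sigma_k^2<c\}|$, then $$C_r(\Gamma,\Lambda)\le\frac12\log\left(1+\frac{\Gamma}{c}\right)+\log K.$$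
   Context: All logarithms (in rates and bounds) are to the same base. **FH channel.** Let $\mathcal K=\{1,\dots,K\}$, and fix $J$ with $1\le J\le K$. For $k\in\mathcal K$ let $\mathbf e_k\in\mathbb R^K$ be the $k$-th standard basis vector. For $\mathcal I\subset\mathcal K$ with $|\mathcal I|=J$ let $\mathbf e_{\mathcal I}\in\mathbb R^K$ be the vector with $l$-th entry $1$ if $l\in\mathcal I$ and $0$ otherwise. The noise vector is $\mathbf N=(N_1,\dots,N_K)^\top$ with independent real random variables $N_k$ of mean zero and (finite) variance $\sigma_k^2$. At each time instant the sender chooses $(x,k)\in\mathcal X:=\mathbb R\times\mathcal K$ and inputs $x\mathbf e_k$; the jammer chooses an element $(\mathcal I,\mathbf s)$ of $$\mathcal S=\bigcup_{\mathcal I\subset\mathcal K:|\mathcal I|=J}\{\mathcal I\}\times\{\mathbf s\in\mathbb R^K: l\notin\mathcal I\Rightarrow s_l=0\}$$ and inputs $\mathbf s\circ\mathbf e_{\mathcal I}$, where $\circ$ is the component-wise product. The receiver obtains $\mathbf y=x\mathbf e_k+\mathbf s\circ\mathbf e_{\mathcal I}+\mathbf N\in\mathbb R^K$. The channel is memoryless: the noise vectors at different times are independent copies of $\mathbf N$. **Codes.** A blocklength-$n$ code $(f_n,\varphi_n)$ with message set $\mathcal M_n=\{1,\dots,|\mathcal M_n|\}$ consists of an encoder $f_n:\mathcal M_n\to\{(x_1\mathbf e_{k_1},\dots,x_n\mathbf e_{k_n}):(x_i,k_i)\in\mathcal X,\ 1\le i\le n\}$, whose values are regarded as $K\times n$ matrices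 with $i$-th column $f_n(m)_i=x_i\mathbf e_{k_i}$, and a (measurable) decoder $\varphi_n:\mathbb R^{K\times n}\to\mathcal M_n$. It is an $(n,\Gamma)$-code if $\sum_{i=1}^n\|f_n(m)_i\|^2\le n\Gamma$ for all $m\in\mathcal M_n$, with $\|\cdot\|$ the Euclidean norm. **Jammer sequences.** A length-$n$ jamming sequence $((\mathcal I_1,\mathbf s_1),\dots,(\mathcal I_n,\mathbf s_n))\in\mathcal S^n$ is represented by the $K\times n$ matrices $\tilde S$ (columns $\mathbf s_i$) and $\tilde E$ (columns $\mathbf e_{\mathcal I_i}$). Let $\mathcal J_\Lambda$ be the set of all such $\tilde S\circ\tilde E$ with $\sum_{i=1}^n\|\mathbf s_i\|^2\le n\Lambda$. **Error for a fixed code.** With $\tilde N$ a $K\times n$ matrix whose columns are independent copies of $\mathbf N$, set $$\bar e(f_n,\varphi_n,\tilde S\circ\tilde E)=\frac1{|\mathcal M_n|}\sum_{m\in\mathcal M_n}\mathbb P[\varphi_n(f_n(m)+\tilde S\circ\tilde E+\tilde N)\ne m].$$ **Common randomness assisted capacity.** A common randomness assisted $(n,\Gamma)$-code is a random variable $(F_n,\Phi_n)$ on the set of $(n,\Gamma)$-codes with a common message set $\mathcal M_n$, independent of the channel noise. Its overall error under jammer power constraint $\Lambda$ is $\sup_{\tilde S\circ\tilde E\in\mathcal J_\Lambda}\mathbb E[\bar e(F_n,\Phi_n,\tilde S\circ\tilde E)]$, the expectation being over $(F_n,\Phi_n)$. A number $R\ge0$ is a common randomness assisted achievable rate under $(\Gamma,\Lambda)$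 if there is a sequence, $n\ge1$, of common randomness assisted $(n,\Gamma)$-codes with $\liminf_{n\to\infty}\frac1n\log|\mathcal M_n|\ge R$ whose overall errors tend to $0$. $C_r(\Gamma,\Lambda)$ is the supremum of these rates. *)

theory Defs
  imports "HOL-Probability.Probability"
begin

text \<open>
  The subchannels are the elements of a finite type \<open>'k\<close>, so that \<open>K = CARD('k)\<close> and
  \<open>\<K> = UNIV\<close>.  A real \<open>K \<times> n\<close> matrix is the family of its columns, i.e. an
  element of \<open>{1..n} \<rightarrow>\<^sub>E UNIV\<close>.
\<close>

type_synonym 'k signal = "nat \<Rightarrow> real ^ 'k"

definition signal_space :: "nat \<Rightarrow> 'k::finite signal measure" where
  "signal_space n = PiM {1..n} (\<lambda>_. borel)"

definition set_vec :: "'k::finite set \<Rightarrow> real ^ 'k" where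
  "set_vec I = (\<chi> l. if l \<in> I then 1 else 0)"

definition jammer_actions :: "nat \<Rightarrow> ('k::finite set \<times> (real ^ 'k)) set" where
  "jammer_actions J = {(I, s). card I = J \<and> (\<forall>l. l \<notin> I \<longrightarrow> s $ l = 0)}"

text \<open>The product on \<open>real ^ 'k\<close> is the component-wise one.\<close>

definition jamming_signals :: "nat \<Rightarrow> nat \<Rightarrow> real \<Rightarrow> 'k::finite signal set" where
  "jamming_signals n J \<Lambda> =
     {restrict (\<lambda>i. snd (a i) * set_vec (fst (a i))) {1..n} | a.
        (\<forall>i\<in>{1..n}. a i \<in> jammer_actions J) \<and>
        (\<Sum>i=1..n. (norm (snd (a i)))\<^sup>2) \<le> real n * \<Lambda>}"

definition codewords :: "nat \<Rightarrow> 'k::finite signal set" where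
  "codewords n = {u \<in> {1..n} \<rightarrow>\<^sub>E UNIV. \<forall>i\<in>{1..n}. \<exists>x k. u i = x *\<^sub>R axis k 1}"

text \<open>A code is a pair of an encoder and a decoder; the message set is \<open>{1..M}\<close>.\<close>

type_synonym 'k code = "(nat \<Rightarrow> 'k signal) \<times> ('k signal \<Rightarrow> nat)"

definition codes :: "nat \<Rightarrow> real \<Rightarrow> nat \<Rightarrow> 'k::finite code set" where
  "codes n \<Gamma> M =
     {(f, \<phi>). f \<in> {1..M} \<rightarrow>\<^sub>E codewords n \<and>
        \<phi> \<in> measurable (signal_space n) (count_space {1..M}) \<and>
        (\<forall>m\<in>{1..M}. (\<Sum>i=1..n. (norm (f m i))\<^sup>2) \<le> real n * \<Gamma>)}"

text \<open>
  The parameter \<open>\<mu>\<close> is the law of the noise vector of a single time instant; by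
  memorylessness the noise matrix has law \<open>PiM {1..n} (\<lambda>_. \<mu>)\<close>.
\<close>

definition code_error :: "(real ^ 'k::finite) measure \<Rightarrow> nat \<Rightarrow> nat \<Rightarrow> 'k code \<Rightarrow> 'k signal \<Rightarrow> real"
where
  "code_error \<mu> n M = (\<lambda>(f, \<phi>) s.
     (1 / real M) *
     (\<Sum>m=1..M. measure (PiM {1..n} (\<lambda>_. \<mu>))
        {z \<in> space (PiM {1..n} (\<lambda>_. \<mu>)).
           \<phi> (restrict (\<lambda>i. f m i + s i + z i) {1..n}) \<noteq> m}))"

text \<open>
  A common randomness assisted code is represented by its law \<open>Q\<close> on the set of codes.
  Drawing the noise from \<open>PiM {1..n} (\<lambda>_. \<mu>)\<close>, separately from \<open>Q\<close>,
  expresses the independence of code and noise.  The last two conditions say in which sense the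
  code is a random variable: the codewords are random vectors, and the decoded message is jointly
  measurable in the code and the channel output.  This makes the error probability of the random
  code meaningful for deterministic as well as for random jamming sequences.  Measurability of the
  decoder output for each fixed channel output would not suffice for that.
\<close>

definition cr_code :: "nat \<Rightarrow> real \<Rightarrow> nat \<Rightarrow> 'k::finite code measure \<Rightarrow> bool" where
  "cr_code n \<Gamma> M Q \<longleftrightarrow>
     1 \<le> M \<and> prob_space Q \<and> space Q \<subseteq> codes n \<Gamma> M \<and>
     (\<forall>m\<in>{1..M}. (\<lambda>(f, \<phi>). f m) \<in> measurable Q (signal_space n)) \<and>
     (\<lambda>((f, \<phi>), y). \<phi> y) \<in> measurable (Q \<Otimes>\<^sub>M signal_space n) (count_space {1..M})"

definition cr_error ::
  "(real ^ 'k::finite) measure \<Rightarrow> nat \<Rightarrow> real \<Rightarrow> nat \<Rightarrow> nat \<Rightarrow> 'k code measure \<Rightarrow> real"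
where
  "cr_error \<mu> J \<Lambda> n M Q =
     (SUP s\<in>jamming_signals n J \<Lambda>. LINT c|Q. code_error \<mu> n M c s)"

definition cr_achievable ::
  "real \<Rightarrow> (real ^ 'k::finite) measure \<Rightarrow> nat \<Rightarrow> real \<Rightarrow> real \<Rightarrow> real \<Rightarrow> bool"
where
  "cr_achievable b \<mu> J \<Gamma> \<Lambda> R \<longleftrightarrow>
     0 \<le> R \<and>
     (\<exists>(M :: nat \<Rightarrow> nat) (Q :: nat \<Rightarrow> 'k code measure).
        (\<forall>n\<ge>1. cr_code n \<Gamma> (M n) (Q n)) \<and>
        liminf (\<lambda>n. ereal (1 / real n * log b (real (M n)))) \<ge> ereal R \<and>
        (\<lambda>n. cr_error \<mu> J \<Lambda> n (M n) (Q n)) \<longlonglongrightarrow> 0)"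

text \<open>
  The supremum is extended real: for some noise laws (for instance without noise and with
  \<open>J < K\<close>) the set of achievable rates is unbounded.
\<close>

definition cr_capacity ::
  "real \<Rightarrow> (real ^ 'k::finite) measure \<Rightarrow> nat \<Rightarrow> real \<Rightarrow> real \<Rightarrow> ereal"
where
  "cr_capacity b \<mu> J \<Gamma> \<Lambda> = Sup (ereal ` {R. cr_achievable b \<mu> J \<Gamma> \<Lambda> R})"

definition noise_law :: "'w measure \<Rightarrow> ('k::finite \<Rightarrow> 'w \<Rightarrow> real) \<Rightarrow> (real ^ 'k) measure" where
  "noise_law P N = distr P borel (\<lambda>\<omega>. \<chi> k. N k \<omega>)"

text \<open>Variances may vanish; a Gaussian variable of variance 0 is almost surely 0.\<close>

definition centered_gaussian :: "'w measure \<Rightarrow> ('w \<Rightarrow> real) \<Rightarrow> real \<Rightarrow> bool" where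
  "centered_gaussian P X s \<longleftrightarrow>
     (if s = 0 then X \<in> borel_measurable P \<and> (AE \<omega> in P. X \<omega> = 0)
      else distributed P lborel X (normal_density 0 s))"

end

theory Submission
  imports Defs
begin

text \<open>
  Lower bound: sender and receiver hop uniformly over the subchannels with \<open>\<sigma>\<^sup>2 < c\<close>, using
  Gaussian codebooks of power \<open>g < \<Gamma>\<close>.  The receiver uses the log-likelihood ratio of the additive
  Gaussian channel with noise variance \<open>c\<close> as a metric.  For a transmitted symbol and additive
  noise \<open>z\<close>, its expectation is affine in \<open>z\<^sup>2\<close>, and averaged over the hops the mean of \<open>z\<^sup>2\<close> per
  time instant is at most \<open>c\<close>, however the jammer distributes its power.  Hence the mean metric of
  the sent codeword is at least \<open>ln (1 + g / c) / 2\<close> per symbol.  Both error events are controlled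
  by exponential moments, which factorize over time.

  Upper bound: the jammer adds independent Gaussian noise filling every subchannel up to a level
  \<open>c' < c\<close>; by Markov's inequality it respects the power constraint with a probability bounded away
  from 0.  For a fixed hopping sequence, a codeword's output law is compared with the law in which
  the used subchannel carries a centered Gaussian of variance increased by \<open>\<Gamma>\<close>.  Summing over all
  hopping sequences costs the factor \<open>K ^ n\<close>, which is the term \<open>log K\<close>, and bounds the success
  probability of every code above this rate by a sequence tending to 0.
\<close>

section \<open>Finite products of probability measures\<close>

text \<open>The noise in the lower bound has just two moments. The plain log-likelihood ratio
  contains a negative multiple of the squared noise, so its negative exponential need not be
  integrable. The score is therefore bounded from below. Its negative exponential then has a
  second-order bound in which the linear term keeps the dependence on the interference energy and
  the quadratic term does not see the interference. The bound is affine in the energy, so only the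
  total energy on the hopping set counts, and water-filling bounds it by c per subchannel. The
  choice \<open>g < \<Gamma>\<close> makes power violations exponentially rare.

  In the converse the hopping sequence depends on the message, so no single reference law serves all
  codewords; there is one for each hopping sequence. Filling to the level c itself would use mean
  power exactly \<Lambda>, and Markov's inequality would say nothing; a rate strictly above the
  bound leaves room for \<open>c' < c\<close>. The estimates hold for each code separately, hence
  survive averaging over common randomness. Success probabilities tending to 1 would then have to
  stay below a limit smaller than 1.\<close>

lemma nn_integral_PiM_prod:
  assumes "\<And>i. prob_space (M i)" "finite I" "\<And>i. i \<in> I \<Longrightarrow> f i \<in> borel_measurable (M i)"
  shows "(\<integral>\<^sup>+ x. (\<Prod>i\<in>I. f i (x i)) \<partial>PiM I M) = (\<Prod>i\<in>I. integral\<^sup>N (M i) (f i))"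
proof -
  interpret product_prob_space M by (intro product_prob_spaceI assms)
  show ?thesis by (rule product_nn_integral_prod) (use assms in auto)
qed

text \<open>Boxes determine a product measure, and on a box both the density and the indicator
  factor over the coordinates. It turns one-letter likelihood ratios into a likelihood ratio of
  whole blocks.\<close>

lemma PiM_density:
  assumes M: "\<And>i. prob_space (M i)" and D: "\<And>i. prob_space (density (M i) (f i))"
    and "finite I" and f [measurable]: "\<And>i. f i \<in> borel_measurable (M i)"
  shows "PiM I (\<lambda>i. density (M i) (f i)) = density (PiM I M) (\<lambda>x. \<Prod>i\<in>I. f i (x i))"
proof -
  interpret D: product_prob_space "\<lambda>i. density (M i) (f i)" by (intro product_prob_spaceI D)
  show ?thesis
  proof (rule D.PiM_eqI[symmetric])
    show "sets (density (PiM I M) (\<lambda>x. \<Prod>i\<in>I. f i (x i))) = sets (PiM I (\<lambda>i. density (M i) (f i)))"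
      by (simp, rule sets_PiM_cong) auto
    fix A assume A: "\<And>i. i \<in> I \<Longrightarrow> A i \<in> sets (density (M i) (f i))"
    then have [measurable]: "\<And>i. i \<in> I \<Longrightarrow> A i \<in> sets (M i)" by simp
    have PA: "Pi\<^sub>E I A \<in> sets (PiM I M)" using assms by (intro sets_PiM_I_finite) auto
    have "emeasure (density (PiM I M) (\<lambda>x. \<Prod>i\<in>I. f i (x i))) (Pi\<^sub>E I A)
        = (\<integral>\<^sup>+x. (\<Prod>i\<in>I. f i (x i)) * indicator (Pi\<^sub>E I A) x \<partial>PiM I M)"
      by (rule emeasure_density) (use PA in auto)
    also have "\<dots> = (\<integral>\<^sup>+x. (\<Prod>i\<in>I. f i (x i) * indicator (A i) (x i)) \<partial>PiM I M)"
    proof (rule nn_integral_cong)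
      fix x assume "x \<in> space (PiM I M)"
      then have "(indicator (Pi\<^sub>E I A) x :: ennreal) = (\<Prod>i\<in>I. indicator (A i) (x i))"
        using \<open>finite I\<close> by (auto simp: space_PiM PiE_iff indicator_def prod_zero_iff)
      then show "(\<Prod>i\<in>I. f i (x i)) * indicator (Pi\<^sub>E I A) x = (\<Prod>i\<in>I. f i (x i) * indicator (A i) (x i))"
        by (simp add: prod.distrib)
    qed
    also have "\<dots> = (\<Prod>i\<in>I. \<integral>\<^sup>+x. f i x * indicator (A i) x \<partial>M i)"
      by (rule nn_integral_PiM_prod) (use assms in auto)
    also have "\<dots> = (\<Prod>i\<in>I. emeasure (density (M i) (f i)) (A i))"
      by (rule prod.cong) (auto simp: emeasure_density)
    finally show "emeasure (density (PiM I M) (\<lambda>x. \<Prod>i\<in>I. f i (x i))) (Pi\<^sub>E I A) = \<dots>" .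
  qed fact
qed

text \<open>Integrating the indicator of a box first over \<open>b\<close> and then over
  \<open>a\<close> separates the coordinates. The lemma is applied twice when jamming and noise are
  added: once over the subchannels of one time instant and once over time.\<close>

lemma distr_pair_PiM:
  assumes M: "\<And>i. prob_space (M i)" and N: "\<And>i. prob_space (N i)" and "finite I"
    and h [measurable]: "\<And>i. h i \<in> measurable (M i \<Otimes>\<^sub>M N i) (L i)"
  shows "distr (PiM I M \<Otimes>\<^sub>M PiM I N) (PiM I L) (\<lambda>(a, b). \<lambda>i\<in>I. h i (a i, b i))
    = PiM I (\<lambda>i. distr (M i \<Otimes>\<^sub>M N i) (L i) (h i))" (is "?D = _")
proof -
  interpret M: product_prob_space M by (intro product_prob_spaceI M)
  interpret N: product_prob_space N by (intro product_prob_spaceI N)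
  have MN: "prob_space (M i \<Otimes>\<^sub>M N i)" for i
    by (intro prob_space_pair M N)
  interpret D: product_prob_space "\<lambda>i. distr (M i \<Otimes>\<^sub>M N i) (L i) (h i)"
    by (intro product_prob_spaceI prob_space.prob_space_distr MN) auto
  have PM: "prob_space (PiM I M)" "prob_space (PiM I N)"
    by (intro prob_space_PiM M N)+
  interpret PN: prob_space "PiM I N" by (rule PM)
  have meas [measurable]: "(\<lambda>(a, b). \<lambda>i\<in>I. h i (a i, b i)) \<in> PiM I M \<Otimes>\<^sub>M PiM I N \<rightarrow>\<^sub>M PiM I L"
    by measurable
  show ?thesis
  proof (rule D.PiM_eqI)
    show "sets ?D = sets (PiM I (\<lambda>i. distr (M i \<Otimes>\<^sub>M N i) (L i) (h i)))"
      by (simp, rule sets_PiM_cong) auto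
    fix A assume A: "\<And>i. i \<in> I \<Longrightarrow> A i \<in> sets (distr (M i \<Otimes>\<^sub>M N i) (L i) (h i))"
    then have A' [measurable]: "\<And>i. i \<in> I \<Longrightarrow> A i \<in> sets (L i)" by simp
    have PA [measurable]: "Pi\<^sub>E I A \<in> sets (PiM I L)" using assms by (intro sets_PiM_I_finite) auto
    have "emeasure ?D (Pi\<^sub>E I A) = (\<integral>\<^sup>+x. indicator (Pi\<^sub>E I A) x \<partial>?D)"
      by (subst nn_integral_indicator) auto
    also have "\<dots> = (\<integral>\<^sup>+p. indicator (Pi\<^sub>E I A) ((\<lambda>(a, b). \<lambda>i\<in>I. h i (a i, b i)) p) \<partial>(PiM I M \<Otimes>\<^sub>M PiM I N))"
      by (subst nn_integral_distr) auto
    also have "\<dots> = (\<integral>\<^sup>+a. \<integral>\<^sup>+b. indicator (Pi\<^sub>E I A) (\<lambda>i\<in>I. h i (a i, b i)) \<partial>PiM I N \<partial>PiM I M)"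
      by (subst sigma_finite_measure.nn_integral_fst[OF prob_space_imp_sigma_finite[OF PM(2)], symmetric]) auto
    also have "\<dots> = (\<integral>\<^sup>+a. \<integral>\<^sup>+b. (\<Prod>i\<in>I. indicator (A i) (h i (a i, b i))) \<partial>PiM I N \<partial>PiM I M)"
      by (intro nn_integral_cong) (auto simp: PiE_iff indicator_def \<open>finite I\<close> prod_zero_iff)
    also have "\<dots> = (\<integral>\<^sup>+a. (\<Prod>i\<in>I. \<integral>\<^sup>+b. indicator (A i) (h i (a i, b)) \<partial>N i) \<partial>PiM I M)"
    proof (intro nn_integral_cong nn_integral_PiM_prod N \<open>finite I\<close>)
      fix a i assume a: "a \<in> space (PiM I M)" and i [measurable]: "i \<in> I"
      then have [measurable]: "a i \<in> space (M i)" by (auto simp: space_PiM)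
      show "(\<lambda>b. indicator (A i) (h i (a i, b)) :: ennreal) \<in> borel_measurable (N i)"
        using i by measurable
    qed
    also have "\<dots> = (\<Prod>i\<in>I. \<integral>\<^sup>+a. \<integral>\<^sup>+b. indicator (A i) (h i (a, b)) \<partial>N i \<partial>M i)"
    proof (intro nn_integral_PiM_prod M \<open>finite I\<close>)
      fix i assume i [measurable]: "i \<in> I"
      interpret Ni: prob_space "N i" by (rule N)
      show "(\<lambda>a. \<integral>\<^sup>+b. indicator (A i) (h i (a, b)) \<partial>N i) \<in> borel_measurable (M i)"
        using i by measurable
    qed
    also have "\<dots> = (\<Prod>i\<in>I. emeasure (distr (M i \<Otimes>\<^sub>M N i) (L i) (h i)) (A i))"
    proof (rule prod.cong[OF refl])
      fix i assume i [measurable]: "i \<in> I"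
      interpret Ni: prob_space "N i" by (rule N)
      have "emeasure (distr (M i \<Otimes>\<^sub>M N i) (L i) (h i)) (A i)
          = (\<integral>\<^sup>+x. indicator (A i) x \<partial>distr (M i \<Otimes>\<^sub>M N i) (L i) (h i))"
        using i by (subst nn_integral_indicator) auto
      also have "\<dots> = (\<integral>\<^sup>+p. indicator (A i) (h i p) \<partial>(M i \<Otimes>\<^sub>M N i))"
        using i by (subst nn_integral_distr) auto
      also have "\<dots> = (\<integral>\<^sup>+a. \<integral>\<^sup>+b. indicator (A i) (h i (a, b)) \<partial>N i \<partial>M i)"
        using i by (subst sigma_finite_measure.nn_integral_fst[OF prob_space_imp_sigma_finite[OF N],
            symmetric]) auto
      finally show "(\<integral>\<^sup>+a. \<integral>\<^sup>+b. indicator (A i) (h i (a, b)) \<partial>N i \<partial>M i) = emeasure (distr (M i \<Otimes>\<^sub>M N i) (L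
          i) (h i)) (A i)" ..
    qed
    finally show "emeasure ?D (Pi\<^sub>E I A) = \<dots>" .
  qed fact
qed

lemma nn_integral_PiM_component:
  assumes M: "\<And>i. prob_space (M i)" and i: "i \<in> I" and f: "f \<in> borel_measurable (M i)"
  shows "(\<integral>\<^sup>+x. f (x i) \<partial>PiM I M) = (\<integral>\<^sup>+x. f x \<partial>M i)"
proof -
  have "(\<integral>\<^sup>+x. f x \<partial>M i) = (\<integral>\<^sup>+x. f x \<partial>distr (PiM I M) (M i) (\<lambda>\<omega>. \<omega> i))"
    using distr_PiM_component[of I M i] M i by simp
  also have "\<dots> = (\<integral>\<^sup>+x. f (x i) \<partial>PiM I M)"
    using i f by (intro nn_integral_distr) auto
  finally show ?thesis ..
qed

text \<open>This isolates a wrong codeword: it is averaged first, while the sent codeword and hence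
  the channel output stay fixed.\<close>

lemma nn_integral_PiM_resample:
  assumes M: "\<And>i. prob_space (M i)" and "finite I" "i \<in> I" and f: "f \<in> borel_measurable (PiM I M)"
  shows "(\<integral>\<^sup>+x. f x \<partial>PiM I M) = (\<integral>\<^sup>+x. \<integral>\<^sup>+y. f (x(i := y)) \<partial>M i \<partial>PiM (I - {i}) M)"
proof -
  interpret product_prob_space M by (intro product_prob_spaceI M)
  have "insert i (I - {i}) = I" using \<open>i \<in> I\<close> by auto
  with product_nn_integral_insert[of "I - {i}" i f] assms show ?thesis by simp
qed

section \<open>Gaussian integrals\<close>

definition gauss :: "real \<Rightarrow> real \<Rightarrow> real measure" where
  "gauss m v = density lborel (normal_density m (sqrt v))"

lemma sets_gauss [simp, measurable_cong]: "sets (gauss m v) = sets borel"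
  and space_gauss [simp]: "space (gauss m v) = UNIV"
  by (simp_all add: gauss_def)

lemma measurable_gauss_eq [simp]: "measurable M (gauss m v) = borel_measurable M"
  and measurable_gauss_eq1 [simp]: "measurable (gauss m v) N = measurable borel N"
  by (rule measurable_cong_sets; simp)+

lemma prob_space_gauss: "0 < v \<Longrightarrow> prob_space (gauss m v)"
  unfolding gauss_def by (rule prob_space_normal_density) simp

text \<open>The decoding score treats a zero symbol as a separate case, which a Gaussian symbol
  avoids almost surely.\<close>

lemma AE_gauss_neq: "AE x in gauss m v. x \<noteq> a"
  unfolding gauss_def
  by (subst AE_density) (auto intro: AE_mp[OF AE_lborel_singleton[of a]])

lemma nn_integral_gauss:
  assumes [measurable]: "f \<in> borel_measurable borel" and "\<And>x. 0 \<le> f x"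
  shows "(\<integral>\<^sup>+x. ennreal (f x) \<partial>gauss m v) = (\<integral>\<^sup>+x. ennreal (normal_density m (sqrt v) x * f x) \<partial>lborel)"
  unfolding gauss_def using assms(2)
  by (subst nn_integral_density) (auto simp: ennreal_mult)

text \<open>
  All Gaussian integrals below are computed by recognising the integrand as a multiple of
  another normal density.
\<close>

lemma nn_integral_gauss_eqI:
  assumes [measurable]: "f \<in> borel_measurable borel" and "\<And>x. 0 \<le> f x" and "0 < v'" and "0 \<le> K"
    and "\<And>x. normal_density m (sqrt v) x * f x = K * normal_density m' (sqrt v') x"
  shows "(\<integral>\<^sup>+x. ennreal (f x) \<partial>gauss m v) = ennreal K"
proof -
  have "(\<integral>\<^sup>+x. ennreal (f x) \<partial>gauss m v) = (\<integral>\<^sup>+x. ennreal K * ennreal (normal_density m' (sqrt v') x) \<partial>lborel)"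
    using assms by (simp add: nn_integral_gauss ennreal_mult)
  also have "\<dots> = ennreal K * (\<integral>\<^sup>+x. ennreal (normal_density m' (sqrt v') x) \<partial>lborel)"
    by (rule nn_integral_cmult) simp
  also have "(\<integral>\<^sup>+x. ennreal (normal_density m' (sqrt v') x) \<partial>lborel) = 1"
    using \<open>0 < v'\<close> by (subst nn_integral_eq_integral) auto
  finally show ?thesis by simp
qed

text \<open>With the normalizing constant in the exponent, an identity between products of densities
  becomes one between quadratic polynomials.\<close>

lemma normal_density_exp:
  assumes "0 < v"
  shows "normal_density m (sqrt v) x = exp (- ((x - m)\<^sup>2 / (2 * v)) - ln (2 * pi * v) / 2)"
proof -
  have "sqrt (2 * pi * v) = exp (ln (2 * pi * v) / 2)"
    using assms by (simp add: ln_sqrt[symmetric])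
  then show ?thesis
    using assms by (simp add: normal_density_def exp_diff)
qed

text \<open>The hypothesis \<open>eq\<close> is the completed square; \<open>m'\<close> and
  \<open>v'\<close> are mean and variance of the tilted Gaussian, and the quotient of the
  normalizing constants gives the term \<open>ln (v' / v) / 2\<close>.\<close>

lemma nn_integral_gauss_exp_eqI:
  assumes [measurable]: "f \<in> borel_measurable borel" and v: "0 < v" and v': "0 < v'"
    and eq: "\<And>x. f x - (x - m)\<^sup>2 / (2 * v) = k - (x - m')\<^sup>2 / (2 * v')"
  shows "(\<integral>\<^sup>+x. ennreal (exp (f x)) \<partial>gauss m v) = ennreal (exp (k + ln (v' / v) / 2))"
proof (rule nn_integral_gauss_eqI[where m' = m', OF _ _ v'])
  fix x
  have "normal_density m (sqrt v) x * exp (f x) = exp ((f x - (x - m)\<^sup>2 / (2 * v)) - ln (2 * pi * v) / 2)"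
    unfolding normal_density_exp[OF v] by (simp add: exp_add[symmetric])
  also have "\<dots> = exp (k + ln (v' / v) / 2) * normal_density m' (sqrt v') x"
    unfolding eq normal_density_exp[OF v'] using v v' by (simp add: exp_add[symmetric] ln_mult ln_div
        field_simps)
  finally show "normal_density m (sqrt v) x * exp (f x) = exp (k + ln (v' / v) / 2) * normal_density m'
      (sqrt v') x" .
qed auto

lemma gauss_power_tail:
  assumes g: "0 < g" "g < \<Gamma>"
  obtains \<theta> \<rho> where "0 < \<theta>" "0 < \<rho>" "\<rho> < 1"
    "(\<integral>\<^sup>+x. ennreal (exp (\<theta> * (x\<^sup>2 - \<Gamma>))) \<partial>gauss 0 g) \<le> ennreal \<rho>"
proof
  \<comment> \<open>The optimal Chernoff parameter: tilting by it changes the variance from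
    \<open>g\<close> to \<Gamma>. The exponent is then minus half of
    \<open>\<Gamma> / g - 1 - ln (\<Gamma> / g)\<close>, which is negative because
    \<open>\<Gamma> / g\<close> differs from 1.\<close>
  define \<theta> where "\<theta> = (1 / g - 1 / \<Gamma>) / 2"
  show "0 < \<theta>" using g by (simp add: \<theta>_def field_simps)
  have "(\<integral>\<^sup>+x. ennreal (exp (\<theta> * (x\<^sup>2 - \<Gamma>))) \<partial>gauss 0 g) = ennreal (exp (- \<theta> * \<Gamma> + ln (\<Gamma> / g) / 2))"
    by (rule nn_integral_gauss_exp_eqI[where m' = 0])
      (use g in \<open>auto simp: \<theta>_def divide_simps\<close>, simp_all add: algebra_simps)
  then show "(\<integral>\<^sup>+x. ennreal (exp (\<theta> * (x\<^sup>2 - \<Gamma>))) \<partial>gauss 0 g) \<le> ennreal (exp (- \<theta> * \<Gamma> + ln (\<Gamma> / g) / 2))"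
    by simp
  have "ln (\<Gamma> / g) < \<Gamma> / g - 1"
    using g ln_le_minus_one[of "\<Gamma> / g"] ln_eq_minus_one[of "\<Gamma> / g"] by (fastforce simp: le_less)
  moreover have "\<theta> * \<Gamma> = (\<Gamma> / g - 1) / 2" using g by (simp add: \<theta>_def field_simps)
  ultimately show "exp (- \<theta> * \<Gamma> + ln (\<Gamma> / g) / 2) < 1" by simp
qed simp

text \<open>This is the information density of the Gaussian channel with noise variance
  \<open>v\<close> and input power \<Gamma>: the log-density of the output given the input
  \<open>x\<close>, minus that of the output under a Gaussian input.\<close>

definition log_ratio :: "real \<Rightarrow> real \<Rightarrow> real \<Rightarrow> real \<Rightarrow> real" where
  "log_ratio v \<Gamma> x y = ln (1 + \<Gamma> / v) / 2 - (y - x)\<^sup>2 / (2 * v) + y\<^sup>2 / (2 * (v + \<Gamma>))"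

lemma measurable_log_ratio [measurable]:
  assumes [measurable]: "f \<in> borel_measurable M" "g \<in> borel_measurable M"
  shows "(\<lambda>p. log_ratio v \<Gamma> (f p) (g p)) \<in> borel_measurable M"
  unfolding log_ratio_def by measurable

lemma gauss_shift_density:
  assumes "0 < v" "0 < \<Gamma>"
  shows "gauss x v = density (gauss 0 (v + \<Gamma>)) (\<lambda>y. ennreal (exp (log_ratio v \<Gamma> x y)))"
proof -
  have "normal_density x (sqrt v) y = normal_density 0 (sqrt (v + \<Gamma>)) y * exp (log_ratio v \<Gamma> x y)" for y
  proof -
    have "1 + \<Gamma> / v = (v + \<Gamma>) / v" using assms by (simp add: field_simps)
    then have "ln (1 + \<Gamma> / v) = ln (v + \<Gamma>) - ln v"
      using assms by (simp add: ln_div)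
    moreover have "ln (2 * pi * v) = ln (2 * pi) + ln v" "ln (2 * pi * (v + \<Gamma>)) = ln (2 * pi) + ln (v + \<Gamma>)"
      using assms ln_mult[of "2 * pi" v] ln_mult[of "2 * pi" "v + \<Gamma>"] by auto
    ultimately show ?thesis
      using assms by (simp add: normal_density_exp log_ratio_def exp_add[symmetric] diff_divide_distrib
          add_divide_distrib)
  qed
  then show ?thesis
    unfolding gauss_def
    by (subst density_density_eq) (auto simp: ennreal_mult intro!: density_cong)
qed

text \<open>Averaging the conditional output density over the Gaussian input gives the output
  density. This holds for every fixed \<open>y\<close>, so no assumption on the law of the output is
  needed when \<open>x\<close> belongs to an independent codeword.\<close>

lemma nn_integral_exp_log_ratio_codeword:
  assumes "0 < v" "0 < \<Gamma>"
  shows "(\<integral>\<^sup>+x. ennreal (exp (log_ratio v \<Gamma> x y)) \<partial>gauss 0 \<Gamma>) = 1"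
proof -
  have "(\<integral>\<^sup>+x. ennreal (exp (log_ratio v \<Gamma> x y)) \<partial>gauss 0 \<Gamma>)
      = ennreal (exp (ln (1 + \<Gamma> / v) / 2 + ln (v * \<Gamma> / (v + \<Gamma>) / \<Gamma>) / 2))"
  \<comment> \<open>Mean and variance of the tilted Gaussian are those of the input conditioned on
    the output \<open>y\<close>.\<close>
  proof (rule nn_integral_gauss_exp_eqI[where m' = "\<Gamma> * y / (v + \<Gamma>)"])
    fix x
    have *: "v + \<Gamma> \<noteq> 0" "v \<noteq> 0" "\<Gamma> \<noteq> 0" using assms by auto
    then show "log_ratio v \<Gamma> x y - (x - 0)\<^sup>2 / (2 * \<Gamma>)
      = ln (1 + \<Gamma> / v) / 2 - (x - \<Gamma> * y / (v + \<Gamma>))\<^sup>2 / (2 * (v * \<Gamma> / (v + \<Gamma>)))"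
      unfolding log_ratio_def
      apply (simp add: divide_simps power2_eq_square)
      apply (simp add: algebra_simps)
      done
  qed (use assms in auto)
  also have "ln (1 + \<Gamma> / v) / 2 + ln (v * \<Gamma> / (v + \<Gamma>) / \<Gamma>) / 2 = 0"
  proof -
    have "v * \<Gamma> / (v + \<Gamma>) / \<Gamma> = inverse (1 + \<Gamma> / v)"
      using assms by (simp add: inverse_eq_divide add_divide_eq_iff)
    then show ?thesis using assms by (simp add: ln_inverse add_pos_pos)
  qed
  finally show ?thesis by simp
qed

lemma ln_one_plus_quadratic:
  assumes "0 \<le> (t::real)" shows "t - t\<^sup>2 / 2 \<le> ln (1 + t)"
proof -
  let ?f = "\<lambda>s::real. ln (1 + s) - s + s\<^sup>2 / 2"
  have "?f 0 \<le> ?f t"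
  proof (rule DERIV_nonneg_imp_nondecreasing[OF assms])
    fix s :: real assume s: "0 \<le> s" "s \<le> t"
    have "(?f has_real_derivative 1 / (1 + s) - 1 + s) (at s)"
      using s by (auto intro!: derivative_eq_intros)
    moreover have "0 \<le> 1 / (1 + s) - 1 + s" using s by (simp add: field_simps)
    ultimately show "\<exists>y. (?f has_real_derivative y) (at s) \<and> 0 \<le> y" by blast
  qed
  then show ?thesis by simp
qed

text \<open>The coefficient of \<open>l\<close> is the mean of the information density when
  \<open>x\<close> is sent. The remainder of order \<open>l\<^sup>2\<close> is free of
  \<open>v\<close>, so subchannels with different variances can share one estimate.\<close>

lemma nn_integral_exp_log_ratio_output:
  assumes pos: "0 < v" "0 < \<Gamma>" "0 \<le> l"
  shows "(\<integral>\<^sup>+y. ennreal (exp (l * log_ratio v \<Gamma> x y)) \<partial>gauss x v)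
    \<le> ennreal (exp (l * (ln (1 + \<Gamma> / v) / 2 + (x\<^sup>2 - \<Gamma>) / (2 * (v + \<Gamma>))) + l\<^sup>2 * (1 / 4 + x\<^sup>2 / (2 * \<Gamma>))))"
    (is "_ \<le> ennreal (exp ?R)")
proof -
  define w where "w = v + \<Gamma>"
  \<comment> \<open>The tilted density has precision
    \<open>(1 + l) / v - l / w = u / (v * w)\<close>.\<close>
  define u where "u = w + l * \<Gamma>"
  have w: "0 < w" "v < w" "\<Gamma> < w" using pos by (auto simp: w_def)
  have u: "0 < u" using pos w by (simp add: u_def add_pos_nonneg)
  have "(\<integral>\<^sup>+y. ennreal (exp (l * log_ratio v \<Gamma> x y)) \<partial>gauss x v)
      = ennreal (exp (l * (ln (1 + \<Gamma> / v) / 2) + l * (1 + l) * x\<^sup>2 / (2 * u) + ln (v * w / u / v) / 2))"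
  proof (rule nn_integral_gauss_exp_eqI[where m' = "(1 + l) * x * w / u"])
    fix y
    have *: "u \<noteq> 0" "w \<noteq> 0" "v \<noteq> 0" using u w pos by auto
    have "- (1 + l) * (y - x)\<^sup>2 / (2 * v) + l * y\<^sup>2 / (2 * w)
        = l * (1 + l) * x\<^sup>2 / (2 * u) - (y - (1 + l) * x * w / u)\<^sup>2 / (2 * (v * w / u))"
      using *
      apply (simp add: divide_simps power2_eq_square)
      apply (simp add: u_def w_def algebra_simps)
      done
    moreover have "l * log_ratio v \<Gamma> x y - (y - x)\<^sup>2 / (2 * v)
      = l * (ln (1 + \<Gamma> / v) / 2) + (- (1 + l) * (y - x)\<^sup>2 / (2 * v) + l * y\<^sup>2 / (2 * w))"
      by (simp add: log_ratio_def w_def algebra_simps add_divide_distrib diff_divide_distrib)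
    ultimately show "l * log_ratio v \<Gamma> x y - (y - x)\<^sup>2 / (2 * v)
      = l * (ln (1 + \<Gamma> / v) / 2) + l * (1 + l) * x\<^sup>2 / (2 * u) - (y - (1 + l) * x * w / u)\<^sup>2 / (2 * (v * w /
          u))"
      by linarith
  qed (use pos w u in auto)
  also have "\<dots> \<le> ennreal (exp ?R)"
  proof (intro ennreal_leI, subst exp_le_cancel_iff)
    have "1 + l * \<Gamma> / w = u / w" using w by (simp add: u_def add_divide_distrib)
    then have "v * w / u / v = inverse (1 + l * \<Gamma> / w)"
      using pos by simp
    then have 1: "ln (v * w / u / v) = - ln (1 + l * \<Gamma> / w)"
      using pos w by (simp add: ln_inverse add_pos_nonneg)
    have 2: "l * \<Gamma> / w - (l * \<Gamma> / w)\<^sup>2 / 2 \<le> ln (1 + l * \<Gamma> / w)"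
      using pos w by (intro ln_one_plus_quadratic) auto
    \<comment> \<open>Here and in \<open>5\<close> the inequality \<Gamma> < w removes
      \<open>v\<close> from the second-order remainder.\<close>
    have 3: "(l * \<Gamma> / w)\<^sup>2 \<le> l\<^sup>2"
      using pos w by (intro power_mono) (auto simp: divide_simps intro!: mult_left_mono)
    have 4: "l * (1 + l) * x\<^sup>2 / (2 * u) \<le> l * (1 + l) * x\<^sup>2 / (2 * w)"
      using pos w by (intro divide_left_mono) (auto simp: u_def intro!: mult_nonneg_nonneg mult_pos_pos
          add_pos_nonneg)
    have 5: "l\<^sup>2 * (x\<^sup>2 / (2 * w)) \<le> l\<^sup>2 * (x\<^sup>2 / (2 * \<Gamma>))"
      using pos w by (intro mult_left_mono divide_left_mono) auto
    have 6: "l * (1 + l) * x\<^sup>2 / (2 * w) = l * (x\<^sup>2 / (2 * w)) + l\<^sup>2 * (x\<^sup>2 / (2 * w))"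
      by (simp add: algebra_simps power2_eq_square add_divide_distrib)
    have 7: "?R = l * (ln (1 + \<Gamma> / v) / 2) + l * (x\<^sup>2 / (2 * w)) - l * \<Gamma> / w / 2 + l\<^sup>2 / 4 + l\<^sup>2 * (x\<^sup>2 / (2
        * \<Gamma>))"
      unfolding w_def[symmetric] by (simp add: algebra_simps diff_divide_distrib)
    show "l * (ln (1 + \<Gamma> / v) / 2) + l * (1 + l) * x\<^sup>2 / (2 * u) + ln (v * w / u / v) / 2 \<le> ?R"
      unfolding 1 7 using mult_left_mono[OF 2, of "1/2"] 3 4[unfolded 6] 5
      by (simp only: distrib_left right_diff_distrib) argo
  qed
  finally show ?thesis .
qed

text \<open>The terms with and without \<open>x\<^sup>2\<close> decrease in the noise variance
  separately; for the latter, \<open>ln q <= q - 1\<close> is applied to the ratio \<open>q\<close>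
  of the two arguments of the logarithm. In the converse it replaces every variance above the water
  level by the level itself.\<close>

lemma information_antimono_noise:
  fixes c v \<Gamma> x :: real
  assumes "0 < c" "c \<le> v" "0 < \<Gamma>"
  shows "ln (1 + \<Gamma> / v) / 2 + (x\<^sup>2 - \<Gamma>) / (2 * (v + \<Gamma>)) \<le> ln (1 + \<Gamma> / c) / 2 + (x\<^sup>2 - \<Gamma>) / (2 * (c + \<Gamma>))"
proof -
  define q where "q = (1 + \<Gamma> / v) / (1 + \<Gamma> / c)"
  have v: "0 < v" using assms by linarith
  have q: "0 < q" unfolding q_def using assms v by (intro divide_pos_pos add_pos_pos) auto
  have "ln (1 + \<Gamma> / v) - ln (1 + \<Gamma> / c) = ln q"
    unfolding q_def using assms v by (intro ln_divide_pos[symmetric] add_pos_pos) auto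
  also have "\<dots> \<le> q - 1" using q by (rule ln_le_minus_one)
  also have "q - 1 = - (\<Gamma> * (v - c) / (v * (c + \<Gamma>)))"
    using assms v by (simp add: q_def divide_simps add_pos_pos) (simp add: algebra_simps)
  also have "\<dots> \<le> - (\<Gamma> * (v - c) / ((v + \<Gamma>) * (c + \<Gamma>)))"
    using assms by (simp, intro divide_left_mono mult_right_mono) auto
  also have "\<dots> = \<Gamma> / (v + \<Gamma>) - \<Gamma> / (c + \<Gamma>)"
    using assms by (simp add: divide_simps) (simp add: algebra_simps)
  finally have 1: "ln (1 + \<Gamma> / v) - ln (1 + \<Gamma> / c) \<le> \<Gamma> / (v + \<Gamma>) - \<Gamma> / (c + \<Gamma>)" .
  have 2: "x\<^sup>2 / (v + \<Gamma>) \<le> x\<^sup>2 / (c + \<Gamma>)" using assms by (intro divide_left_mono) auto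
  have 3: "(x\<^sup>2 - \<Gamma>) / (2 * a) = (x\<^sup>2 / a - \<Gamma> / a) / 2" for a :: real
    by (simp add: diff_divide_distrib)
  have 4: "p / 2 + (q - r) / 2 \<le> p' / 2 + (q' - r') / 2" if "p - p' \<le> r - r'" "q \<le> q'" for p p' q q' r r' ::
      real
    using that by argo
  show ?thesis unfolding 3 by (rule 4[OF 1 2])
qed

section \<open>The decoding metric\<close>

lemma exp_uminus_le_quadratic:
  fixes t :: real
  assumes "0 \<le> t"
  shows "exp (- t) \<le> 1 - t + t\<^sup>2 / 2"
proof -
  have q: "0 < 1 + t + t\<^sup>2 / 2" using assms by (simp add: add_pos_nonneg)
  have "exp (- t) = 1 / exp t" by (simp add: exp_minus inverse_eq_divide)
  also have "\<dots> \<le> 1 / (1 + t + t\<^sup>2 / 2)"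
    using exp_lower_Taylor_quadratic[OF assms] q by (intro divide_left_mono) auto
  also have "\<dots> \<le> 1 - t + t\<^sup>2 / 2"
  proof -
    have "(1 - t + t\<^sup>2 / 2) * (1 + t + t\<^sup>2 / 2) = 1 + (t\<^sup>2)\<^sup>2 / 4"
      by (simp add: field_simps power2_eq_square)
    then have "1 \<le> (1 - t + t\<^sup>2 / 2) * (1 + t + t\<^sup>2 / 2)" by simp
    then show ?thesis using q by (subst pos_divide_le_eq) auto
  qed
  finally show ?thesis .
qed

text \<open>An upper bound on the argument is enough: for positive \<open>t\<close> the Taylor
  remainder is at most \<open>exp B\<close>, and for negative \<open>t\<close> the coefficient 1/2
  already suffices. Exponential moments are reduced in this way to moments of order one and
  two.\<close>

lemma exp_le_quadratic:
  fixes t B :: real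
  assumes "t \<le> B" "0 \<le> B"
  shows "exp t \<le> 1 + t + t\<^sup>2 * exp B / 2"
proof (cases "0 \<le> t")
  case True
  obtain s where s: "\<bar>s\<bar> \<le> \<bar>t\<bar>" "exp t = (\<Sum>m<2. t ^ m / fact m) + exp s / fact 2 * t ^ 2"
    using Maclaurin_exp_le[of t 2] by blast
  have "exp s * t\<^sup>2 \<le> exp B * t\<^sup>2" using s(1) True assms by (intro mult_right_mono) auto
  then show ?thesis using s(2) by (simp add: numeral_2_eq_2 mult.commute)
next
  case False
  have "t\<^sup>2 * 1 \<le> t\<^sup>2 * exp B" using assms by (intro mult_left_mono) auto
  moreover have "exp t \<le> 1 + t + t\<^sup>2 / 2" using exp_uminus_le_quadratic[of "- t"] False by simp
  ultimately show ?thesis by argo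
qed

definition hop :: "real \<Rightarrow> 'k::finite \<Rightarrow> real ^ 'k" where
  "hop x k = x *\<^sub>R axis k 1"

lemma inner_hop [simp]: "inner (hop x k) y = x * y $ k"
  by (simp add: hop_def inner_commute inner_axis)

lemma hop_nth: "hop x k $ l = (if l = k then x else 0)"
  by (simp add: hop_def axis_def)

lemma hop_eq_0 [simp]: "hop x k = 0 \<longleftrightarrow> x = 0"
  by (simp add: hop_def axis_eq_0_iff)

lemma norm_hop [simp]: "norm (hop x k) = \<bar>x\<bar>"
  by (simp add: hop_def)

lemma measurable_hop [measurable (raw)]:
  assumes [measurable]: "f \<in> borel_measurable M" and g: "g \<in> measurable M (count_space UNIV)"
  shows "(\<lambda>p. hop (f p) (g p :: 'k::finite)) \<in> borel_measurable M"
  by (rule measurable_compose_countable[OF _ g]) (simp add: hop_def)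

text \<open>
  Mixing the Gaussian likelihood ratio with the constant 1 bounds the score below, so
  that single jamming pulses of high energy can do only limited harm, while the expectation of
  its exponential over an independent codeword symbol is still 1.
\<close>

definition mix :: "real \<Rightarrow> real \<Rightarrow> real" where
  "mix \<eta> d = ln (\<eta> + (1 - \<eta>) * exp d)"

context
  fixes \<eta> :: real assumes \<eta>: "0 < \<eta>" "\<eta> < 1"
begin

lemma mix_arg_pos: "0 < \<eta> + (1 - \<eta>) * exp d"
  using \<eta> by (simp add: add_pos_pos)

lemma exp_mix: "exp (mix \<eta> d) = \<eta> + (1 - \<eta>) * exp d"
  using mix_arg_pos by (simp add: mix_def)

lemma mix_ge_ln: "ln \<eta> \<le> mix \<eta> d"
  unfolding mix_def using \<eta> by (subst ln_le_cancel_iff) (auto simp: mix_arg_pos)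

text \<open>The price of the mixture is the constant \<open>ln (1 - \<eta>)\<close> per letter,
  which can be made as small as desired.\<close>

lemma mix_ge: "ln (1 - \<eta>) + d \<le> mix \<eta> d"
proof -
  have "exp (ln (1 - \<eta>) + d) \<le> exp (mix \<eta> d)"
    unfolding exp_mix using \<eta> by (simp add: exp_add)
  then show ?thesis by simp
qed

lemma mix_le_max: "mix \<eta> d \<le> max 0 d"
proof -
  have "(1 - \<eta>) * exp d \<le> (1 - \<eta>) * exp (max 0 d)" using \<eta> by (intro mult_left_mono) auto
  moreover have "\<eta> * 1 \<le> \<eta> * exp (max 0 d)" using \<eta> by (intro mult_left_mono) auto
  ultimately have "exp (mix \<eta> d) \<le> exp (max 0 d)"
    unfolding exp_mix by (simp add: algebra_simps)
  then show ?thesis by simp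
qed

lemma mix_square_le:
  assumes "d \<le> B" "0 \<le> B"
  shows "(mix \<eta> d)\<^sup>2 \<le> (ln \<eta>)\<^sup>2 + B\<^sup>2"
proof (cases "0 \<le> mix \<eta> d")
  case True
  then have "(mix \<eta> d)\<^sup>2 \<le> B\<^sup>2" using mix_le_max[of d] assms by (intro power_mono) auto
  then show ?thesis by (simp add: add_increasing)
next
  case False
  then have "(- mix \<eta> d)\<^sup>2 \<le> (- ln \<eta>)\<^sup>2" using mix_ge_ln[of d] by (intro power_mono) auto
  then show ?thesis by (simp add: add_increasing2)
qed

text \<open>The floor \<open>ln \<eta>\<close> bounds the exponent by \<open>- ln \<eta>\<close>,
  which yields the factor \<open>1 / \<eta>\<close>. In the linear term \<open>mix\<close> is
  replaced by \<open>d\<close>, which may be very negative but enters with a first power only. In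
  the quadratic term the two-sided bound on \<open>mix\<close> removes \<open>d\<close>
  altogether.\<close>

lemma exp_mix_le_quadratic:
  assumes "d \<le> B" "0 \<le> B" "0 \<le> l" "l \<le> 1"
  shows "exp (- l * mix \<eta> d) \<le> 1 - l * (ln (1 - \<eta>) + d) + l\<^sup>2 * ((ln \<eta>)\<^sup>2 + B\<^sup>2) / (2 * \<eta>)"
proof -
  have ln_neg: "ln \<eta> < 0" using \<eta> by simp
  have "- l * mix \<eta> d \<le> - ln \<eta>"
  proof -
    have "l * (- mix \<eta> d) \<le> l * (- ln \<eta>)" using mix_ge_ln[of d] assms by (intro mult_left_mono) auto
    also have "\<dots> \<le> 1 * (- ln \<eta>)" using assms ln_neg by (intro mult_right_mono) auto
    finally show ?thesis by simp
  qed
  then have "exp (- l * mix \<eta> d) \<le> 1 + (- l * mix \<eta> d) + (- l * mix \<eta> d)\<^sup>2 * exp (- ln \<eta>) / 2"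
    using ln_neg by (intro exp_le_quadratic) auto
  moreover have "exp (- ln \<eta>) = 1 / \<eta>" using \<eta> by (simp add: exp_minus inverse_eq_divide)
  moreover have "(- l * mix \<eta> d)\<^sup>2 * (1 / \<eta>) / 2 \<le> l\<^sup>2 * ((ln \<eta>)\<^sup>2 + B\<^sup>2) / (2 * \<eta>)"
  proof -
    have "l\<^sup>2 * (mix \<eta> d)\<^sup>2 / (2 * \<eta>) \<le> l\<^sup>2 * ((ln \<eta>)\<^sup>2 + B\<^sup>2) / (2 * \<eta>)"
      using mix_square_le[OF assms(1,2)] \<eta> by (intro divide_right_mono mult_left_mono) auto
    then show ?thesis by (simp add: power_mult_distrib mult.commute)
  qed
  moreover have "l * (ln (1 - \<eta>) + d) \<le> l * mix \<eta> d"
    using mix_ge[of d] assms by (intro mult_left_mono) auto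
  ultimately show ?thesis by auto
qed

end

text \<open>The defect is a square divided by a positive number. The bound depends on the symbol
  \<open>x\<close> alone, so it holds uniformly over noise and jamming and can serve as
  \<open>B\<close> above.\<close>

lemma log_ratio_le:
  assumes "0 < v" "0 < \<Gamma>"
  shows "log_ratio v \<Gamma> x y \<le> ln (1 + \<Gamma> / v) / 2 + x\<^sup>2 / (2 * \<Gamma>)"
proof -
  have "x\<^sup>2 / (2 * \<Gamma>) + (y - x)\<^sup>2 / (2 * v) - y\<^sup>2 / (2 * (v + \<Gamma>)) = (v * x + \<Gamma> * (x - y))\<^sup>2 / (2 * \<Gamma> * v *
      (v + \<Gamma>))"
  proof -
    have "v + \<Gamma> \<noteq> 0" "v \<noteq> 0" "\<Gamma> \<noteq> 0" using assms by auto
    then show ?thesis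
      apply (simp add: divide_simps power2_eq_square)
      apply (simp add: algebra_simps)
      done
  qed
  moreover have "0 \<le> (v * x + \<Gamma> * (x - y))\<^sup>2 / (2 * \<Gamma> * v * (v + \<Gamma>))" using assms by simp
  ultimately show ?thesis unfolding log_ratio_def by linarith
qed

lemma gauss_moments:
  assumes g: "0 < g"
  shows "integrable (gauss 0 g) (\<lambda>x. x)" "integral\<^sup>L (gauss 0 g) (\<lambda>x. x) = 0"
    "integrable (gauss 0 g) (\<lambda>x. x\<^sup>2)" "integral\<^sup>L (gauss 0 g) (\<lambda>x. x\<^sup>2) = g"
    "integrable (gauss 0 g) (\<lambda>x. x ^ 4)" "integral\<^sup>L (gauss 0 g) (\<lambda>x. x ^ 4) = 3 * g\<^sup>2"
proof -
  have s: "0 < sqrt g" using g by simp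
  have *: "integrable (gauss 0 g) (\<lambda>x. x ^ k)"
    and **: "integral\<^sup>L (gauss 0 g) (\<lambda>x. x ^ k) = integral\<^sup>L lborel (\<lambda>x. normal_density 0 (sqrt g) x * (x -
        0) ^ k)" for k
    using integrable_normal_moment[OF s, of 0 k] unfolding gauss_def
    by (auto simp: integrable_density integral_density)
  from *[of 1] *[of 2] *[of 4] show "integrable (gauss 0 g) (\<lambda>x. x)" "integrable (gauss 0 g) (\<lambda>x. x\<^sup>2)"
      "integrable (gauss 0 g) (\<lambda>x. x ^ 4)"
    by simp_all
  show "integral\<^sup>L (gauss 0 g) (\<lambda>x. x) = 0"
    using **[of 1] integral_normal_moment_odd[OF s, of 0 0] by simp
  show "integral\<^sup>L (gauss 0 g) (\<lambda>x. x\<^sup>2) = g"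
    unfolding ** using integral_normal_moment_even[OF s, of 0 1] g by simp
  show "integral\<^sup>L (gauss 0 g) (\<lambda>x. x ^ 4) = 3 * g\<^sup>2"
    unfolding ** using integral_normal_moment_even[OF s, of 0 2] g by (simp add: fact_numeral field_simps)
qed

text \<open>
  For \<open>u = hop x k\<close> with \<open>x \<noteq> 0\<close> the terms in \<open>u\<close> and \<open>y\<close> reduce to \<open>x\<close> and \<open>y $ k\<close>, so the decoder
  needs no separate access to the hopping sequence.
\<close>

definition letter_score :: "real \<Rightarrow> real \<Rightarrow> real \<Rightarrow> real ^ 'k::finite \<Rightarrow> real ^ 'k \<Rightarrow> real" where
  "letter_score c g \<eta> u y = (if u = 0 then 0 else mix \<eta> (ln (1 + g / c) / 2
     - (inner u u - 2 * inner u y + (inner u y)\<^sup>2 / inner u u) / (2 * c) + (inner u y)\<^sup>2 / inner u u / (2 *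
         (c + g))))"

lemma letter_score_hop: "x \<noteq> 0 \<Longrightarrow> letter_score c g \<eta> (hop x k) y = mix \<eta> (log_ratio c g x (y $ k))"
  by (simp add: letter_score_def log_ratio_def hop_nth power2_eq_square algebra_simps)

lemma measurable_letter_score [measurable (raw)]:
  assumes [measurable]: "f \<in> borel_measurable M" "h \<in> borel_measurable M"
  shows "(\<lambda>p. letter_score c g \<eta> (f p) (h p :: real ^ 'k::finite)) \<in> borel_measurable M"
  unfolding letter_score_def mix_def by measurable

text \<open>The coefficient of \<open>l\<^sup>2\<close> after averaging over the Gaussian symbol:
  the summand 3/2 is the mean of \<open>x ^ 4 / (2 * g\<^sup>2)\<close>.\<close>

definition spread :: "real \<Rightarrow> real \<Rightarrow> real \<Rightarrow> real" where
  "spread c g \<eta> = ((ln \<eta>)\<^sup>2 + 2 * (ln (1 + g / c) / 2)\<^sup>2 + 3 / 2) / (2 * \<eta>)"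

text \<open>Here \<open>w\<close> stands for the energy of noise plus jamming in the subchannel in
  use. At \<open>w = c\<close> the two fractions cancel and the linear term is the Gaussian rate
  \<open>ln (1 + g / c) / 2\<close> minus the loss due to \<eta>.\<close>

definition letter_bound :: "real \<Rightarrow> real \<Rightarrow> real \<Rightarrow> real \<Rightarrow> real \<Rightarrow> real" where
  "letter_bound c g \<eta> l w = 1 - l * (ln (1 - \<eta>) + ln (1 + g / c) / 2 + g / (2 * (c + g)) - g / (2 * c * (c +
      g)) * w) + l\<^sup>2 * spread c g \<eta>"

context
  fixes c g \<eta> :: real assumes c: "0 < c" and g: "0 < g" and \<eta>: "0 < \<eta>" "\<eta> < 1"
begin

text \<open>Both components of the mixture have mean 1, for every output and every hop. This gives a
  wrong codeword its exponentially small chance of reaching the threshold, whatever the jammer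
  does.\<close>

lemma nn_integral_exp_letter_score_wrong:
  "(\<integral>\<^sup>+x. ennreal (exp (letter_score c g \<eta> (hop x k) y)) \<partial>gauss 0 g) = 1"
proof -
  interpret prob_space "gauss 0 g" using g by (rule prob_space_gauss)
  have "(\<integral>\<^sup>+x. ennreal (exp (letter_score c g \<eta> (hop x k) y)) \<partial>gauss 0 g)
      = (\<integral>\<^sup>+x. ennreal \<eta> + ennreal (1 - \<eta>) * ennreal (exp (log_ratio c g x (y $ k))) \<partial>gauss 0 g)"
    using AE_gauss_neq[of 0 0 g]
    by (intro nn_integral_cong_AE, eventually_elim)
      (use \<eta> in \<open>simp add: letter_score_hop exp_mix ennreal_plus[symmetric] ennreal_mult[symmetric] del:
          ennreal_plus\<close>)
  also have "\<dots> = ennreal \<eta> + ennreal (1 - \<eta>) * 1"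
    using emeasure_space_1
    by (simp add: nn_integral_add nn_integral_cmult nn_integral_exp_log_ratio_codeword[OF c g])
  also have "\<dots> = 1"
    using \<eta> by (simp add: ennreal_plus[symmetric] del: ennreal_plus)
  finally show ?thesis .
qed

text \<open>The interference in the subchannel in use is \<open>z $ k\<close>; the bound depends on
  it through its square only, because the symbol is centered.\<close>

lemma
  assumes l: "0 \<le> l" "l \<le> 1"
  shows nn_integral_exp_letter_score_true:
      "(\<integral>\<^sup>+x. ennreal (exp (- l * letter_score c g \<eta> (hop x k) (hop x k + z))) \<partial>gauss 0 g) \<le> ennreal
          (letter_bound c g \<eta> l ((z $ k)\<^sup>2))"
    and letter_bound_nonneg: "0 \<le> letter_bound c g \<eta> l ((z $ k)\<^sup>2)"
proof -
  interpret prob_space "gauss 0 g" using g by (rule prob_space_gauss)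
  define L where "L = ln (1 + g / c) / 2"
  define t where "t = z $ k"
  \<comment> \<open>A polynomial majorant in the symbol \<open>x\<close>, obtained from
    \<open>(a + b)\<^sup>2 \<le> 2 * a\<^sup>2 + 2 * b\<^sup>2\<close> for the quadratic term; its
    mean needs Gaussian moments up to order four.\<close>
  define p where "p x = 1 - l * (ln (1 - \<eta>) + (L - t\<^sup>2 / (2 * c) + (x\<^sup>2 + 2 * x * t + t\<^sup>2) / (2 * (c + g))))
     + l\<^sup>2 * ((ln \<eta>)\<^sup>2 + (2 * L\<^sup>2 + x ^ 4 / (2 * g\<^sup>2))) / (2 * \<eta>)" for x
  have L: "0 \<le> L" using c g by (simp add: L_def)
  have le: "exp (- l * mix \<eta> (log_ratio c g x (x + t))) \<le> p x" for x
  proof -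
    have B: "log_ratio c g x (x + t) \<le> L + x\<^sup>2 / (2 * g)" "0 \<le> L + x\<^sup>2 / (2 * g)"
      using log_ratio_le[OF c g] L g by (auto simp: L_def)
    have "exp (- l * mix \<eta> (log_ratio c g x (x + t)))
       \<le> 1 - l * (ln (1 - \<eta>) + log_ratio c g x (x + t)) + l\<^sup>2 * ((ln \<eta>)\<^sup>2 + (L + x\<^sup>2 / (2 * g))\<^sup>2) / (2 * \<eta>)"
      by (rule exp_mix_le_quadratic[OF \<eta> B l])
    also have "(L + x\<^sup>2 / (2 * g))\<^sup>2 \<le> 2 * L\<^sup>2 + x ^ 4 / (2 * g\<^sup>2)"
    proof -
      have "0 \<le> (L - x\<^sup>2 / (2 * g))\<^sup>2" by simp
      then have "(L + x\<^sup>2 / (2 * g))\<^sup>2 \<le> 2 * L\<^sup>2 + 2 * (x\<^sup>2 / (2 * g))\<^sup>2" by (simp add: power2_eq_square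
          algebra_simps)
      also have "2 * (x\<^sup>2 / (2 * g))\<^sup>2 = x ^ 4 / (2 * g\<^sup>2)" using g by (simp add: field_simps
          power2_eq_square power4_eq_xxxx)
      finally show ?thesis .
    qed
    then have "l\<^sup>2 * ((ln \<eta>)\<^sup>2 + (L + x\<^sup>2 / (2 * g))\<^sup>2) / (2 * \<eta>) \<le> l\<^sup>2 * ((ln \<eta>)\<^sup>2 + (2 * L\<^sup>2 + x ^ 4 / (2
        * g\<^sup>2))) / (2 * \<eta>)"
      using \<eta> by (intro divide_right_mono mult_left_mono add_left_mono) auto
    finally show ?thesis by (simp add: p_def log_ratio_def L_def power2_eq_square algebra_simps)
  qed
  \<comment> \<open>The moments 0, \<open>g\<close> and \<open>3 * g\<^sup>2\<close> are
    substituted; the cross term \<open>2 * x * t\<close> has mean 0.\<close>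
  have p_has: "integrable (gauss 0 g) p \<and> integral\<^sup>L (gauss 0 g) p
     = 1 - l * (ln (1 - \<eta>) + (L - t\<^sup>2 / (2 * c) + (g + 2 * 0 * t + t\<^sup>2) / (2 * (c + g))))
     + l\<^sup>2 * ((ln \<eta>)\<^sup>2 + (2 * L\<^sup>2 + (3 * g\<^sup>2) / (2 * g\<^sup>2))) / (2 * \<eta>)"
    unfolding p_def using gauss_moments[OF g] prob_space[unfolded space_gauss] by simp
  have "(\<integral>\<^sup>+x. ennreal (exp (- l * letter_score c g \<eta> (hop x k) (hop x k + z))) \<partial>gauss 0 g)
      = (\<integral>\<^sup>+x. ennreal (exp (- l * mix \<eta> (log_ratio c g x (x + t)))) \<partial>gauss 0 g)"
    using AE_gauss_neq[of 0 0 g]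
    by (intro nn_integral_cong_AE, eventually_elim) (simp add: letter_score_hop t_def hop_nth)
  also have "\<dots> \<le> (\<integral>\<^sup>+x. ennreal (p x) \<partial>gauss 0 g)"
    using le by (intro nn_integral_mono ennreal_leI)
  also have "\<dots> = ennreal (integral\<^sup>L (gauss 0 g) p)"
    using p_has order_trans[OF exp_ge_zero le] by (intro nn_integral_eq_integral AE_I2) auto
  also have eq: "integral\<^sup>L (gauss 0 g) p = letter_bound c g \<eta> l (t\<^sup>2)"
  proof -
    have "t\<^sup>2 / (2 * c) = t\<^sup>2 / (2 * (c + g)) + g / (2 * c * (c + g)) * t\<^sup>2"
      using c g by (simp add: divide_simps add_pos_pos) (simp add: algebra_simps)
    then show ?thesis
      using p_has g by (simp add: letter_bound_def spread_def L_def[symmetric] add_divide_distrib algebra_simps)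
  qed
  finally show "(\<integral>\<^sup>+x. ennreal (exp (- l * letter_score c g \<eta> (hop x k) (hop x k + z))) \<partial>gauss 0 g) \<le>
      ennreal (letter_bound c g \<eta> l ((z $ k)\<^sup>2))"
    unfolding t_def .
  \<comment> \<open>The sign of \<open>letter_bound\<close> is not visible from its formula; it is
    the mean of a majorant of an exponential.\<close>
  have "0 \<le> integral\<^sup>L (gauss 0 g) p" using order_trans[OF exp_ge_zero le] by (intro integral_nonneg_AE AE_I2)
  then show "0 \<le> letter_bound c g \<eta> l ((z $ k)\<^sup>2)" unfolding eq t_def .
qed

end

section \<open>Random codes\<close>

lemma space_signal_space: "space (signal_space n) = {1..n} \<rightarrow>\<^sub>E UNIV"
  by (simp add: signal_space_def space_PiM)

lemma sets_PiM_signal: "sets \<mu> = sets borel \<Longrightarrow> sets (PiM {1..n} (\<lambda>_. \<mu>)) = sets (signal_space n)"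
  unfolding signal_space_def by (intro sets_PiM_cong) auto

lemma measurable_signal_component [measurable (raw)]:
  assumes "f \<in> measurable M (signal_space n)" "i \<in> {1..n}"
  shows "(\<lambda>p. f p i) \<in> borel_measurable M"
  using measurable_compose[OF assms(1)[unfolded signal_space_def] measurable_component_singleton[OF assms(2)]] .

lemma measurable_restrict_signal [measurable (raw)]:
  assumes "\<And>i. i \<in> {1..n} \<Longrightarrow> f i \<in> borel_measurable M"
  shows "(\<lambda>p. \<lambda>i\<in>{1..n}. f i p) \<in> measurable M (signal_space n)"
  unfolding signal_space_def using assms by (rule measurable_restrict)

section \<open>Error probabilities of random codes and their measurability\<close>

definition received :: "nat \<Rightarrow> 'k::finite signal \<Rightarrow> 'k signal \<Rightarrow> 'k signal \<Rightarrow> 'k signal" where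
  "received n u s z = (\<lambda>i\<in>{1..n}. u i + s i + z i)"

lemma measurable_received [measurable (raw)]:
  assumes [measurable]: "u \<in> measurable M (signal_space n)" "s \<in> measurable M (signal_space n)" "z \<in>
      measurable M (signal_space n)"
  shows "(\<lambda>p. received n (u p) (s p) (z p)) \<in> measurable M (signal_space n)"
  unfolding received_def by measurable

definition msg_error :: "(real ^ 'k::finite) measure \<Rightarrow> nat \<Rightarrow> 'k code \<Rightarrow> 'k signal \<Rightarrow> nat \<Rightarrow> real" where
  "msg_error \<mu> n c s m = measure (PiM {1..n} (\<lambda>_. \<mu>))
     {z \<in> space (PiM {1..n} (\<lambda>_. \<mu>)). snd c (received n (fst c m) s z) \<noteq> m}"

lemma code_error_eq: "code_error \<mu> n M c s = (1 / real M) * (\<Sum>m=1..M. msg_error \<mu> n c s m)"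
  by (simp add: code_error_def msg_error_def received_def case_prod_unfold)

context
  fixes \<mu> :: "(real ^ 'k::finite) measure" and n M :: nat and \<Gamma> :: real and Q :: "'k code measure"
  assumes mu: "prob_space \<mu>" "sets \<mu> = sets borel" and Q: "cr_code n \<Gamma> M Q"
begin

lemma sets_noise [measurable_cong]: "sets (PiM {1..n} (\<lambda>_. \<mu>)) = sets (signal_space n)"
  by (rule sets_PiM_signal[OF mu(2)])

text \<open>Code, jamming and noise may all be random. The received signal depends on the code
  through its encoder, so the joint measurability of the decoder in code and output is what makes
  the composition measurable.\<close>

lemma measurable_cr_decode:
  assumes m: "m \<in> {1..M}"
    and [measurable]: "c \<in> measurable N Q" "s \<in> measurable N (signal_space n)" "z \<in> measurable N
        (signal_space n)"
  shows "(\<lambda>p. snd (c p) (received n (fst (c p) m) (s p) (z p))) \<in> measurable N (count_space {1..M})"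
proof -
  have [measurable]: "(\<lambda>(f, \<phi>). f m) \<in> measurable Q (signal_space n)" using Q m unfolding cr_code_def by blast
  then have [measurable]: "(\<lambda>x. fst x m) \<in> measurable Q (signal_space n)" by (simp add: case_prod_unfold)
  have D: "(\<lambda>x. snd (fst x) (snd x)) \<in> measurable (Q \<Otimes>\<^sub>M signal_space n) (count_space {1..M})"
    using Q unfolding cr_code_def case_prod_unfold by blast
  have [measurable]: "(\<lambda>p. fst (c p) m) \<in> measurable N (signal_space n)"
    by (rule measurable_compose[of c N Q]) auto
  have "(\<lambda>p. (c p, received n (fst (c p) m) (s p) (z p))) \<in> measurable N (Q \<Otimes>\<^sub>M signal_space n)"
    by measurable
  from measurable_compose[OF this D] show ?thesis by simp
qed

lemma measurable_cr_decode_pred: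
  assumes "m \<in> {1..M}"
    and "c \<in> measurable N Q" "s \<in> measurable N (signal_space n)" "z \<in> measurable N (signal_space n)"
  shows "Measurable.pred N (\<lambda>p. snd (c p) (received n (fst (c p) m) (s p) (z p)) \<noteq> m)"
  using measurable_compose[OF measurable_cr_decode[OF assms], of "\<lambda>k. k \<noteq> m" "count_space UNIV"] by simp

text \<open>As an integral of an indicator, the error probability becomes accessible to Fubini's
  theorem.\<close>

lemma ennreal_msg_error:
  assumes m: "m \<in> {1..M}" and c: "c \<in> space Q" and s: "s \<in> space (signal_space n)"
  shows "ennreal (msg_error \<mu> n c s m)
    = (\<integral>\<^sup>+z. indicator {z. snd c (received n (fst c m) s z) \<noteq> m} z \<partial>PiM {1..n} (\<lambda>_. \<mu>))"
proof -
  interpret P: prob_space "PiM {1..n} (\<lambda>_. \<mu>)" by (intro prob_space_PiM mu)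
  have [measurable]: "Measurable.pred (PiM {1..n} (\<lambda>_. \<mu>)) (\<lambda>z. snd c (received n (fst c m) s z) \<noteq> m)"
    by (rule measurable_cr_decode_pred[OF m])
      (use c s in \<open>simp_all add: measurable_ident_sets[OF sets_noise] del: One_nat_def\<close>)
  have "ennreal (msg_error \<mu> n c s m) = emeasure (PiM {1..n} (\<lambda>_. \<mu>))
     {z \<in> space (PiM {1..n} (\<lambda>_. \<mu>)). snd c (received n (fst c m) s z) \<noteq> m}"
    unfolding msg_error_def by (rule P.emeasure_eq_measure[symmetric])
  also have "\<dots> = (\<integral>\<^sup>+z. indicator {z \<in> space (PiM {1..n} (\<lambda>_. \<mu>)). snd c (received n (fst c m) s z) \<noteq> m} z
      \<partial>PiM {1..n} (\<lambda>_. \<mu>))"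
    by (rule nn_integral_indicator[symmetric]) measurable
  also have "\<dots> = (\<integral>\<^sup>+z. indicator {z. snd c (received n (fst c m) s z) \<noteq> m} z \<partial>PiM {1..n} (\<lambda>_. \<mu>))"
    by (intro nn_integral_cong) (auto simp: indicator_def)
  finally show ?thesis .
qed

text \<open>Joint measurability in the code and the jamming signal is needed in the converse, where
  the averages over random code and random jamming are exchanged.\<close>

lemma measurable_msg_error:
  assumes m: "m \<in> {1..M}"
  shows "(\<lambda>(c, s). msg_error \<mu> n c s m) \<in> borel_measurable (Q \<Otimes>\<^sub>M signal_space n)"
proof -
  interpret P: prob_space "PiM {1..n} (\<lambda>_. \<mu>)" by (intro prob_space_PiM mu)
  have [measurable]: "Measurable.pred ((Q \<Otimes>\<^sub>M signal_space n) \<Otimes>\<^sub>M PiM {1..n} (\<lambda>_. \<mu>))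
     (\<lambda>p. snd (fst (fst p)) (received n (fst (fst (fst p)) m) (snd (fst p)) (snd p)) \<noteq> m)"
    by (rule measurable_cr_decode_pred[OF m]) measurable
  have "(\<lambda>p. enn2real (\<integral>\<^sup>+z. indicator {z. snd (fst p) (received n (fst (fst p) m) (snd p) z) \<noteq> m} z \<partial>PiM
      {1..n} (\<lambda>_. \<mu>)))
      \<in> borel_measurable (Q \<Otimes>\<^sub>M signal_space n)"
    by measurable
  then show ?thesis
  proof (subst measurable_cong)
    fix p :: "'k code \<times> 'k signal" assume "p \<in> space (Q \<Otimes>\<^sub>M signal_space n)"
    then have "ennreal (msg_error \<mu> n (fst p) (snd p) m)
      = (\<integral>\<^sup>+z. indicator {z. snd (fst p) (received n (fst (fst p) m) (snd p) z) \<noteq> m} z \<partial>PiM {1..n} (\<lambda>_. \<mu>))"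
      by (intro ennreal_msg_error[OF m]) (auto simp: space_pair_measure)
    from this[symmetric] show "(case p of (c, s) \<Rightarrow> msg_error \<mu> n c s m)
      = enn2real (\<integral>\<^sup>+z. indicator {z. snd (fst p) (received n (fst (fst p) m) (snd p) z) \<noteq> m} z \<partial>PiM {1..n}
          (\<lambda>_. \<mu>))"
      by (simp add: case_prod_unfold) (simp add: msg_error_def)
  qed
qed

end

lemma msg_error_nonneg: "0 \<le> msg_error \<mu> n c s m"
  by (simp add: msg_error_def)

lemma msg_error_le_1: "prob_space \<mu> \<Longrightarrow> msg_error \<mu> n c s m \<le> 1"
  unfolding msg_error_def by (intro prob_space.prob_le_1 prob_space_PiM)

section \<open>Threshold decoding and Gaussian hopping codebooks\<close>

definition score :: "real \<Rightarrow> real \<Rightarrow> real \<Rightarrow> nat \<Rightarrow> 'k::finite signal \<Rightarrow> 'k signal \<Rightarrow> real" where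
  "score c g \<eta> n u y = (\<Sum>i=1..n. letter_score c g \<eta> (u i) (y i))"

lemma measurable_score [measurable (raw)]:
  assumes [measurable]: "u \<in> measurable M (signal_space n)" "y \<in> measurable M (signal_space n)"
  shows "(\<lambda>p. score c g \<eta> n (u p) (y p)) \<in> borel_measurable M"
  unfolding score_def by measurable

text \<open>A wrong decision requires that the sent message misses the threshold or another one
  reaches it. The default 1 keeps the value inside the message set.\<close>

definition decode :: "('k::finite signal \<Rightarrow> 'k signal \<Rightarrow> real) \<Rightarrow> real \<Rightarrow> nat \<Rightarrow> (nat \<Rightarrow> 'k signal) \<Rightarrow> 'k signal \<Rightarrow>
    nat" where
  "decode d T M f y = (if \<exists>m\<in>{1..M}. T \<le> d (f m) y then LEAST m. m \<in> {1..M} \<and> T \<le> d (f m) y else 1)"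

lemma decode_in:
  assumes "1 \<le> M" shows "decode d T M f y \<in> {1..M}"
proof (cases "\<exists>m\<in>{1..M}. T \<le> d (f m) y")
  case True
  then have "\<exists>m. m \<in> {1..M} \<and> T \<le> d (f m) y" by blast
  from LeastI_ex[OF this] show ?thesis by (simp only: decode_def True if_True)
qed (use assms in \<open>auto simp: decode_def\<close>)

lemma decode_error:
  assumes m: "m \<in> {1..M}" and "decode d T M f y \<noteq> m"
  shows "d (f m) y < T \<or> (\<exists>m'\<in>{1..M} - {m}. T \<le> d (f m') y)"
proof (rule ccontr)
  assume H: "\<not> ?thesis"
  then have "(LEAST m. m \<in> {1..M} \<and> T \<le> d (f m) y) = m"
    using m by (intro Least_equality) force+
  moreover have ex: "\<exists>m\<in>{1..M}. T \<le> d (f m) y" using H m by (intro bexI[of _ m]) simp_all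
  ultimately have "decode d T M f y = m" by (simp only: decode_def ex if_True)
  then show False using assms(2) by contradiction
qed

lemma measurable_decode:
  assumes M: "1 \<le> M"
    and d [measurable]: "\<And>m. m \<in> {1..M} \<Longrightarrow> (\<lambda>p. d (f p m) (y p)) \<in> borel_measurable N"
  shows "(\<lambda>p. decode d T M (f p) (y p)) \<in> measurable N (count_space {1..M})"
proof -
  have P: "Measurable.pred N (\<lambda>p. m \<in> {1..M} \<and> T \<le> d (f p m) (y p))" for m
    by (cases "m \<in> {1..M}") simp_all
  have "(\<lambda>p. decode d T M (f p) (y p)) \<in> measurable N (count_space UNIV)"
    unfolding decode_def using P by measurable
  then show ?thesis
    using decode_in[OF M, of d T]
    by (auto simp: measurable_count_space_eq2 measurable_count_space_eq2_countable)
qed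

type_synonym 'k seed = "(nat \<Rightarrow> 'k) \<times> (nat \<Rightarrow> nat \<Rightarrow> real)"

text \<open>
  The seed consists of the hopping sequence, common to all messages, and of one Gaussian
  sequence per message.  A sequence violating the power constraint is replaced by the zero
  codeword, which has score 0 and hence is never decoded.
\<close>

definition seed_law :: "'k::finite set \<Rightarrow> real \<Rightarrow> nat \<Rightarrow> nat \<Rightarrow> 'k seed measure" where
  "seed_law A g n M = PiM {1..n} (\<lambda>_. measure_pmf (pmf_of_set A)) \<Otimes>\<^sub>M PiM {1..M} (\<lambda>_. PiM {1..n} (\<lambda>_. gauss
      0 g))"

definition codeword :: "nat \<Rightarrow> real \<Rightarrow> (nat \<Rightarrow> 'k::finite) \<Rightarrow> (nat \<Rightarrow> real) \<Rightarrow> 'k signal" where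
  "codeword n \<Gamma> \<kappa> x = (\<lambda>i\<in>{1..n}. if (\<Sum>j=1..n. (x j)\<^sup>2) \<le> real n * \<Gamma> then hop (x i) (\<kappa> i) else 0)"

lemma codeword_in_codewords: "codeword n \<Gamma> \<kappa> x \<in> codewords n"
proof -
  have "\<exists>x k. (0 :: real ^ 'a) = x *\<^sub>R axis k 1" by (intro exI[of _ 0]) simp
  then show ?thesis by (auto simp: codewords_def codeword_def hop_def)
qed

lemma codeword_power:
  assumes "0 \<le> \<Gamma>"
  shows "(\<Sum>i=1..n. (norm (codeword n \<Gamma> \<kappa> x i))\<^sup>2) \<le> real n * \<Gamma>"
proof (cases "(\<Sum>j=1..n. (x j)\<^sup>2) \<le> real n * \<Gamma>")
  case True
  then have "(\<Sum>i=1..n. (norm (codeword n \<Gamma> \<kappa> x i))\<^sup>2) = (\<Sum>j=1..n. (x j)\<^sup>2)"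
    by (intro sum.cong) (auto simp: codeword_def)
  then show ?thesis using True by simp
next
  case False
  then have "(\<Sum>i=1..n. (norm (codeword n \<Gamma> \<kappa> x i))\<^sup>2) = 0"
    by (intro sum.neutral) (auto simp: codeword_def)
  then show ?thesis using assms by simp
qed

definition codebook :: "nat \<Rightarrow> real \<Rightarrow> nat \<Rightarrow> 'k::finite seed \<Rightarrow> nat \<Rightarrow> 'k signal" where
  "codebook n \<Gamma> M \<omega> = (\<lambda>m\<in>{1..M}. codeword n \<Gamma> (fst \<omega>) (snd \<omega> m))"

lemma measurable_codebook_component:
  assumes m: "m \<in> {1..M}"
  shows "(\<lambda>\<omega>. codeword n \<Gamma> (fst \<omega>) (snd \<omega> m)) \<in> measurable (seed_law A g n M) (signal_space n)"
proof -
  have X: "(\<lambda>\<omega>. snd \<omega> m i) \<in> borel_measurable (seed_law A g n M)" if "i \<in> {1..n}" for i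
  proof -
    have "(\<lambda>\<omega>. snd \<omega> m) \<in> measurable (seed_law A g n M) (PiM {1..n} (\<lambda>_. gauss 0 g))"
      unfolding seed_law_def
      by (rule measurable_compose[OF measurable_snd measurable_component_singleton[OF m]])
    from measurable_compose[OF this measurable_component_singleton[OF that]] show ?thesis
      by (simp cong: measurable_cong_sets)
  qed
  have K: "(\<lambda>\<omega>. fst \<omega> i) \<in> measurable (seed_law A g n M) (count_space UNIV)" if "i \<in> {1..n}" for i
  proof -
    have "(\<lambda>\<omega>. fst \<omega> i) \<in> measurable (seed_law A g n M) (measure_pmf (pmf_of_set A))"
      unfolding seed_law_def
      by (rule measurable_compose[OF measurable_fst measurable_component_singleton[OF that]])
    then show ?thesis by (simp cong: measurable_cong_sets)
  qed
  note [measurable] = X K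
  show ?thesis unfolding codeword_def by measurable
qed

lemma measurable_codebook:
  "codebook n \<Gamma> M \<in> measurable (seed_law A g n M) (PiM {1..M} (\<lambda>_. signal_space n))"
  unfolding codebook_def by (intro measurable_restrict measurable_codebook_component)

definition admissible_codebooks :: "nat \<Rightarrow> real \<Rightarrow> nat \<Rightarrow> (nat \<Rightarrow> 'k::finite signal) set" where
  "admissible_codebooks n \<Gamma> M = {f \<in> {1..M} \<rightarrow>\<^sub>E codewords n. \<forall>m\<in>{1..M}. (\<Sum>i=1..n. (norm (f m i))\<^sup>2) \<le> real n
      * \<Gamma>}"

text \<open>The decoder is a function of the codebook, so the sigma-algebra on codes is pulled back
  along \<open>fst\<close>; no sigma-algebra on the set of decoders is required. Restricting the
  space to the graph over the admissible codebooks makes every point a code that obeys the power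
  constraint.\<close>

definition random_code :: "('k::finite signal \<Rightarrow> 'k signal \<Rightarrow> real) \<Rightarrow> real \<Rightarrow> 'k set \<Rightarrow> real \<Rightarrow> nat \<Rightarrow> real \<Rightarrow> nat
    \<Rightarrow> 'k code measure" where
  "random_code d T A g n \<Gamma> M = distr (seed_law A g n M)
     (vimage_algebra ((\<lambda>f. (f, decode d T M f)) ` admissible_codebooks n \<Gamma> M) fst (PiM {1..M} (\<lambda>_.
         signal_space n)))
     (\<lambda>\<omega>. (codebook n \<Gamma> M \<omega>, decode d T M (codebook n \<Gamma> M \<omega>)))"

lemma prob_space_seed_law: "0 < g \<Longrightarrow> prob_space (seed_law A g n M)"
  unfolding seed_law_def by (intro prob_space_pair prob_space_PiM prob_space_measure_pmf prob_space_gauss)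

lemma codewords_subset: "codewords n \<subseteq> space (signal_space n)"
  by (auto simp: codewords_def space_signal_space)

lemma codebook_admissible: "0 \<le> \<Gamma> \<Longrightarrow> codebook n \<Gamma> M \<omega> \<in> admissible_codebooks n \<Gamma> M"
  using codeword_in_codewords codeword_power by (auto simp: admissible_codebooks_def codebook_def)

lemma measurable_random_code:
  assumes "0 \<le> \<Gamma>"
  shows "(\<lambda>\<omega>. (codebook n \<Gamma> M \<omega>, decode d T M (codebook n \<Gamma> M \<omega>))) \<in> measurable (seed_law A g n M)
    (vimage_algebra ((\<lambda>f. (f, decode d T M f)) ` admissible_codebooks n \<Gamma> M) fst (PiM {1..M} (\<lambda>_.
        signal_space n)))"
proof (rule measurable_vimage_algebra2)
  show "(\<lambda>\<omega>. (codebook n \<Gamma> M \<omega>, decode d T M (codebook n \<Gamma> M \<omega>)))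
     \<in> space (seed_law A g n M) \<rightarrow> (\<lambda>f. (f, decode d T M f)) ` admissible_codebooks n \<Gamma> M"
    by (intro Pi_I image_eqI[OF refl] codebook_admissible assms)
qed (use measurable_codebook in simp)

lemma cr_code_random_code:
  fixes A :: "'k::finite set"
  assumes g: "0 < g" and \<Gamma>: "0 \<le> \<Gamma>" and M: "1 \<le> M"
    and d: "\<And>(N :: ((nat \<Rightarrow> 'k signal) \<times> 'k signal) measure) u y. u \<in> measurable N (signal_space n) \<Longrightarrow> y \<in>
        measurable N (signal_space n) \<Longrightarrow> (\<lambda>p. d (u p) (y p)) \<in> borel_measurable N"
  shows "cr_code n \<Gamma> M (random_code d T A g n \<Gamma> M)"
proof -
  let ?Q = "random_code d T A g n \<Gamma> M"
  let ?C = "PiM {1..M} (\<lambda>_. signal_space n :: 'k signal measure)"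
  let ?X = "(\<lambda>f. (f, decode d T M f)) ` admissible_codebooks n \<Gamma> M"
  have space_Q: "space ?Q = ?X" by (simp add: random_code_def)
  have sub: "admissible_codebooks n \<Gamma> M \<subseteq> space ?C"
  proof -
    have "{1..M} \<rightarrow>\<^sub>E codewords n \<subseteq> {1..M} \<rightarrow>\<^sub>E space (signal_space n :: 'k signal measure)"
      by (intro PiE_mono codewords_subset)
    then show ?thesis by (auto simp: admissible_codebooks_def space_PiM)
  qed
  have dec: "(\<lambda>p. decode d T M (fst p) (snd p)) \<in> measurable (?C \<Otimes>\<^sub>M signal_space n) (count_space {1..M})"
    by (rule measurable_decode[OF M], rule d,
        rule measurable_compose[OF measurable_fst measurable_component_singleton], assumption, rule
            measurable_snd)
  have fstQ: "fst \<in> measurable ?Q ?C"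
    unfolding random_code_def using sub by (auto intro!: measurable_vimage_algebra1)
  have "(\<lambda>p. (fst (fst p), snd p)) \<in> measurable (?Q \<Otimes>\<^sub>M signal_space n) (?C \<Otimes>\<^sub>M signal_space n)"
    using fstQ by measurable
  from measurable_compose[OF this dec]
  have "(\<lambda>p. decode d T M (fst (fst p)) (snd p)) \<in> measurable (?Q \<Otimes>\<^sub>M signal_space n) (count_space {1..M})"
    by simp
  \<comment> \<open>On the space of the law the second component is determined by the first, so
    decoding is measurable because it is so as a function of codebook and output.\<close>
  then have "(\<lambda>((f, \<phi>), y). \<phi> y) \<in> measurable (?Q \<Otimes>\<^sub>M signal_space n) (count_space {1..M})"
    by (subst measurable_cong[where g = "\<lambda>p. decode d T M (fst (fst p)) (snd p)"])
      (auto simp: space_pair_measure space_Q)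
  moreover have "(\<lambda>(f, \<phi>). f m) \<in> measurable ?Q (signal_space n)" if "m \<in> {1..M}" for m
    using measurable_compose[OF fstQ measurable_component_singleton[OF that]] by (simp add: case_prod_unfold)
  moreover have "prob_space ?Q"
    unfolding random_code_def
    by (intro prob_space.prob_space_distr prob_space_seed_law g measurable_random_code \<Gamma>)
  moreover have "space ?Q \<subseteq> codes n \<Gamma> M"
  proof
    fix c assume "c \<in> space ?Q"
    then obtain f where f: "f \<in> admissible_codebooks n \<Gamma> M" and c: "c = (f, decode d T M f)"
      by (auto simp: space_Q)
    have "(\<lambda>y. (f, y)) \<in> measurable (signal_space n) (?C \<Otimes>\<^sub>M signal_space n)"
      using f sub by (intro measurable_Pair1') auto
    from measurable_compose[OF this dec] have "decode d T M f \<in> measurable (signal_space n) (count_space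
        {1..M})"
      by simp
    then show "c \<in> codes n \<Gamma> M" using f by (auto simp: c codes_def admissible_codebooks_def)
  qed
  ultimately show ?thesis using M unfolding cr_code_def by blast
qed

section \<open>Achievability\<close>

text \<open>The product form of the Chernoff bound: an event given by a nonnegative sum has its
  indicator dominated by a product that factors over time.\<close>

lemma one_le_prod_exp:
  assumes "0 \<le> (\<Sum>i\<in>I. a i)"
  shows "1 \<le> (\<Prod>i\<in>I. ennreal (exp (a i)))"
proof (cases "finite I")
  case True
  have "1 \<le> ennreal (exp (\<Sum>i\<in>I. a i))" using assms by simp
  also have "\<dots> = (\<Prod>i\<in>I. ennreal (exp (a i)))" by (subst prod_ennreal) (auto simp: exp_sum[OF True])
  finally show ?thesis .
qed simp

text \<open>Affinity in \<open>w\<close> lets the averages over noise, hops and time pass through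
  without loss, so the jammer gains nothing by redistributing its power.\<close>

lemma letter_bound_affine:
  "letter_bound c g \<eta> l w = letter_bound c g \<eta> l 0 + l * (g / (2 * c * (c + g))) * w"
proof -
  have "1 - l * (a - \<alpha> * w) + t = 1 - l * (a - \<alpha> * 0) + t + l * \<alpha> * w" for a \<alpha> t :: real
    by (simp add: algebra_simps)
  then show ?thesis unfolding letter_bound_def by this
qed

lemma letter_score_0 [simp]: "letter_score c g \<eta> 0 y = 0"
  by (simp add: letter_score_def)

text \<open>The two parts of the seed are separate arguments, so that the Gaussian sequences
  \<open>X\<close> can be averaged for fixed hops and noise.\<close>

definition wrong :: "(real \<times> real \<times> real) \<Rightarrow> real \<Rightarrow> nat \<Rightarrow> real \<Rightarrow> nat \<Rightarrow> nat \<Rightarrow> 'k::finite signal \<Rightarrow> (nat \<Rightarrow> 'k) \<Rightarrow>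
    'k signal \<Rightarrow> (nat \<Rightarrow> nat \<Rightarrow> real) \<Rightarrow> bool" where
  "wrong p \<tau> n \<Gamma> M m s \<kappa> z X \<longleftrightarrow> (case p of (c, g, \<eta>) \<Rightarrow> decode (score c g \<eta> n) (real n * \<tau>) M (codebook n \<Gamma> M
      (\<kappa>, X))
     (received n (codebook n \<Gamma> M (\<kappa>, X) m) s z) \<noteq> m)"

context
  fixes \<mu> :: "(real ^ 'k::finite) measure" and \<sigma>2 :: "'k \<Rightarrow> real" and A :: "'k set" and c g \<eta> l :: real
  assumes mu: "prob_space \<mu>" "sets \<mu> = sets borel"
    and mom: "\<And>k. integrable \<mu> (\<lambda>z. z $ k)" "\<And>k. integrable \<mu> (\<lambda>z. (z $ k)\<^sup>2)"
      "\<And>k. (\<integral>z. z $ k \<partial>\<mu>) = 0" "\<And>k. (\<integral>z. (z $ k)\<^sup>2 \<partial>\<mu>) = \<sigma>2 k"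
    and A: "A \<noteq> {}" and c: "0 < c" and g: "0 < g" and \<eta>: "0 < \<eta>" "\<eta> < 1" and l: "0 \<le> l" "l \<le> 1"
begin

text \<open>The noise is centered, so the cross term of jamming and noise vanishes and the mean
  energy in subchannel \<open>k\<close> is \<open>(v $ k)\<^sup>2 + \<sigma>2 k\<close>. Uniform
  hopping averages it over \<open>A\<close>. Finally \<open>1 + t \<le> exp t\<close> moves the
  affine bound into an exponent, where the time instants add up.\<close>

lemma nn_integral_letter_true:
  "(\<integral>\<^sup>+k. \<integral>\<^sup>+z. \<integral>\<^sup>+x. ennreal (exp (- l * letter_score c g \<eta> (hop x k) (hop x k + (v + z)))) \<partial>gauss 0 g \<partial>\<mu>
      \<partial>measure_pmf (pmf_of_set A))
    \<le> ennreal (exp (letter_bound c g \<eta> l ((\<Sum>k\<in>A. (v $ k)\<^sup>2 + \<sigma>2 k) / card A) - 1))"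
proof -
  interpret prob_space \<mu> by (rule mu)
  let ?B = "letter_bound c g \<eta> l" and ?b = "l * (g / (2 * c * (c + g)))"
  have card: "0 < card A" using A by (simp add: card_gt_0_iff)
  have z: "(\<integral>\<^sup>+z. \<integral>\<^sup>+x. ennreal (exp (- l * letter_score c g \<eta> (hop x k) (hop x k + (v + z)))) \<partial>gauss 0 g \<partial>\<mu>)
      \<le> ennreal (?B ((v $ k)\<^sup>2 + \<sigma>2 k)) \<and> 0 \<le> ?B ((v $ k)\<^sup>2 + \<sigma>2 k)" for k
  proof -
    have eq: "?B (((v + z) $ k)\<^sup>2) = (?B 0 + ?b * (v $ k)\<^sup>2) + 2 * ?b * v $ k * z $ k + ?b * (z $ k)\<^sup>2" for z
      by (subst letter_bound_affine) (simp only: vector_add_component power2_sum ring_distribs, simp)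
    have int: "integrable \<mu> (\<lambda>z. ?B (((v + z) $ k)\<^sup>2))"
      unfolding eq using mom by simp
    have eq: "(\<integral>z. ?B (((v + z) $ k)\<^sup>2) \<partial>\<mu>) = ?B ((v $ k)\<^sup>2 + \<sigma>2 k)"
      unfolding eq letter_bound_affine[of _ _ _ _ "_ + _"] using mom by (simp add: prob_space distrib_left)
    have nonneg: "0 \<le> ?B (((v + z) $ k)\<^sup>2)" for z by (rule letter_bound_nonneg[OF c g \<eta> l])
    have "(\<integral>\<^sup>+z. \<integral>\<^sup>+x. ennreal (exp (- l * letter_score c g \<eta> (hop x k) (hop x k + (v + z)))) \<partial>gauss 0 g \<partial>\<mu>)
       \<le> (\<integral>\<^sup>+z. ennreal (?B (((v + z) $ k)\<^sup>2)) \<partial>\<mu>)"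
      by (intro nn_integral_mono nn_integral_exp_letter_score_true[OF c g \<eta> l])
    also have "\<dots> = ennreal (?B ((v $ k)\<^sup>2 + \<sigma>2 k))"
      unfolding eq[symmetric] using int nonneg by (intro nn_integral_eq_integral AE_I2)
    finally show ?thesis using nonneg by (auto simp: eq[symmetric] intro!: integral_nonneg_AE)
  qed
  have "(\<integral>\<^sup>+k. \<integral>\<^sup>+z. \<integral>\<^sup>+x. ennreal (exp (- l * letter_score c g \<eta> (hop x k) (hop x k + (v + z)))) \<partial>gauss 0 g
      \<partial>\<mu> \<partial>measure_pmf (pmf_of_set A))
     \<le> (\<integral>\<^sup>+k. ennreal (?B ((v $ k)\<^sup>2 + \<sigma>2 k)) \<partial>measure_pmf (pmf_of_set A))"
    using z by (intro nn_integral_mono) blast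
  also have "\<dots> = (\<Sum>k\<in>A. ennreal (?B ((v $ k)\<^sup>2 + \<sigma>2 k))) / card A"
    using A by (intro nn_integral_pmf_of_set) auto
  also have "\<dots> = ennreal ((\<Sum>k\<in>A. ?B ((v $ k)\<^sup>2 + \<sigma>2 k)) / card A)"
    using z card by (simp add: sum_ennreal divide_ennreal sum_nonneg ennreal_of_nat_eq_real_of_nat)
  also have "(\<Sum>k\<in>A. ?B ((v $ k)\<^sup>2 + \<sigma>2 k)) / card A = ?B ((\<Sum>k\<in>A. (v $ k)\<^sup>2 + \<sigma>2 k) / card A)"
  proof -
    have "(\<Sum>k\<in>A. ?B ((v $ k)\<^sup>2 + \<sigma>2 k)) = (\<Sum>k\<in>A. ?B 0 + ?b * ((v $ k)\<^sup>2 + \<sigma>2 k))"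
      by (intro sum.cong refl letter_bound_affine)
    also have "\<dots> = card A * ?B 0 + ?b * (\<Sum>k\<in>A. (v $ k)\<^sup>2 + \<sigma>2 k)"
      by (subst sum.distrib) (simp only: sum_constant sum_distrib_left)
    finally show ?thesis
      using card A by (simp add: letter_bound_affine[of _ _ _ _ "_ / _"] add_divide_distrib)
  qed
  also have "ennreal \<dots> \<le> ennreal (exp (?B ((\<Sum>k\<in>A. (v $ k)\<^sup>2 + \<sigma>2 k) / card A) - 1))"
    using exp_ge_add_one_self[of "?B ((\<Sum>k\<in>A. (v $ k)\<^sup>2 + \<sigma>2 k) / card A) - 1"] by (intro ennreal_leI) simp
  finally show ?thesis .
qed

context
  fixes n M m :: nat and \<Gamma> \<tau> \<theta> \<rho> :: real and s :: "'k signal"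
  assumes n: "1 \<le> n" and m: "m \<in> {1..M}" and \<tau>: "0 < \<tau>" and \<theta>: "0 \<le> \<theta>" and \<rho>: "0 \<le> \<rho>"
    and tail: "(\<integral>\<^sup>+x. ennreal (exp (\<theta> * (x\<^sup>2 - \<Gamma>))) \<partial>gauss 0 g) \<le> ennreal \<rho>"
begin

text \<open>The three terms correspond to a power violation of the sent sequence, a sent codeword
  below the threshold, and another codeword reaching it. In the third term the output is formed with
  the actual, possibly zero, codeword, since only its independence of \<open>X m'\<close> will
  count.\<close>

lemma wrong_le:
  "indicator {X. wrong (c, g, \<eta>) \<tau> n \<Gamma> M m s \<kappa> z X} X \<le>
     (\<Prod>i\<in>{1..n}. ennreal (exp (\<theta> * ((X m i)\<^sup>2 - \<Gamma>))))
   + (\<Prod>i\<in>{1..n}. ennreal (exp (l * \<tau> - l * letter_score c g \<eta> (hop (X m i) (\<kappa> i)) (hop (X m i) (\<kappa> i) + (s i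
       + z i)))))
   + (\<Sum>m'\<in>{1..M} - {m}. \<Prod>i\<in>{1..n}. ennreal (exp (letter_score c g \<eta> (hop (X m' i) (\<kappa> i))
        (received n (codeword n \<Gamma> \<kappa> (X m)) s z i) - \<tau>)))" (is "_ \<le> ?a + ?b + (\<Sum>m'\<in>_. ?c m')")
proof (cases "wrong (c, g, \<eta>) \<tau> n \<Gamma> M m s \<kappa> z X")
  case True
  let ?y = "received n (codeword n \<Gamma> \<kappa> (X m)) s z"
  let ?ok = "\<lambda>m. (\<Sum>j=1..n. (X m j)\<^sup>2) \<le> real n * \<Gamma>"
  have cb: "codebook n \<Gamma> M (\<kappa>, X) m' = codeword n \<Gamma> \<kappa> (X m')" if "m' \<in> {1..M}" for m'
    using that by (simp add: codebook_def)
  have sc: "score c g \<eta> n (codeword n \<Gamma> \<kappa> x) y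
      = (if (\<Sum>j=1..n. (x j)\<^sup>2) \<le> real n * \<Gamma> then (\<Sum>i=1..n. letter_score c g \<eta> (hop (x i) (\<kappa> i)) (y i)) else
          0)" for x y
    by (auto simp: score_def codeword_def)
  \<comment> \<open>The threshold is positive, so a sequence replaced by the zero codeword, of score
    0, cannot reach it.\<close>
  have pos: "0 < real n * \<tau>" using n \<tau> by simp
  from True have "score c g \<eta> n (codeword n \<Gamma> \<kappa> (X m)) ?y < real n * \<tau>
      \<or> (\<exists>m'\<in>{1..M} - {m}. real n * \<tau> \<le> score c g \<eta> n (codeword n \<Gamma> \<kappa> (X m')) ?y)"
    using decode_error[OF m, of "score c g \<eta> n" "real n * \<tau>" "codebook n \<Gamma> M (\<kappa>, X)" "received n (codebook n
        \<Gamma> M (\<kappa>, X) m) s z"] m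
    by (auto simp: wrong_def cb)
  then consider "\<not> ?ok m" | "?ok m" "score c g \<eta> n (codeword n \<Gamma> \<kappa> (X m)) ?y < real n * \<tau>"
    | m' where "m' \<in> {1..M} - {m}" "real n * \<tau> \<le> score c g \<eta> n (codeword n \<Gamma> \<kappa> (X m')) ?y"
    by blast
  then have "1 \<le> ?a + ?b + (\<Sum>m'\<in>{1..M} - {m}. ?c m')"
  proof cases
    case 1
    have "1 \<le> ?a"
    proof (rule one_le_prod_exp)
      have "(\<Sum>i\<in>{1..n}. \<theta> * ((X m i)\<^sup>2 - \<Gamma>)) = \<theta> * ((\<Sum>j=1..n. (X m j)\<^sup>2) - real n * \<Gamma>)"
        by (simp add: sum_distrib_left[symmetric] sum_subtractf)
      then show "0 \<le> (\<Sum>i\<in>{1..n}. \<theta> * ((X m i)\<^sup>2 - \<Gamma>))" using 1 \<theta> by simp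
    qed
    then show ?thesis by (intro add_increasing2) auto
  next
    case 2
    have "1 \<le> ?b"
    proof (rule one_le_prod_exp)
      have y: "?y i = hop (X m i) (\<kappa> i) + (s i + z i)" if "i \<in> {1..n}" for i
        using that 2(1) by (simp add: received_def codeword_def algebra_simps)
      have "(\<Sum>i\<in>{1..n}. l * \<tau> - l * letter_score c g \<eta> (hop (X m i) (\<kappa> i)) (hop (X m i) (\<kappa> i) + (s i + z i)))
          = (\<Sum>i\<in>{1..n}. l * \<tau> - l * letter_score c g \<eta> (hop (X m i) (\<kappa> i)) (?y i))"
        by (intro sum.cong refl) (simp only: y)
      also have "\<dots> = l * (real n * \<tau> - score c g \<eta> n (codeword n \<Gamma> \<kappa> (X m)) ?y)"
        using 2(1) by (simp add: sc sum_subtractf sum_distrib_left[symmetric] algebra_simps)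
      finally show "0 \<le> (\<Sum>i\<in>{1..n}. l * \<tau> - l * letter_score c g \<eta> (hop (X m i) (\<kappa> i)) (hop (X m i) (\<kappa> i) +
          (s i + z i)))"
        using 2(2) l by simp
    qed
    then show ?thesis by (intro add_increasing2[OF _ add_increasing]) auto
  next
    case (3 m')
    then have ok: "?ok m'" using pos by (auto simp: sc split: if_splits)
    have "1 \<le> ?c m'"
    proof (rule one_le_prod_exp)
      show "0 \<le> (\<Sum>i\<in>{1..n}. letter_score c g \<eta> (hop (X m' i) (\<kappa> i)) (?y i) - \<tau>)"
        using 3(2) ok by (simp add: sc sum_subtractf)
    qed
    also have "?c m' \<le> (\<Sum>m'\<in>{1..M} - {m}. ?c m')" using 3(1) by (intro member_le_sum) auto
    finally show ?thesis by (intro add_increasing) auto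
  qed
  then show ?thesis by (auto simp: indicator_def)
qed simp

text \<open>The output depends on the Gaussian sequences through the sent one only. Resampling
  \<open>X m'\<close> gives mean 1 for each letter, hence \<open>exp (- \<tau>) ^ n\<close> per
  wrong message; the term of the sent codeword is left to be averaged over noise and hops.\<close>

lemma nn_integral_wrong_codebook:
  "(\<integral>\<^sup>+X. indicator {X. wrong (c, g, \<eta>) \<tau> n \<Gamma> M m s \<kappa> z X} X \<partial>PiM {1..M} (\<lambda>_. PiM {1..n} (\<lambda>_. gauss 0 g)))
    \<le> ennreal (\<rho> ^ n + real M * exp (- \<tau>) ^ n)
     + (\<Prod>i\<in>{1..n}. \<integral>\<^sup>+x. ennreal (exp (l * \<tau> - l * letter_score c g \<eta> (hop x (\<kappa> i)) (hop x (\<kappa> i) + (s i + z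
         i)))) \<partial>gauss 0 g)"
proof -
  let ?G = "PiM {1..n} (\<lambda>_. gauss 0 g)" and ?I = "{1..n}"
  let ?a = "\<lambda>x. \<Prod>i\<in>?I. ennreal (exp (\<theta> * ((x i)\<^sup>2 - \<Gamma>)))"
  let ?b = "\<lambda>x. \<Prod>i\<in>?I. ennreal (exp (l * \<tau> - l * letter_score c g \<eta> (hop (x i) (\<kappa> i)) (hop (x i) (\<kappa> i) + (s
      i + z i))))"
  let ?c = "\<lambda>m' X. \<Prod>i\<in>?I. ennreal (exp (letter_score c g \<eta> (hop (X m' i) (\<kappa> i)) (received n (codeword n \<Gamma> \<kappa>
      (X m)) s z i) - \<tau>))"
  have G: "prob_space ?G" by (intro prob_space_PiM prob_space_gauss g)
  have comp [measurable]: "(\<lambda>X. X m' i) \<in> borel_measurable (PiM {1..M} (\<lambda>_. ?G))" if "m' \<in> {1..M}" "i \<in> ?I"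
      for m' i
    using measurable_compose[OF measurable_component_singleton[OF that(1), of "\<lambda>_. ?G"]
        measurable_component_singleton[OF that(2)]] by simp
  have comp1 [measurable]: "(\<lambda>x. x i) \<in> borel_measurable ?G" if "i \<in> ?I" for i
    using measurable_component_singleton[OF that, of "\<lambda>_. gauss 0 g"] by simp
  have cw [measurable]: "(\<lambda>X. codeword n \<Gamma> \<kappa> (X m)) \<in> measurable (PiM {1..M} (\<lambda>_. ?G)) (signal_space n)"
    unfolding codeword_def using m by measurable
  have rec [measurable]: "(\<lambda>X. received n (codeword n \<Gamma> \<kappa> (X m)) s z i) \<in> borel_measurable (PiM {1..M} (\<lambda>_.
      ?G))" if "i \<in> ?I" for i
  proof -
    have "(\<lambda>X. codeword n \<Gamma> \<kappa> (X m) i) \<in> borel_measurable (PiM {1..M} (\<lambda>_. ?G))"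
      by (rule measurable_signal_component[OF cw that])
    then show ?thesis using that by (simp add: received_def)
  qed
  have a: "(\<integral>\<^sup>+X. ?a (X m) \<partial>PiM {1..M} (\<lambda>_. ?G)) \<le> ennreal (\<rho> ^ n)"
  proof -
    have "(\<integral>\<^sup>+X. ?a (X m) \<partial>PiM {1..M} (\<lambda>_. ?G)) = (\<integral>\<^sup>+x. ?a x \<partial>?G)"
      by (rule nn_integral_PiM_component[OF G m]) measurable
    also have "\<dots> = (\<Prod>i\<in>?I. \<integral>\<^sup>+x. ennreal (exp (\<theta> * (x\<^sup>2 - \<Gamma>))) \<partial>gauss 0 g)"
      by (rule nn_integral_PiM_prod) (auto intro: prob_space_gauss g)
    also have "\<dots> \<le> (\<Prod>i\<in>?I. ennreal \<rho>)" by (intro prod_mono_ennreal tail)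
    also have "\<dots> = ennreal (\<rho> ^ n)" using \<rho> by (simp add: ennreal_power)
    finally show ?thesis .
  qed
  have b: "(\<integral>\<^sup>+X. ?b (X m) \<partial>PiM {1..M} (\<lambda>_. ?G))
     = (\<Prod>i\<in>?I. \<integral>\<^sup>+x. ennreal (exp (l * \<tau> - l * letter_score c g \<eta> (hop x (\<kappa> i)) (hop x (\<kappa> i) + (s i + z
         i)))) \<partial>gauss 0 g)"
  proof -
    have "(\<integral>\<^sup>+X. ?b (X m) \<partial>PiM {1..M} (\<lambda>_. ?G)) = (\<integral>\<^sup>+x. ?b x \<partial>?G)"
      by (rule nn_integral_PiM_component[OF G m]) measurable
    also have "\<dots> = (\<Prod>i\<in>?I. \<integral>\<^sup>+x. ennreal (exp (l * \<tau> - l * letter_score c g \<eta> (hop x (\<kappa> i)) (hop x (\<kappa> i) +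
        (s i + z i)))) \<partial>gauss 0 g)"
      by (rule nn_integral_PiM_prod) (auto intro: prob_space_gauss g)
    finally show ?thesis .
  qed
  have cm: "?c m' \<in> borel_measurable (PiM {1..M} (\<lambda>_. ?G))" if "m' \<in> {1..M} - {m}" for m'
  proof -
    have m'': "m' \<in> {1..M}" using that by blast
    note comp[OF m'', measurable]
    show ?thesis by measurable
  qed
  have c': "(\<integral>\<^sup>+X. ?c m' X \<partial>PiM {1..M} (\<lambda>_. ?G)) = ennreal (exp (- \<tau>) ^ n)" if m': "m' \<in> {1..M} - {m}" for m'
  proof -
    have m'': "m' \<in> {1..M}" using m' by blast
    have "(\<integral>\<^sup>+X. ?c m' X \<partial>PiM {1..M} (\<lambda>_. ?G))
        = (\<integral>\<^sup>+X. \<integral>\<^sup>+x. ?c m' (X(m' := x)) \<partial>?G \<partial>PiM ({1..M} - {m'}) (\<lambda>_. ?G))"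
      by (intro nn_integral_PiM_resample G m'' cm[OF m']) simp
    also have "\<dots> = (\<integral>\<^sup>+X. ennreal (exp (- \<tau>) ^ n) \<partial>PiM ({1..M} - {m'}) (\<lambda>_. ?G))"
    proof (rule nn_integral_cong)
      fix X
      let ?y = "received n (codeword n \<Gamma> \<kappa> (X m)) s z"
      have "(\<integral>\<^sup>+x. ?c m' (X(m' := x)) \<partial>?G)
          = (\<integral>\<^sup>+x. (\<Prod>i\<in>?I. ennreal (exp (letter_score c g \<eta> (hop (x i) (\<kappa> i)) (?y i) - \<tau>))) \<partial>?G)"
        using m' by (intro nn_integral_cong) simp
      also have "\<dots> = (\<Prod>i\<in>?I. \<integral>\<^sup>+x. ennreal (exp (letter_score c g \<eta> (hop x (\<kappa> i)) (?y i) - \<tau>)) \<partial>gauss 0 g)"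
        by (rule nn_integral_PiM_prod) (auto intro: prob_space_gauss g)
      also have "\<dots> = (\<Prod>i\<in>?I. ennreal (exp (- \<tau>)))"
      proof (rule prod.cong[OF refl])
        fix i
        have "(\<integral>\<^sup>+x. ennreal (exp (letter_score c g \<eta> (hop x (\<kappa> i)) (?y i) - \<tau>)) \<partial>gauss 0 g)
            = (\<integral>\<^sup>+x. ennreal (exp (- \<tau>)) * ennreal (exp (letter_score c g \<eta> (hop x (\<kappa> i)) (?y i))) \<partial>gauss 0 g)"
          by (intro nn_integral_cong) (simp add: ennreal_mult[symmetric] exp_add[symmetric])
        also have "\<dots> = ennreal (exp (- \<tau>))"
          by (simp add: nn_integral_cmult nn_integral_exp_letter_score_wrong[OF c g \<eta>])
        finally show "(\<integral>\<^sup>+x. ennreal (exp (letter_score c g \<eta> (hop x (\<kappa> i)) (?y i) - \<tau>)) \<partial>gauss 0 g) =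
            ennreal (exp (- \<tau>))" .
      qed
      also have "\<dots> = ennreal (exp (- \<tau>) ^ n)" by (simp add: ennreal_power)
      finally show "(\<integral>\<^sup>+x. ?c m' (X(m' := x)) \<partial>?G) = ennreal (exp (- \<tau>) ^ n)" .
    qed
    also have "\<dots> = ennreal (exp (- \<tau>) ^ n)"
    proof -
      interpret prob_space "PiM ({1..M} - {m'}) (\<lambda>_. ?G)" by (intro prob_space_PiM G)
      show ?thesis by (simp add: emeasure_space_1 del: One_nat_def)
    qed
    finally show ?thesis .
  qed
  note comp[OF m, measurable]
  have ab [measurable]: "(\<lambda>X. ?a (X m)) \<in> borel_measurable (PiM {1..M} (\<lambda>_. ?G))" "(\<lambda>X. ?b (X m)) \<in>
      borel_measurable (PiM {1..M} (\<lambda>_. ?G))"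
    by measurable
  have "(\<integral>\<^sup>+X. indicator {X. wrong (c, g, \<eta>) \<tau> n \<Gamma> M m s \<kappa> z X} X \<partial>PiM {1..M} (\<lambda>_. ?G))
     \<le> (\<integral>\<^sup>+X. ?a (X m) + ?b (X m) + (\<Sum>m'\<in>{1..M} - {m}. ?c m' X) \<partial>PiM {1..M} (\<lambda>_. ?G))"
    by (intro nn_integral_mono wrong_le)
  also have "\<dots> = (\<integral>\<^sup>+X. ?a (X m) \<partial>PiM {1..M} (\<lambda>_. ?G)) + (\<integral>\<^sup>+X. ?b (X m) \<partial>PiM {1..M} (\<lambda>_. ?G))
      + (\<Sum>m'\<in>{1..M} - {m}. \<integral>\<^sup>+X. ?c m' X \<partial>PiM {1..M} (\<lambda>_. ?G))"
    using ab cm by (subst nn_integral_add nn_integral_sum; (intro borel_measurable_add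
        borel_measurable_sum)?; blast?)+
  also have "(\<Sum>m'\<in>{1..M} - {m}. \<integral>\<^sup>+X. ?c m' X \<partial>PiM {1..M} (\<lambda>_. ?G)) = (\<Sum>m'\<in>{1..M} - {m}. ennreal (exp (- \<tau>)
      ^ n))"
    by (intro sum.cong refl c')
  also have "\<dots> \<le> (\<Sum>m'\<in>{1..M}. ennreal (exp (- \<tau>) ^ n))" by (intro sum_mono2) auto
  also have "\<dots> = ennreal (real M * exp (- \<tau>) ^ n)"
    by (simp add: ennreal_mult ennreal_of_nat_eq_real_of_nat)
  finally have "(\<integral>\<^sup>+X. indicator {X. wrong (c, g, \<eta>) \<tau> n \<Gamma> M m s \<kappa> z X} X \<partial>PiM {1..M} (\<lambda>_. ?G))
     \<le> (\<integral>\<^sup>+X. ?a (X m) \<partial>PiM {1..M} (\<lambda>_. ?G)) + (\<integral>\<^sup>+X. ?b (X m) \<partial>PiM {1..M} (\<lambda>_. ?G)) + ennreal (real M * exp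
         (- \<tau>) ^ n)"
    by (auto intro: order_trans add_left_mono)
  also have "\<dots> \<le> ennreal (\<rho> ^ n) + (\<integral>\<^sup>+X. ?b (X m) \<partial>PiM {1..M} (\<lambda>_. ?G)) + ennreal (real M * exp (- \<tau>) ^ n)"
    by (intro add_right_mono a)
  also have "\<dots> = ennreal (\<rho> ^ n + real M * exp (- \<tau>) ^ n) + (\<integral>\<^sup>+X. ?b (X m) \<partial>PiM {1..M} (\<lambda>_. ?G))"
    using \<rho> by (simp add: ac_simps)
  finally show ?thesis unfolding b .
qed

text \<open>The hypothesis \<open>w\<close> is the whole information about the jamming signal that
  is used: the interference energy, averaged over hops and time, is at most
  \<open>c\<close>.\<close>

lemma nn_integral_wrong:
  assumes w: "(\<Sum>i=1..n. (\<Sum>k\<in>A. (s i $ k)\<^sup>2 + \<sigma>2 k) / card A) \<le> real n * c"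
  shows "(\<integral>\<^sup>+\<kappa>. \<integral>\<^sup>+z. \<integral>\<^sup>+X. indicator {X. wrong (c, g, \<eta>) \<tau> n \<Gamma> M m s \<kappa> z X} X
        \<partial>PiM {1..M} (\<lambda>_. PiM {1..n} (\<lambda>_. gauss 0 g)) \<partial>PiM {1..n} (\<lambda>_. \<mu>) \<partial>PiM {1..n} (\<lambda>_. measure_pmf
            (pmf_of_set A)))
    \<le> ennreal (\<rho> ^ n + real M * exp (- \<tau>) ^ n + exp (l * \<tau> + letter_bound c g \<eta> l c - 1) ^ n)"
proof -
  let ?I = "{1..n}"
  let ?H = "PiM ?I (\<lambda>_. measure_pmf (pmf_of_set A))" and ?N = "PiM ?I (\<lambda>_. \<mu>)" and ?B = "letter_bound c g \<eta> l"
  let ?q = "\<lambda>i k z. \<integral>\<^sup>+x. ennreal (exp (l * \<tau> - l * letter_score c g \<eta> (hop x k) (hop x k + (s i + z))))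
      \<partial>gauss 0 g"
  let ?r = "ennreal (\<rho> ^ n + real M * exp (- \<tau>) ^ n)"
  note sets_mu [measurable_cong] = mu(2)
  interpret g: prob_space "gauss 0 g" by (rule prob_space_gauss[OF g])
  interpret mu: prob_space \<mu> by (rule mu)
  interpret N: prob_space ?N by (intro prob_space_PiM mu)
  interpret H: prob_space ?H by (intro prob_space_PiM prob_space_measure_pmf)
  have q [measurable]: "?q i k \<in> borel_measurable \<mu>" for i k
    by measurable
  have "(\<integral>\<^sup>+\<kappa>. \<integral>\<^sup>+z. \<integral>\<^sup>+X. indicator {X. wrong (c, g, \<eta>) \<tau> n \<Gamma> M m s \<kappa> z X} X
        \<partial>PiM {1..M} (\<lambda>_. PiM {1..n} (\<lambda>_. gauss 0 g)) \<partial>?N \<partial>?H)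
     \<le> (\<integral>\<^sup>+\<kappa>. \<integral>\<^sup>+z. ?r + (\<Prod>i\<in>?I. ?q i (\<kappa> i) (z i)) \<partial>?N \<partial>?H)"
    by (intro nn_integral_mono nn_integral_wrong_codebook)
  also have "\<dots> = (\<integral>\<^sup>+\<kappa>. ?r + (\<Prod>i\<in>?I. \<integral>\<^sup>+z. ?q i (\<kappa> i) z \<partial>\<mu>) \<partial>?H)"
  proof (rule nn_integral_cong)
    fix \<kappa>
    have [measurable]: "(\<lambda>z. ?q i (\<kappa> i) (z i)) \<in> borel_measurable ?N" if "i \<in> ?I" for i
      by (rule measurable_compose[OF measurable_component_singleton[OF that] q])
    have "(\<integral>\<^sup>+z. ?r + (\<Prod>i\<in>?I. ?q i (\<kappa> i) (z i)) \<partial>?N) = ?r + (\<integral>\<^sup>+z. (\<Prod>i\<in>?I. ?q i (\<kappa> i) (z i)) \<partial>?N)"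
      by (subst nn_integral_add) (auto simp: N.emeasure_space_1 simp del: One_nat_def)
    also have "(\<integral>\<^sup>+z. (\<Prod>i\<in>?I. ?q i (\<kappa> i) (z i)) \<partial>?N) = (\<Prod>i\<in>?I. \<integral>\<^sup>+z. ?q i (\<kappa> i) z \<partial>\<mu>)"
      by (rule nn_integral_PiM_prod) (auto intro: mu q)
    finally show "(\<integral>\<^sup>+z. ?r + (\<Prod>i\<in>?I. ?q i (\<kappa> i) (z i)) \<partial>?N) = ?r + (\<Prod>i\<in>?I. \<integral>\<^sup>+z. ?q i (\<kappa> i) z \<partial>\<mu>)" .
  qed
  also have "\<dots> = ?r + (\<integral>\<^sup>+\<kappa>. (\<Prod>i\<in>?I. \<integral>\<^sup>+z. ?q i (\<kappa> i) z \<partial>\<mu>) \<partial>?H)"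
  proof -
    have "(\<lambda>\<kappa>. \<integral>\<^sup>+z. ?q i (\<kappa> i) z \<partial>\<mu>) \<in> borel_measurable ?H" if "i \<in> ?I" for i
      by (rule measurable_compose[OF measurable_component_singleton[OF that, of "\<lambda>_. measure_pmf (pmf_of_set
          A)"]]) simp
    then show ?thesis
      by (subst nn_integral_add) (auto simp: H.emeasure_space_1 simp del: One_nat_def intro!:
          borel_measurable_prod_ennreal)
  qed
  also have "(\<integral>\<^sup>+\<kappa>. (\<Prod>i\<in>?I. \<integral>\<^sup>+z. ?q i (\<kappa> i) z \<partial>\<mu>) \<partial>?H)
      = (\<Prod>i\<in>?I. \<integral>\<^sup>+k. \<integral>\<^sup>+z. ?q i k z \<partial>\<mu> \<partial>measure_pmf (pmf_of_set A))"
    by (rule nn_integral_PiM_prod) (auto intro: prob_space_measure_pmf)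
  also have "\<dots> \<le> (\<Prod>i\<in>?I. ennreal (exp (l * \<tau> + ?B ((\<Sum>k\<in>A. (s i $ k)\<^sup>2 + \<sigma>2 k) / card A) - 1)))"
  proof (rule prod_mono_ennreal)
    fix i
    let ?w = "(\<Sum>k\<in>A. (s i $ k)\<^sup>2 + \<sigma>2 k) / card A"
    let ?p = "\<lambda>k z. \<integral>\<^sup>+x. ennreal (exp (- l * letter_score c g \<eta> (hop x k) (hop x k + (s i + z)))) \<partial>gauss 0 g"
    have p [measurable]: "?p k \<in> borel_measurable \<mu>" for k by measurable
    have "?q i k z = ennreal (exp (l * \<tau>)) * ?p k z" for k z
      by (subst nn_integral_cmult[symmetric]) (auto simp: ennreal_mult[symmetric] exp_add[symmetric])
    then have "(\<integral>\<^sup>+k. \<integral>\<^sup>+z. ?q i k z \<partial>\<mu> \<partial>measure_pmf (pmf_of_set A))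
        = ennreal (exp (l * \<tau>)) * (\<integral>\<^sup>+k. \<integral>\<^sup>+z. ?p k z \<partial>\<mu> \<partial>measure_pmf (pmf_of_set A))"
      using p by (simp add: nn_integral_cmult del: One_nat_def)
    also have "\<dots> \<le> ennreal (exp (l * \<tau>)) * ennreal (exp (?B ?w - 1))"
      by (intro mult_left_mono nn_integral_letter_true) auto
    also have "\<dots> = ennreal (exp (l * \<tau> + ?B ?w - 1))"
      by (simp add: ennreal_mult[symmetric] exp_add[symmetric] algebra_simps)
    finally show "(\<integral>\<^sup>+k. \<integral>\<^sup>+z. ?q i k z \<partial>\<mu> \<partial>measure_pmf (pmf_of_set A)) \<le> ennreal (exp (l * \<tau> + ?B ?w - 1))" .
  qed
  also have "\<dots> = ennreal (exp (\<Sum>i\<in>?I. l * \<tau> + ?B ((\<Sum>k\<in>A. (s i $ k)\<^sup>2 + \<sigma>2 k) / card A) - 1))"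
    by (subst prod_ennreal) (auto simp: exp_sum)
  \<comment> \<open>The slope \<open>?b\<close> of the affine bound is nonnegative, so only the sum
    of the energies over time enters, and \<open>w\<close> bounds it.\<close>
  also have "\<dots> \<le> ennreal (exp (l * \<tau> + ?B c - 1) ^ n)"
  proof (intro ennreal_leI)
    let ?b = "l * (g / (2 * c * (c + g)))"
    have "(\<Sum>i\<in>?I. l * \<tau> + ?B ((\<Sum>k\<in>A. (s i $ k)\<^sup>2 + \<sigma>2 k) / card A) - 1)
       = (\<Sum>i\<in>?I. (l * \<tau> + ?B 0 - 1) + ?b * ((\<Sum>k\<in>A. (s i $ k)\<^sup>2 + \<sigma>2 k) / card A))"
      by (intro sum.cong refl) (subst letter_bound_affine, simp)
    also have "\<dots> = real n * (l * \<tau> + ?B 0 - 1) + ?b * (\<Sum>i=1..n. (\<Sum>k\<in>A. (s i $ k)\<^sup>2 + \<sigma>2 k) / card A)"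
      by (subst sum.distrib) (simp add: sum_distrib_left)
    also have "\<dots> \<le> real n * (l * \<tau> + ?B 0 - 1) + ?b * (real n * c)"
      using w l c g by (intro add_left_mono mult_left_mono) auto
    also have "\<dots> = real n * (l * \<tau> + ?B c - 1)"
      by (subst (2) letter_bound_affine) (simp add: algebra_simps)
    finally show "exp (\<Sum>i\<in>?I. l * \<tau> + ?B ((\<Sum>k\<in>A. (s i $ k)\<^sup>2 + \<sigma>2 k) / card A) - 1) \<le> exp (l * \<tau> + ?B c - 1)
        ^ n"
      by (simp add: exp_of_nat_mult[symmetric])
  qed
  finally show ?thesis
    using \<rho> by (simp add: add_left_mono)
qed

end

end

section \<open>Jamming signals and the overall error\<close>

lemma norm_vec_square: "(norm (x :: real ^ 'k::finite))\<^sup>2 = (\<Sum>k\<in>UNIV. (x $ k)\<^sup>2)"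
  by (simp only: power2_norm_eq_inner) (simp add: inner_vec_def power2_eq_square)

lemma jamming_signalsD:
  fixes s :: "'k::finite signal"
  assumes "s \<in> jamming_signals n J \<Lambda>"
  shows "s \<in> space (signal_space n)" "(\<Sum>i=1..n. \<Sum>k\<in>A. (s i $ k)\<^sup>2) \<le> real n * \<Lambda>"
proof -
  obtain a where s: "s = restrict (\<lambda>i. snd (a i) * set_vec (fst (a i))) {1..n}"
    and pow: "(\<Sum>i=1..n. (norm (snd (a i)))\<^sup>2) \<le> real n * \<Lambda>"
    using assms unfolding jamming_signals_def by blast
  show "s \<in> space (signal_space n)" by (simp add: s space_signal_space)
  have "(\<Sum>i=1..n. \<Sum>k\<in>A. (s i $ k)\<^sup>2) \<le> (\<Sum>i=1..n. (norm (snd (a i)))\<^sup>2)"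
  proof (rule sum_mono)
    fix i assume "i \<in> {1..n}"
    then have "(\<Sum>k\<in>A. (s i $ k)\<^sup>2) \<le> (\<Sum>k\<in>A. (snd (a i) $ k)\<^sup>2)"
      by (intro sum_mono) (auto simp: s set_vec_def)
    also have "\<dots> \<le> (\<Sum>k\<in>UNIV. (snd (a i) $ k)\<^sup>2)" by (intro sum_mono2) auto
    finally show "(\<Sum>k\<in>A. (s i $ k)\<^sup>2) \<le> (norm (snd (a i)))\<^sup>2" by (simp add: norm_vec_square)
  qed
  then show "(\<Sum>i=1..n. \<Sum>k\<in>A. (s i $ k)\<^sup>2) \<le> real n * \<Lambda>" using pow by linarith
qed

text \<open>The zero signal is admissible. The overall error is a supremum of reals, whose bounds
  require a nonempty set.\<close>

lemma jamming_signals_nonempty: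
  assumes "J \<le> CARD('k::finite)" "0 \<le> \<Lambda>"
  shows "(jamming_signals n J \<Lambda> :: 'k signal set) \<noteq> {}"
proof -
  obtain I :: "'k set" where "card I = J"
    using obtain_subset_with_card_n[OF assms(1)] by blast
  then have "restrict (\<lambda>i. snd (I, 0) * set_vec (fst (I, 0))) {1..n} \<in> jamming_signals n J \<Lambda>"
    using assms(2) unfolding jamming_signals_def
    by (intro CollectI exI[of _ "\<lambda>_. (I, 0)"]) (simp add: jammer_actions_def)
  then show ?thesis by blast
qed

lemma code_error_nonneg: "0 \<le> code_error \<mu> n M c s"
  by (simp add: code_error_eq msg_error_nonneg sum_nonneg)

lemma code_error_le_1:
  assumes "prob_space \<mu>" shows "code_error \<mu> n M c s \<le> 1"
proof (cases "M = 0")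
  case False
  have "(\<Sum>m=1..M. msg_error \<mu> n c s m) \<le> (\<Sum>m=1..M. 1)"
    by (intro sum_mono msg_error_le_1 assms)
  then show ?thesis using False by (simp add: code_error_eq divide_simps)
qed (simp add: code_error_eq)

context
  fixes \<mu> :: "(real ^ 'k::finite) measure" and n M :: nat and \<Gamma> :: real and Q :: "'k code measure"
  assumes mu: "prob_space \<mu>" "sets \<mu> = sets borel" and Q: "cr_code n \<Gamma> M Q"
begin

lemma measurable_msg_error_section:
  assumes "m \<in> {1..M}" "s \<in> space (signal_space n)"
  shows "(\<lambda>c. msg_error \<mu> n c s m) \<in> borel_measurable Q"
  using measurable_compose[OF measurable_Pair2'[OF assms(2)] measurable_msg_error[OF mu Q assms(1)]] by simp

lemma integrable_msg_error:
  assumes "m \<in> {1..M}" "s \<in> space (signal_space n)"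
  shows "integrable Q (\<lambda>c. msg_error \<mu> n c s m)"
proof -
  interpret prob_space Q using Q by (simp add: cr_code_def)
  show ?thesis
    using msg_error_nonneg[of \<mu> n _ s m] msg_error_le_1[OF mu(1), of n _ s m]
    by (intro integrable_const_bound[of _ 1] AE_I2 measurable_msg_error_section assms) auto
qed

lemma integrable_code_error:
  assumes "s \<in> space (signal_space n)"
  shows "integrable Q (\<lambda>c. code_error \<mu> n M c s)"
proof -
  have "integrable Q (\<lambda>c. \<Sum>m=1..M. msg_error \<mu> n c s m)"
    by (rule Bochner_Integration.integrable_sum) (rule integrable_msg_error[OF _ assms])
  then show ?thesis unfolding code_error_eq by (rule integrable_mult_right)
qed

lemma integral_code_error:
  assumes "s \<in> space (signal_space n)"
  shows "(LINT c|Q. code_error \<mu> n M c s) = (1 / real M) * (\<Sum>m=1..M. LINT c|Q. msg_error \<mu> n c s m)"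
proof -
  have "(LINT c|Q. (\<Sum>m=1..M. msg_error \<mu> n c s m)) = (\<Sum>m=1..M. LINT c|Q. msg_error \<mu> n c s m)"
    by (rule Bochner_Integration.integral_sum) (rule integrable_msg_error[OF _ assms])
  then show ?thesis by (simp only: code_error_eq integral_mult_right_zero)
qed

lemma cr_error_upper:
  assumes s: "s \<in> jamming_signals n J \<Lambda>"
  shows "(LINT c|Q. code_error \<mu> n M c s) \<le> cr_error \<mu> J \<Lambda> n M Q"
proof -
  interpret prob_space Q using Q by (simp add: cr_code_def)
  have "(LINT c|Q. code_error \<mu> n M c s) \<le> 1" if "s \<in> jamming_signals n J \<Lambda>" for s :: "'k signal"
  proof -
    have "(LINT c|Q. code_error \<mu> n M c s) \<le> (LINT c|Q. 1)"
      using jamming_signalsD(1)[OF that] by (intro integral_mono integrable_code_error code_error_le_1 mu) auto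
    then show ?thesis by (simp add: prob_space)
  qed
  then show ?thesis unfolding cr_error_def by (intro cSUP_upper s bdd_aboveI2)
qed

lemma cr_error_nonneg:
  assumes "J \<le> CARD('k)" "0 \<le> \<Lambda>"
  shows "0 \<le> cr_error \<mu> J \<Lambda> n M Q"
proof -
  obtain s :: "'k signal" where "s \<in> jamming_signals n J \<Lambda>" using jamming_signals_nonempty[OF assms] by blast
  have "0 \<le> (LINT c|Q. code_error \<mu> n M c s)" by (intro integral_nonneg_AE AE_I2 code_error_nonneg)
  also have "\<dots> \<le> cr_error \<mu> J \<Lambda> n M Q" by (rule cr_error_upper) fact
  finally show ?thesis .
qed

end

context
  fixes \<mu> :: "(real ^ 'k::finite) measure" and \<sigma>2 :: "'k \<Rightarrow> real" and A :: "'k set" and c g \<eta> l :: real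
    and n M J :: nat and \<Gamma> \<tau> \<theta> \<rho> \<Lambda> :: real
  assumes mu: "prob_space \<mu>" "sets \<mu> = sets borel"
    and mom: "\<And>k. integrable \<mu> (\<lambda>z. z $ k)" "\<And>k. integrable \<mu> (\<lambda>z. (z $ k)\<^sup>2)"
      "\<And>k. (\<integral>z. z $ k \<partial>\<mu>) = 0" "\<And>k. (\<integral>z. (z $ k)\<^sup>2 \<partial>\<mu>) = \<sigma>2 k"
    and A: "A \<noteq> {}" and c: "0 < c" and g: "0 < g" and \<eta>: "0 < \<eta>" "\<eta> < 1" and l: "0 \<le> l" "l \<le> 1"
    and n: "1 \<le> n" and M: "1 \<le> M" and \<tau>: "0 < \<tau>" and \<theta>: "0 \<le> \<theta>" and \<rho>: "0 \<le> \<rho>" and \<Gamma>: "0 \<le> \<Gamma>"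
    and tail: "(\<integral>\<^sup>+x. ennreal (exp (\<theta> * (x\<^sup>2 - \<Gamma>))) \<partial>gauss 0 g) \<le> ennreal \<rho>"
    and fill: "(\<Sum>k\<in>A. \<sigma>2 k) + \<Lambda> \<le> card A * c" and J: "J \<le> CARD('k)" and \<Lambda>: "0 \<le> \<Lambda>"
begin

lemma cr_code_score: "cr_code n \<Gamma> M (random_code (score c g \<eta> n) (real n * \<tau>) A g n \<Gamma> M)"
  by (rule cr_code_random_code[OF g \<Gamma> M]) (rule measurable_score)

text \<open>The law of the code is unfolded to the seed, and the error probability becomes an
  integral over hops, codebook and noise, to which \<open>nn_integral_wrong\<close> applies.\<close>

lemma msg_error_random_code:
  assumes m: "m \<in> {1..M}" and s: "s \<in> jamming_signals n J \<Lambda>"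
  shows "(LINT c|random_code (score c g \<eta> n) (real n * \<tau>) A g n \<Gamma> M. msg_error \<mu> n c s m)
    \<le> \<rho> ^ n + real M * exp (- \<tau>) ^ n + exp (l * \<tau> + letter_bound c g \<eta> l c - 1) ^ n" (is "_ \<le> ?e")
proof (rule integral_real_bounded)
  let ?Q = "random_code (score c g \<eta> n) (real n * \<tau>) A g n \<Gamma> M"
  let ?H = "PiM {1..n} (\<lambda>_. measure_pmf (pmf_of_set A))" and ?X = "PiM {1..M} (\<lambda>_. PiM {1..n} (\<lambda>_. gauss 0 g))"
    and ?N = "PiM {1..n} (\<lambda>_. \<mu>)"
  let ?code = "\<lambda>\<omega>. (codebook n \<Gamma> M \<omega>, decode (score c g \<eta> n) (real n * \<tau>) M (codebook n \<Gamma> M \<omega>))"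
  show "0 \<le> ?e" using \<rho> by simp
  have s_sp: "s \<in> space (signal_space n)" using s by (rule jamming_signalsD)
  have X: "prob_space ?X" by (intro prob_space_PiM prob_space_gauss g)
  have N: "prob_space ?N" by (intro prob_space_PiM mu)
  have cd: "?code \<in> measurable (?H \<Otimes>\<^sub>M ?X) ?Q"
    using measurable_random_code[OF \<Gamma>, of n M "score c g \<eta> n" "real n * \<tau>" A g]
    by (simp add: random_code_def seed_law_def)
  have sp: "?code \<omega> \<in> space ?Q" if "\<omega> \<in> space (?H \<Otimes>\<^sub>M ?X)" for \<omega>
    using measurable_space[OF cd that] .
  note me = measurable_msg_error_section[OF mu cr_code_score m s_sp]
  have err: "ennreal (msg_error \<mu> n (?code (\<kappa>, X)) s m)
      = (\<integral>\<^sup>+z. indicator {X. wrong (c, g, \<eta>) \<tau> n \<Gamma> M m s \<kappa> z X} X \<partial>?N)"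
    if "\<kappa> \<in> space ?H" "X \<in> space ?X" for \<kappa> X
  proof -
    have "(\<kappa>, X) \<in> space (?H \<Otimes>\<^sub>M ?X)" using that by (simp add: space_pair_measure)
    from ennreal_msg_error[OF mu cr_code_score m sp[OF this] s_sp] show ?thesis
      by (simp add: wrong_def indicator_def)
  qed
  have "(\<integral>\<^sup>+c. ennreal (msg_error \<mu> n c s m) \<partial>?Q) = (\<integral>\<^sup>+\<omega>. ennreal (msg_error \<mu> n (?code \<omega>) s m) \<partial>(?H \<Otimes>\<^sub>M ?X))"
    unfolding random_code_def seed_law_def
    using me measurable_random_code[OF \<Gamma>, of n M "score c g \<eta> n" "real n * \<tau>" A g]
    by (subst nn_integral_distr) (auto simp: random_code_def seed_law_def)
  also have "\<dots> = (\<integral>\<^sup>+\<kappa>. \<integral>\<^sup>+X. ennreal (msg_error \<mu> n (?code (\<kappa>, X)) s m) \<partial>?X \<partial>?H)"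
    using measurable_compose[OF cd me]
    by (subst sigma_finite_measure.nn_integral_fst[OF prob_space_imp_sigma_finite[OF X], symmetric]) auto
  also have "\<dots> = (\<integral>\<^sup>+\<kappa>. \<integral>\<^sup>+X. \<integral>\<^sup>+z. indicator {X. wrong (c, g, \<eta>) \<tau> n \<Gamma> M m s \<kappa> z X} X \<partial>?N \<partial>?X \<partial>?H)"
    by (intro nn_integral_cong err)
  \<comment> \<open>The codebook is moved inside the noise integral, since its average is taken for
    fixed noise.\<close>
  also have "\<dots> = (\<integral>\<^sup>+\<kappa>. \<integral>\<^sup>+z. \<integral>\<^sup>+X. indicator {X. wrong (c, g, \<eta>) \<tau> n \<Gamma> M m s \<kappa> z X} X \<partial>?X \<partial>?N \<partial>?H)"
  proof (rule nn_integral_cong)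
    fix \<kappa> assume \<kappa>: "\<kappa> \<in> space ?H"
    interpret XN: pair_sigma_finite ?N ?X
      using X N by (intro pair_sigma_finite.intro prob_space_imp_sigma_finite)
    have "(\<lambda>p. (\<kappa>, snd p)) \<in> measurable (?N \<Otimes>\<^sub>M ?X) (?H \<Otimes>\<^sub>M ?X)"
      by (intro measurable_Pair measurable_const \<kappa> measurable_snd)
    from measurable_compose[OF this cd]
    have "(\<lambda>p. ?code (\<kappa>, snd p)) \<in> measurable (?N \<Otimes>\<^sub>M ?X) ?Q" .
    from measurable_cr_decode_pred[OF mu cr_code_score m this, of "\<lambda>_. s" fst]
    have [measurable]: "Measurable.pred (?N \<Otimes>\<^sub>M ?X) (\<lambda>p. wrong (c, g, \<eta>) \<tau> n \<Gamma> M m s \<kappa> (fst p) (snd p))"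
      using s_sp measurable_fst[of ?N ?X, unfolded measurable_cong_sets[OF refl sets_PiM_signal[OF mu(2)]]]
      by (simp add: wrong_def del: One_nat_def)
    have "(\<lambda>p. indicator {X. wrong (c, g, \<eta>) \<tau> n \<Gamma> M m s \<kappa> (fst p) X} (snd p) :: ennreal) \<in> borel_measurable
        (?N \<Otimes>\<^sub>M ?X)"
      by (simp add: indicator_def del: One_nat_def) measurable
    then show "(\<integral>\<^sup>+X. \<integral>\<^sup>+z. indicator {X. wrong (c, g, \<eta>) \<tau> n \<Gamma> M m s \<kappa> z X} X \<partial>?N \<partial>?X)
        = (\<integral>\<^sup>+z. \<integral>\<^sup>+X. indicator {X. wrong (c, g, \<eta>) \<tau> n \<Gamma> M m s \<kappa> z X} X \<partial>?X \<partial>?N)"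
      by (intro XN.Fubini') (simp add: case_prod_unfold)
  qed
  \<comment> \<open>The jammer spends at most \<open>n * \<Lambda>\<close> on the hopping set, and
    \<open>fill\<close> says that this power, added to the noise variances there, averages to at
    most \<open>c\<close>.\<close>
  also have "\<dots> \<le> ennreal ?e"
  proof (rule nn_integral_wrong[OF mu mom A c g \<eta> l n m \<tau> \<theta> \<rho> tail])
    have card: "0 < card A" using A by (simp add: card_gt_0_iff)
    have "(\<Sum>i=1..n. (\<Sum>k\<in>A. (s i $ k)\<^sup>2 + \<sigma>2 k) / card A)
        = ((\<Sum>i=1..n. \<Sum>k\<in>A. (s i $ k)\<^sup>2) + real n * (\<Sum>k\<in>A. \<sigma>2 k)) / card A"
      by (simp add: sum_divide_distrib[symmetric] sum.distrib)
    also have "\<dots> \<le> (real n * \<Lambda> + real n * (\<Sum>k\<in>A. \<sigma>2 k)) / card A"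
      using jamming_signalsD(2)[OF s, of A] by (intro divide_right_mono add_right_mono) auto
    also have "\<dots> = real n * ((\<Sum>k\<in>A. \<sigma>2 k) + \<Lambda>) / card A" by (simp add: algebra_simps)
    also have "\<dots> \<le> real n * (card A * c) / card A"
      using fill by (intro divide_right_mono mult_left_mono) auto
    also have "\<dots> = real n * c" using card A by simp
    finally show "(\<Sum>i=1..n. (\<Sum>k\<in>A. (s i $ k)\<^sup>2 + \<sigma>2 k) / card A) \<le> real n * c" .
  qed
  finally show "(\<integral>\<^sup>+c. ennreal (msg_error \<mu> n c s m) \<partial>?Q) \<le> ennreal ?e" .
qed

lemma cr_error_random_code:
  "cr_error \<mu> J \<Lambda> n M (random_code (score c g \<eta> n) (real n * \<tau>) A g n \<Gamma> M)
    \<le> \<rho> ^ n + real M * exp (- \<tau>) ^ n + exp (l * \<tau> + letter_bound c g \<eta> l c - 1) ^ n" (is "_ \<le> ?e")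
  unfolding cr_error_def
proof (rule cSUP_least[OF jamming_signals_nonempty[OF J \<Lambda>]])
  fix s :: "'k signal" assume s: "s \<in> jamming_signals n J \<Lambda>"
  let ?Q = "random_code (score c g \<eta> n) (real n * \<tau>) A g n \<Gamma> M"
  have "(LINT c|?Q. code_error \<mu> n M c s) = (1 / real M) * (\<Sum>m=1..M. LINT c|?Q. msg_error \<mu> n c s m)"
    by (rule integral_code_error[OF mu cr_code_score jamming_signalsD(1)[OF s]])
  also have "\<dots> \<le> (1 / real M) * (\<Sum>m=1..M. ?e)"
    by (intro mult_left_mono sum_mono msg_error_random_code s) auto
  also have "\<dots> = ?e" using M by simp
  finally show "(LINT c|?Q. code_error \<mu> n M c s) \<le> ?e" .
qed

end

text \<open>The rate \<open>r\<close>, in natural units, lies strictly below the Gaussian rate. The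
  gap is split into room for the power constraint, the threshold, the mixture and the second-order
  term; the remaining error terms decay geometrically.\<close>

theorem cr_achievable_hopping:
  fixes \<mu> :: "(real ^ 'k::finite) measure" and \<sigma>2 :: "'k \<Rightarrow> real" and b c \<Gamma> \<Lambda> R :: real
  assumes b: "1 < b" and mu: "prob_space \<mu>" "sets \<mu> = sets borel"
    and mom: "\<And>k. integrable \<mu> (\<lambda>z. z $ k)" "\<And>k. integrable \<mu> (\<lambda>z. (z $ k)\<^sup>2)"
      "\<And>k. (\<integral>z. z $ k \<partial>\<mu>) = 0" "\<And>k. (\<integral>z. (z $ k)\<^sup>2 \<partial>\<mu>) = \<sigma>2 k"
    and A: "A \<noteq> {}" and c: "0 < c" and \<Gamma>: "0 < \<Gamma>" and \<Lambda>: "0 \<le> \<Lambda>" and J: "J \<le> CARD('k)"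
    and fill: "(\<Sum>k\<in>A. \<sigma>2 k) + \<Lambda> \<le> card A * c"
    and R: "0 \<le> R" "R < 1 / 2 * log b (1 + \<Gamma> / c)"
  shows "cr_achievable b \<mu> J \<Gamma> \<Lambda> R"
proof -
  define r where "r = R * ln b"
  have lnb: "0 < ln b" using b by simp
  have r: "0 \<le> r" "r < ln (1 + \<Gamma> / c) / 2"
    using R lnb by (auto simp: r_def log_def field_simps)
  \<comment> \<open>The midpoint between \<Gamma> and the power at which the Gaussian rate is
    exactly \<open>r\<close>.\<close>
  define g where "g = (c * (exp (2 * r) - 1) + \<Gamma>) / 2"
  have "exp (2 * r) < 1 + \<Gamma> / c"
  proof -
    have "exp (2 * r) < exp (ln (1 + \<Gamma> / c))" using r(2) by simp
    also have "\<dots> = 1 + \<Gamma> / c" using c \<Gamma> by (intro exp_ln add_pos_pos) auto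
    finally show ?thesis .
  qed
  then have "c * (exp (2 * r) - 1) < c * (\<Gamma> / c)"
    using c by (intro mult_strict_left_mono) auto
  then have "c * (exp (2 * r) - 1) < \<Gamma>" using c by simp
  moreover have "0 \<le> c * (exp (2 * r) - 1)" using c r by simp
  ultimately have g: "0 < g" "g < \<Gamma>" and g': "c * (exp (2 * r) - 1) < g"
    using \<Gamma> unfolding g_def by auto
  define L where "L = ln (1 + g / c) / 2"
  have "exp (2 * r) < 1 + g / c" using g' c by (simp add: field_simps)
  then have "ln (exp (2 * r)) < ln (1 + g / c)" by (subst ln_less_cancel_iff) (auto intro:
      order.strict_trans[OF exp_gt_zero])
  then have rL: "r < L" by (simp add: L_def)
  define \<tau> where "\<tau> = (r + L) / 2"
  have \<tau>: "0 < \<tau>" "r < \<tau>" "\<tau> < L" using r rL by (auto simp: \<tau>_def)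
  define \<delta> where "\<delta> = (L - \<tau>) / 2"
  have \<delta>: "0 < \<delta>" using \<tau> by (simp add: \<delta>_def)
  \<comment> \<open>This choice makes \<open>ln (1 - \<eta>) = - \<delta>\<close>, so the mixture
    costs half of the gap \<open>L - \<tau> = 2 * \<delta>\<close>.\<close>
  define \<eta> where "\<eta> = 1 - exp (- \<delta>)"
  have \<eta>: "0 < \<eta>" "\<eta> < 1" using \<delta> by (auto simp: \<eta>_def)
  define V where "V = spread c g \<eta>"
  have V: "0 < V" unfolding V_def spread_def using \<eta> by (intro divide_pos_pos add_nonneg_pos) auto
  \<comment> \<open>Small enough for the second-order term \<open>l * V\<close> to use at most half
    of the remaining \<delta>, and at most 1 as the exponential bound requires.\<close>
  define l where "l = min 1 (\<delta> / (2 * V))"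
  have l: "0 < l" "l \<le> 1" using \<delta> V by (auto simp: l_def)
  have "l * V \<le> \<delta> / (2 * V) * V" using V by (intro mult_right_mono) (auto simp: l_def)
  then have lV: "l * V \<le> \<delta> / 2" using V by simp
  have "l * \<tau> + letter_bound c g \<eta> l c - 1 = l * (l * V - \<delta>)"
  proof -
    have "g / (2 * c * (c + g)) * c = g / (2 * (c + g))" using c by simp
    then show ?thesis
      by (simp add: letter_bound_def \<eta>_def[symmetric] L_def[symmetric] V_def[symmetric])
        (simp add: \<eta>_def \<delta>_def algebra_simps power2_eq_square)
  qed
  also have "\<dots> < 0" using l lV \<delta> by (intro mult_pos_neg) auto
  finally have q: "exp (l * \<tau> + letter_bound c g \<eta> l c - 1) < 1" by simp
  obtain \<theta> \<rho> where \<theta>: "0 < \<theta>" and \<rho>: "0 < \<rho>" "\<rho> < 1"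
    and tail: "(\<integral>\<^sup>+x. ennreal (exp (\<theta> * (x\<^sup>2 - \<Gamma>))) \<partial>gauss 0 g) \<le> ennreal \<rho>"
    using gauss_power_tail[OF g] by blast
  \<comment> \<open>Rounding up secures the rate; since \<open>r\<close> is nonnegative it costs at
    most a factor 2.\<close>
  define M where "M n = nat \<lceil>exp (r * real n)\<rceil>" for n :: nat
  have M_ge: "exp (r * real n) \<le> real (M n)" for n by (simp add: M_def)
  have M_le: "real (M n) \<le> 2 * exp (r * real n)" for n
  proof -
    have "1 \<le> exp (r * real n)" using r by simp
    then show ?thesis unfolding M_def by linarith
  qed
  have M1: "1 \<le> M n" for n
    using order.strict_trans2[OF exp_gt_zero M_ge, of n] by (simp add: Suc_le_eq)
  define Q where "Q n = random_code (score c g \<eta> n) (real n * \<tau>) A g n \<Gamma> (M n)" for n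
  have \<Gamma>0: "0 \<le> \<Gamma>" and l0: "0 \<le> l" and \<theta>0: "0 \<le> \<theta>" and \<rho>0: "0 \<le> \<rho>" using \<Gamma> l \<theta> \<rho> by auto
  have code: "cr_code n \<Gamma> (M n) (Q n)" for n
    unfolding Q_def by (rule cr_code_random_code[OF g(1) \<Gamma>0 M1]) (rule measurable_score)
  have "(\<lambda>n. cr_error \<mu> J \<Lambda> n (M n) (Q n)) \<longlonglongrightarrow> 0"
  proof (rule tendsto_sandwich)
    let ?q = "exp (l * \<tau> + letter_bound c g \<eta> l c - 1)"
    show "\<forall>\<^sub>F n in sequentially. 0 \<le> cr_error \<mu> J \<Lambda> n (M n) (Q n)"
    proof (intro always_eventually allI)
      fix n show "0 \<le> cr_error \<mu> J \<Lambda> n (M n) (Q n)"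
        by (rule cr_error_nonneg[OF mu code[of n] J \<Lambda>])
    qed
    show "\<forall>\<^sub>F n in sequentially. cr_error \<mu> J \<Lambda> n (M n) (Q n) \<le> \<rho> ^ n + 2 * exp (r - \<tau>) ^ n + ?q ^ n"
    proof (rule eventually_sequentiallyI)
      fix n :: nat assume n: "1 \<le> n"
      have "cr_error \<mu> J \<Lambda> n (M n) (Q n) \<le> \<rho> ^ n + real (M n) * exp (- \<tau>) ^ n + ?q ^ n"
        unfolding Q_def
        by (rule cr_error_random_code[OF mu mom A c g(1) \<eta> l0 l(2) n M1 \<tau>(1) \<theta>0 \<rho>0 \<Gamma>0 tail fill J \<Lambda>])
      also have "real (M n) * exp (- \<tau>) ^ n \<le> 2 * exp (r * real n) * exp (- \<tau>) ^ n"
        by (intro mult_right_mono M_le) auto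
      also have "2 * exp (r * real n) * exp (- \<tau>) ^ n = 2 * exp (r - \<tau>) ^ n"
        by (simp add: exp_of_nat_mult[symmetric] exp_add[symmetric] algebra_simps)
      finally show "cr_error \<mu> J \<Lambda> n (M n) (Q n) \<le> \<rho> ^ n + 2 * exp (r - \<tau>) ^ n + ?q ^ n" by simp
    qed
    have "(\<lambda>n. \<rho> ^ n + 2 * exp (r - \<tau>) ^ n + ?q ^ n) \<longlonglongrightarrow> 0 + 2 * 0 + 0"
      using \<rho> \<tau> q by (intro tendsto_add tendsto_mult tendsto_const LIMSEQ_power_zero) auto
    then show "(\<lambda>n. \<rho> ^ n + 2 * exp (r - \<tau>) ^ n + ?q ^ n) \<longlonglongrightarrow> 0" by simp
  qed simp
  moreover have "ereal R \<le> liminf (\<lambda>n. ereal (1 / real n * log b (real (M n))))"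
  proof (rule Liminf_bounded, rule eventually_sequentiallyI)
    fix n :: nat assume n: "1 \<le> n"
    have "r * real n \<le> ln (real (M n))"
      using M_ge[of n] M1[of n] by (subst ln_ge_iff) auto
    then have "R * real n \<le> log b (real (M n))"
      using lnb by (simp add: r_def log_def field_simps)
    then have "R \<le> 1 / real n * log b (real (M n))" using n by (simp add: field_simps)
    then show "ereal R \<le> ereal (1 / real n * log b (real (M n)))" by simp
  qed
  ultimately show ?thesis
    unfolding cr_achievable_def using R(1) code by blast
qed

section \<open>Vectors with independent Gaussian components\<close>

lemma measurable_vec_lambda [measurable]:
  assumes "\<And>k. sets (m k) = sets borel"
  shows "(\<lambda>g. \<chi> k. g k) \<in> borel_measurable (PiM (UNIV :: 'k::finite set) m :: ('k \<Rightarrow> real) measure)"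
proof (rule borel_measurable_euclidean_space[THEN iffD2], rule ballI)
  fix b :: "real ^ 'k" assume "b \<in> Basis"
  then obtain k where b: "b = axis k 1" by (auto simp: Basis_vec_def)
  have "(\<lambda>g. g k) \<in> measurable (PiM UNIV m) (m k)" by simp
  then have "(\<lambda>g. g k) \<in> borel_measurable (PiM UNIV m)" using assms[of k] by (simp cong: measurable_cong_sets)
  then show "(\<lambda>g. (\<chi> k. g k) \<bullet> b) \<in> borel_measurable (PiM UNIV m)" by (simp add: b inner_axis)
qed

text \<open>Product measures live on functions, channel signals on \<open>real ^ 'k\<close>; this is
  the law of a vector with independent components, carried over to the latter.\<close>

definition vlaw :: "('k::finite \<Rightarrow> real measure) \<Rightarrow> (real ^ 'k) measure" where
  "vlaw m = distr (PiM UNIV m) borel (\<lambda>g. \<chi> k. g k)"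

lemma sets_vlaw [simp, measurable_cong]: "sets (vlaw m) = sets borel"
  and space_vlaw [simp]: "space (vlaw m) = UNIV"
  by (simp_all add: vlaw_def)

context
  fixes m :: "'k::finite \<Rightarrow> real measure"
  assumes m: "\<And>k. prob_space (m k)" "\<And>k. sets (m k) = sets borel"
begin

lemma prob_space_vlaw: "prob_space (vlaw m)"
  unfolding vlaw_def by (intro prob_space.prob_space_distr prob_space_PiM m measurable_vec_lambda)

lemma nn_integral_vlaw_component:
  assumes f: "f \<in> borel_measurable borel"
  shows "(\<integral>\<^sup>+y. f (y $ k) \<partial>vlaw m) = (\<integral>\<^sup>+x. f x \<partial>m k)"
proof -
  have [measurable]: "(\<lambda>g. \<chi> k. g k) \<in> borel_measurable (PiM UNIV m)" using m by (intro measurable_vec_lambda)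
  have f': "f \<in> borel_measurable (m k)" using f m(2)[of k] by (simp cong: measurable_cong_sets)
  have "(\<integral>\<^sup>+y. f (y $ k) \<partial>vlaw m) = (\<integral>\<^sup>+g. f (g k) \<partial>PiM UNIV m)"
    unfolding vlaw_def using f by (subst nn_integral_distr) simp_all
  also have "\<dots> = (\<integral>\<^sup>+x. f x \<partial>m k)"
    by (rule nn_integral_PiM_component[where M = m and i = k and I = UNIV, OF m(1) UNIV_I f'])
  finally show ?thesis .
qed

text \<open>All other components carry the density 1. It will be applied to the subchannel that the
  sender uses, the only one whose law depends on the symbol.\<close>

lemma vlaw_density:
  assumes f [measurable]: "f \<in> borel_measurable borel" and D: "prob_space (density (m k) f)"
  shows "vlaw (\<lambda>l. if l = k then density (m k) f else m l) = density (vlaw m) (\<lambda>y. f (y $ k))"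
proof -
  let ?f = "\<lambda>l. if l = k then f else (\<lambda>_. 1)"
  have [measurable]: "(\<lambda>g. \<chi> k. g k) \<in> borel_measurable (PiM UNIV m)" using m by (intro measurable_vec_lambda)
  have "(\<lambda>l. if l = k then density (m k) f else m l) = (\<lambda>l. density (m l) (?f l))"
    by (rule ext) (simp add: density_1)
  moreover have "PiM UNIV (\<lambda>l. density (m l) (?f l)) = density (PiM UNIV m) (\<lambda>x. \<Prod>l\<in>UNIV. ?f l (x l))"
  proof (rule PiM_density[OF m(1)])
    show "prob_space (density (m l) (?f l))" for l using D m(1)[of l] by (cases "l = k") (auto simp: density_1)
    show "?f l \<in> borel_measurable (m l)" for l using f m(2)[of l] by (simp cong: measurable_cong_sets)
  qed simp
  moreover have "(\<lambda>x. \<Prod>l\<in>UNIV. ?f l (x l)) = (\<lambda>x. f (x k))"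
  proof
    fix x :: "'k \<Rightarrow> real"
    have "(\<Prod>l\<in>UNIV. ?f l (x l)) = (\<Prod>l\<in>UNIV. if l = k then f (x l) else 1)" by (intro prod.cong) auto
    then show "(\<Prod>l\<in>UNIV. ?f l (x l)) = f (x k)" by simp
  qed
  moreover have "distr (density (PiM UNIV m) (\<lambda>x. f (x k))) borel (\<lambda>g. \<chi> k. g k) = density (vlaw m) (\<lambda>y. f
      (y $ k))"
    unfolding vlaw_def by (subst density_distr) auto
  ultimately show ?thesis by (simp add: vlaw_def)
qed

end

lemma vlaw_add:
  fixes m m' :: "'k::finite \<Rightarrow> real measure"
  assumes m: "\<And>k. prob_space (m k)" "\<And>k. sets (m k) = sets borel"
    and m': "\<And>k. prob_space (m' k)" "\<And>k. sets (m' k) = sets borel"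
  shows "distr (vlaw m \<Otimes>\<^sub>M vlaw m') borel (\<lambda>p. u + fst p + snd p)
    = vlaw (\<lambda>k. distr (m k \<Otimes>\<^sub>M m' k) borel (\<lambda>p. u $ k + fst p + snd p))"
proof -
  let ?v = "\<lambda>g::'k \<Rightarrow> real. \<chi> k. g k"
  have [measurable]: "?v \<in> borel_measurable (PiM UNIV m)" "?v \<in> borel_measurable (PiM UNIV m')"
    using m m' by (auto intro: measurable_vec_lambda)
  note [measurable_cong] = m(2) m'(2)
  have vb [measurable]: "?v \<in> borel_measurable (PiM UNIV (\<lambda>_. borel))" by (rule measurable_vec_lambda) simp
  have h: "(\<lambda>p. u $ k + fst p + snd p) \<in> measurable (m k \<Otimes>\<^sub>M m' k) borel" for k
    by measurable
  have "sigma_finite_measure (vlaw m')"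
    by (intro prob_space_imp_sigma_finite prob_space_vlaw m')
  then have "vlaw m \<Otimes>\<^sub>M vlaw m' = distr (PiM UNIV m \<Otimes>\<^sub>M PiM UNIV m') (borel \<Otimes>\<^sub>M borel) (\<lambda>(x, y). (?v x, ?v y))"
    unfolding vlaw_def
    by (intro pair_measure_distr) auto
  then have "distr (vlaw m \<Otimes>\<^sub>M vlaw m') borel (\<lambda>p. u + fst p + snd p)
      = distr (PiM UNIV m \<Otimes>\<^sub>M PiM UNIV m') borel (\<lambda>p. u + ?v (fst p) + ?v (snd p))"
    by (simp add: distr_distr comp_def case_prod_unfold)
  also have "\<dots> = distr (distr (PiM UNIV m \<Otimes>\<^sub>M PiM UNIV m') (PiM UNIV (\<lambda>_. borel)) (\<lambda>(a, b). \<lambda>k\<in>UNIV. u $ k +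
      fst (a k, b k) + snd (a k, b k))) borel ?v"
  proof (subst distr_distr)
    show "(\<lambda>(a, b). \<lambda>k\<in>UNIV. u $ k + fst (a k, b k) + snd (a k, b k)) \<in> measurable (PiM UNIV m \<Otimes>\<^sub>M PiM UNIV
        m') (PiM UNIV (\<lambda>_. borel))"
      by measurable
  qed (auto simp: comp_def vec_eq_iff case_prod_unfold intro!: distr_cong)
  also have "distr (PiM UNIV m \<Otimes>\<^sub>M PiM UNIV m') (PiM UNIV (\<lambda>_. borel)) (\<lambda>(a, b). \<lambda>k\<in>UNIV. u $ k + fst (a k,
      b k) + snd (a k, b k))
      = PiM UNIV (\<lambda>k. distr (m k \<Otimes>\<^sub>M m' k) borel (\<lambda>p. u $ k + fst p + snd p))"
    by (rule distr_pair_PiM[OF m(1) m'(1) finite h])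
  finally show ?thesis by (simp add: vlaw_def)
qed

lemma distr_gauss_shift: "distr (gauss 0 v) borel (\<lambda>y. x + y) = gauss x v"
proof -
  have "gauss x v = density (distr lborel borel ((+) x)) (normal_density x (sqrt v))"
    by (simp add: gauss_def lborel_distr_plus)
  also have "\<dots> = distr (density lborel (\<lambda>y. normal_density x (sqrt v) (x + y))) borel ((+) x)"
    by (subst density_distr) auto
  also have "(\<lambda>y. normal_density x (sqrt v) (x + y)) = normal_density 0 (sqrt v)"
    by (simp add: normal_density_def fun_eq_iff)
  finally show ?thesis by (simp add: gauss_def)
qed

lemma distr_gauss_add:
  assumes "0 < v" "0 < w"
  shows "distr (gauss 0 v \<Otimes>\<^sub>M gauss 0 w) borel (\<lambda>p. fst p + snd p) = gauss 0 (v + w)"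
proof -
  have "convolution (gauss 0 v) (gauss 0 w) = density lborel (\<lambda>x. \<integral>\<^sup>+y. ennreal (normal_density 0 (sqrt v)
      (x - y)) * ennreal (normal_density 0 (sqrt w) y) \<partial>lborel)"
    unfolding gauss_def
    using assms prob_space_normal_density[of "sqrt v" 0] prob_space_normal_density[of "sqrt w" 0]
    by (intro convolution_density) (auto simp: prob_space_def)
  also have "(\<lambda>x. \<integral>\<^sup>+y. ennreal (normal_density 0 (sqrt v) (x - y)) * ennreal (normal_density 0 (sqrt w) y)
      \<partial>lborel)
      = (\<lambda>x. ennreal (normal_density 0 (sqrt (v + w)) x))"
    using conv_normal_density_zero_mean[of "sqrt v" "sqrt w"] assms by (simp add: ennreal_mult fun_eq_iff)
  finally show ?thesis by (simp add: convolution_def gauss_def case_prod_unfold)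
qed

lemma emeasure_distr_nn_integral:
  assumes "h \<in> measurable M N" "X \<in> sets N"
  shows "emeasure (distr M N h) X = (\<integral>\<^sup>+p. indicator X (h p) \<partial>M)"
proof -
  have "(\<integral>\<^sup>+p. indicator X (h p) \<partial>M) = (\<integral>\<^sup>+x. indicator X x \<partial>distr M N h)"
    using assms by (intro nn_integral_distr[symmetric]) auto
  then show ?thesis using assms by simp
qed

text \<open>These cover the degenerate sums: subchannels that the jammer leaves alone and
  subchannels without noise.\<close>

lemma distr_add_return:
  assumes M: "prob_space M" "sets M = sets (borel :: real measure)"
  shows "distr (M \<Otimes>\<^sub>M return borel 0) borel (\<lambda>p. fst p + snd p) = M"
    and "distr (return borel 0 \<Otimes>\<^sub>M M) borel (\<lambda>p. fst p + snd p) = M"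
proof -
  note [measurable_cong] = M(2)
  have [measurable_cong]: "sets (return borel (0::real)) = sets borel" by simp
  have R: "prob_space (return borel (0::real))" by (intro prob_space_return) simp
  interpret R: prob_space "return borel (0::real)" by (rule R)
  interpret M: prob_space M by (rule M)
  show "distr (M \<Otimes>\<^sub>M return borel 0) borel (\<lambda>p. fst p + snd p) = M"
  proof (rule measure_eqI)
    fix X assume "X \<in> sets (distr (M \<Otimes>\<^sub>M return borel 0) borel (\<lambda>p. fst p + snd p))"
    then have X [measurable]: "X \<in> sets borel" by simp
    have "emeasure (distr (M \<Otimes>\<^sub>M return borel 0) borel (\<lambda>p. fst p + snd p)) X
        = (\<integral>\<^sup>+p. indicator X (fst p + snd p) \<partial>(M \<Otimes>\<^sub>M return borel 0))"
      by (rule emeasure_distr_nn_integral[OF _ X]) measurable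
    also have "\<dots> = (\<integral>\<^sup>+x. \<integral>\<^sup>+y. indicator X (x + y) \<partial>return borel 0 \<partial>M)"
      by (subst R.nn_integral_fst[symmetric]) auto
    also have "\<dots> = emeasure M X"
      using X M(2) by (subst nn_integral_return) auto
    finally show "emeasure (distr (M \<Otimes>\<^sub>M return borel 0) borel (\<lambda>p. fst p + snd p)) X = emeasure M X" .
  qed (simp add: M)
  show "distr (return borel 0 \<Otimes>\<^sub>M M) borel (\<lambda>p. fst p + snd p) = M"
  proof (rule measure_eqI)
    fix X assume "X \<in> sets (distr (return borel 0 \<Otimes>\<^sub>M M) borel (\<lambda>p. fst p + snd p))"
    then have X [measurable]: "X \<in> sets borel" by simp
    have "emeasure (distr (return borel 0 \<Otimes>\<^sub>M M) borel (\<lambda>p. fst p + snd p)) X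
        = (\<integral>\<^sup>+p. indicator X (fst p + snd p) \<partial>(return borel 0 \<Otimes>\<^sub>M M))"
      by (rule emeasure_distr_nn_integral[OF _ X]) measurable
    also have "\<dots> = (\<integral>\<^sup>+x. \<integral>\<^sup>+y. indicator X (x + y) \<partial>M \<partial>return borel 0)"
      by (subst M.nn_integral_fst[symmetric]) auto
    also have "\<dots> = emeasure M X"
      using X M(2) by (subst nn_integral_return) auto
    finally show "emeasure (distr (return borel 0 \<Otimes>\<^sub>M M) borel (\<lambda>p. fst p + snd p)) X = emeasure M X" .
  qed (simp add: M)
qed

text \<open>This is where independence of the noise across subchannels enters the converse.\<close>

lemma noise_law_vlaw:
  assumes P: "prob_space P" and ind: "prob_space.indep_vars P (\<lambda>_. borel) N UNIV"
  shows "noise_law P N = vlaw (\<lambda>k. distr P borel (N k))"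
proof -
  interpret prob_space P by (rule P)
  have rv: "random_variable borel (N k)" for k using ind by (simp add: indep_vars_def)
  have "distr P (PiM UNIV (\<lambda>_. borel)) (\<lambda>\<omega>. \<lambda>k\<in>UNIV. N k \<omega>) = PiM UNIV (\<lambda>k. distr P borel (N k))"
    using indep_vars_iff_distr_eq_PiM[of UNIV N "\<lambda>_. borel"] ind rv by simp
  then have "vlaw (\<lambda>k. distr P borel (N k)) = distr (distr P (PiM UNIV (\<lambda>_. borel)) (\<lambda>\<omega>. \<lambda>k\<in>UNIV. N k \<omega>))
      borel (\<lambda>g. \<chi> k. g k)"
    by (simp add: vlaw_def)
  also have "\<dots> = distr P borel (\<lambda>\<omega>. \<chi> k. N k \<omega>)"
    using rv by (subst distr_distr) (auto simp: comp_def restrict_def measurable_vec_lambda intro!: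
        measurable_PiM_single' measurable_restrict)
  finally show ?thesis by (simp add: noise_law_def)
qed

text \<open>A density cannot represent variance 0, so the point mass is added by hand. Jamming or
  noise may be degenerate, but their sum always has positive variance.\<close>

definition gauss0 :: "real \<Rightarrow> real measure" where
  "gauss0 v = (if v = 0 then return borel 0 else gauss 0 v)"

lemma sets_gauss0 [simp]: "sets (gauss0 v) = sets borel"
  by (simp add: gauss0_def)

lemma prob_space_gauss0: "0 \<le> v \<Longrightarrow> prob_space (gauss0 v)"
  by (auto simp: gauss0_def prob_space_gauss intro: prob_space_return)

lemma distr_gauss0_add:
  assumes "0 \<le> v" "0 \<le> w" "0 < v + w"
  shows "distr (gauss0 v \<Otimes>\<^sub>M gauss0 w) borel (\<lambda>p. x + fst p + snd p) = gauss x (v + w)"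
proof -
  have sum: "distr (gauss0 v \<Otimes>\<^sub>M gauss0 w) borel (\<lambda>p. fst p + snd p) = gauss 0 (v + w)"
    using assms distr_add_return[of "gauss 0 v"] distr_add_return[of "gauss 0 w"] distr_gauss_add[of v w]
    by (auto simp: gauss0_def prob_space_gauss)
  have [measurable_cong]: "sets (gauss0 v) = sets borel" "sets (gauss0 w) = sets borel" by simp_all
  have "distr (gauss0 v \<Otimes>\<^sub>M gauss0 w) borel (\<lambda>p. x + fst p + snd p)
      = distr (distr (gauss0 v \<Otimes>\<^sub>M gauss0 w) borel (\<lambda>p. fst p + snd p)) borel (\<lambda>y. x + y)"
    by (subst distr_distr) (auto simp: comp_def add.assoc)
  then show ?thesis by (simp add: sum distr_gauss_shift)
qed

lemma distr_centered_gaussian: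
  assumes P: "prob_space P" and X: "centered_gaussian P X s"
  shows "distr P borel X = gauss0 (s\<^sup>2)"
proof (cases "s = 0")
  case True
  interpret prob_space P by (rule P)
  have [measurable]: "X \<in> borel_measurable P" and "AE \<omega> in P. X \<omega> = 0"
    using X True by (simp_all add: centered_gaussian_def)
  then have "distr P borel X = distr P borel (\<lambda>_. 0)" by (intro distr_cong_AE) auto
  also have "\<dots> = return borel 0" by (rule distr_const) simp
  finally show ?thesis using True by (simp add: gauss0_def)
next
  case False
  then have D: "distributed P lborel X (normal_density 0 s)" using X by (simp add: centered_gaussian_def)
  have "distr P borel X = distr P lborel X" by (intro distr_cong) auto
  also have "\<dots> = density lborel (normal_density 0 s)" by (rule distributed_distr_eq_density[OF D])
  also have "normal_density 0 s = normal_density 0 (sqrt (s\<^sup>2))" by (simp add: normal_density_def fun_eq_iff)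
  finally show ?thesis using False by (simp add: gauss0_def gauss_def)
qed

section \<open>Converse\<close>

definition output_col :: "('k::finite \<Rightarrow> real) \<Rightarrow> real ^ 'k \<Rightarrow> (real ^ 'k) measure" where
  "output_col v u = vlaw (\<lambda>l. gauss (u $ l) (v l))"

text \<open>The reference law depends on the hop but not on the amplitude, so blocks of length n
  need only \<open>CARD('k) ^ n\<close> of them.\<close>

definition ref_col :: "('k::finite \<Rightarrow> real) \<Rightarrow> real \<Rightarrow> 'k \<Rightarrow> (real ^ 'k) measure" where
  "ref_col v \<Gamma> k = vlaw (\<lambda>l. gauss 0 (if l = k then v k + \<Gamma> else v l))"

lemma sets_output_col [simp, measurable_cong]: "sets (output_col v u) = sets borel"
  and sets_ref_col [simp, measurable_cong]: "sets (ref_col v \<Gamma> k) = sets borel"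
  by (simp_all add: output_col_def ref_col_def)

lemma sets_PiM_borel_signal: "(\<And>i. sets (W i) = sets borel) \<Longrightarrow> sets (PiM {1..n} W) = sets (signal_space n)"
  unfolding signal_space_def by (intro sets_PiM_cong) auto

context
  fixes v :: "'k::finite \<Rightarrow> real" and c \<Gamma> :: real
  assumes c: "0 < c" and \<Gamma>: "0 < \<Gamma>" and v: "\<And>k. c \<le> v k"
begin

lemma v_pos: "0 < v k"
  using c v[of k] by linarith

lemma prob_space_output_col: "prob_space (output_col v u)"
  unfolding output_col_def by (intro prob_space_vlaw prob_space_gauss v_pos sets_gauss)

lemma prob_space_ref_col: "prob_space (ref_col v \<Gamma> k)"
  unfolding ref_col_def using v_pos \<Gamma> by (intro prob_space_vlaw prob_space_gauss sets_gauss) (auto intro: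
      add_pos_pos)

lemma output_col_density:
  "output_col v (hop x k) = density (ref_col v \<Gamma> k) (\<lambda>y. ennreal (exp (log_ratio (v k) \<Gamma> x (y $ k))))"
proof -
  let ?m = "\<lambda>l. gauss 0 (if l = k then v k + \<Gamma> else v l)" and ?f = "\<lambda>y. ennreal (exp (log_ratio (v k) \<Gamma> x y))"
  have m: "prob_space (?m l)" for l using v_pos \<Gamma> by (auto intro!: prob_space_gauss add_pos_pos)
  have D: "density (?m k) ?f = gauss x (v k)" using gauss_shift_density[OF v_pos \<Gamma>] by simp
  have "(\<lambda>l. if l = k then density (?m k) ?f else ?m l) = (\<lambda>l. gauss (hop x k $ l) (v l))"
    unfolding D by (auto simp: hop_nth)
  moreover have "vlaw (\<lambda>l. if l = k then density (?m k) ?f else ?m l) = density (vlaw ?m) (\<lambda>y. ?f (y $ k))"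
    by (rule vlaw_density[OF m sets_gauss]) (use prob_space_gauss[OF v_pos] in \<open>auto simp:
        gauss_shift_density[OF v_pos \<Gamma>, symmetric]\<close>)
  ultimately show ?thesis by (simp add: output_col_def ref_col_def)
qed

text \<open>The bound uses \<open>c\<close> in place of \<open>v k\<close>, hence is the same for
  all subchannels. Its dependence on \<open>x\<close> is split into multiples of
  \<open>x\<^sup>2 - \<Gamma>\<close> and \<open>x\<^sup>2\<close>, because the power constraint
  controls the sums of both over time.\<close>

lemma nn_integral_output_col_le:
  assumes l: "0 \<le> l"
  shows "(\<integral>\<^sup>+y. ennreal (exp (l * (log_ratio (v k) \<Gamma> x (y $ k) - \<theta>))) \<partial>output_col v (hop x k))
    \<le> ennreal (exp (l * (ln (1 + \<Gamma> / c) / 2 - \<theta>) + l\<^sup>2 / 4 + (x\<^sup>2 - \<Gamma>) * (l / (2 * (c + \<Gamma>))) + x\<^sup>2 * (l\<^sup>2 /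
        (2 * \<Gamma>))))"
proof -
  have "(\<integral>\<^sup>+y. ennreal (exp (l * (log_ratio (v k) \<Gamma> x (y $ k) - \<theta>))) \<partial>output_col v (hop x k))
      = (\<integral>\<^sup>+y. ennreal (exp (l * (log_ratio (v k) \<Gamma> x y - \<theta>))) \<partial>gauss x (v k))"
    unfolding output_col_def
    using nn_integral_vlaw_component[where m = "\<lambda>l. gauss (hop x k $ l) (v l)" and k = k and f = "\<lambda>y.
        ennreal (exp (l * (log_ratio (v k) \<Gamma> x y - \<theta>)))", OF prob_space_gauss[OF v_pos] sets_gauss]
    by (simp add: hop_nth)
  also have "\<dots> = (\<integral>\<^sup>+y. ennreal (exp (- l * \<theta>)) * ennreal (exp (l * log_ratio (v k) \<Gamma> x y)) \<partial>gauss x (v k))"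
    by (intro nn_integral_cong) (simp add: ennreal_mult[symmetric] exp_add[symmetric] algebra_simps)
  also have "\<dots> = ennreal (exp (- l * \<theta>)) * (\<integral>\<^sup>+y. ennreal (exp (l * log_ratio (v k) \<Gamma> x y)) \<partial>gauss x (v k))"
    by (rule nn_integral_cmult) simp
  also have "\<dots> \<le> ennreal (exp (- l * \<theta>)) * ennreal (exp (l * (ln (1 + \<Gamma> / v k) / 2 + (x\<^sup>2 - \<Gamma>) / (2 * (v k +
      \<Gamma>))) + l\<^sup>2 * (1 / 4 + x\<^sup>2 / (2 * \<Gamma>))))"
    by (intro mult_left_mono nn_integral_exp_log_ratio_output v_pos \<Gamma> l) auto
  also have "\<dots> = ennreal (exp (- l * \<theta> + (l * (ln (1 + \<Gamma> / v k) / 2 + (x\<^sup>2 - \<Gamma>) / (2 * (v k + \<Gamma>))) + l\<^sup>2 *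
      (1 / 4 + x\<^sup>2 / (2 * \<Gamma>)))))"
    by (subst ennreal_mult[symmetric], simp, simp, subst mult_exp_exp, rule refl)
  also have "\<dots> \<le> ennreal (exp (- l * \<theta> + (l * (ln (1 + \<Gamma> / c) / 2 + (x\<^sup>2 - \<Gamma>) / (2 * (c + \<Gamma>))) + l\<^sup>2 * (1 /
      4 + x\<^sup>2 / (2 * \<Gamma>)))))"
    using information_antimono_noise[OF c v \<Gamma>] l
    by (intro ennreal_leI iffD2[OF exp_le_cancel_iff] add_left_mono add_right_mono mult_left_mono)
  also have "- l * \<theta> + (l * (ln (1 + \<Gamma> / c) / 2 + (x\<^sup>2 - \<Gamma>) / (2 * (c + \<Gamma>))) + l\<^sup>2 * (1 / 4 + x\<^sup>2 / (2 * \<Gamma>)))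
      = l * (ln (1 + \<Gamma> / c) / 2 - \<theta>) + l\<^sup>2 / 4 + (x\<^sup>2 - \<Gamma>) * (l / (2 * (c + \<Gamma>))) + x\<^sup>2 * (l\<^sup>2 / (2 * \<Gamma>))"
  proof -
    have "- l * \<theta> + (l * (a / 2 + p / d) + l\<^sup>2 * (1 / 4 + q / e)) = l * (a / 2 - \<theta>) + l\<^sup>2 / 4 + p * (l / d)
        + q * (l\<^sup>2 / e)"
      for a p d q e :: real by (simp add: ring_distribs mult.commute)
    then show ?thesis .
  qed
  finally show ?thesis .
qed

text \<open>Pointwise, a likelihood ratio r satisfies r \<le> t + r (r / t) ^ l for all t > 0.\<close>

lemma emeasure_output_le:
  assumes l: "0 \<le> l" and B: "B \<in> sets (signal_space n)" and pow: "(\<Sum>i=1..n. (x i)\<^sup>2) \<le> real n * \<Gamma>"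
  shows "emeasure (PiM {1..n} (\<lambda>i. output_col v (hop (x i) (\<kappa> i)))) B
    \<le> ennreal (exp \<theta> ^ n) * emeasure (PiM {1..n} (\<lambda>i. ref_col v \<Gamma> (\<kappa> i))) B
      + ennreal (exp (l * (ln (1 + \<Gamma> / c) / 2 - \<theta>) + 3 / 4 * l\<^sup>2) ^ n)"
proof -
  let ?W = "\<lambda>i. output_col v (hop (x i) (\<kappa> i))" and ?q = "\<lambda>i. ref_col v \<Gamma> (\<kappa> i)" and ?I = "{1..n}"
  let ?r = "\<lambda>i y. log_ratio (v (\<kappa> i)) \<Gamma> (x i) (y $ \<kappa> i)"
  let ?S = "\<lambda>y. \<Sum>i\<in>?I. ?r i (y i)"
  have sq: "sets (PiM ?I ?q) = sets (signal_space n)" and sW: "sets (PiM ?I ?W) = sets (signal_space n)"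
    by (intro sets_PiM_borel_signal; simp)+
  note [measurable_cong] = sq sW
  have [measurable]: "B \<in> sets (signal_space n)" by (rule B)
  have S [measurable]: "?S \<in> borel_measurable (signal_space n)"
  proof -
    have "(\<lambda>y. ?r i (y i)) \<in> borel_measurable (signal_space n)" if "i \<in> ?I" for i
    proof -
      have "(\<lambda>y. y i) \<in> borel_measurable (signal_space n)"
        by (rule measurable_signal_component[OF _ that]) simp
      then show ?thesis by measurable
    qed
    then show ?thesis by (intro borel_measurable_sum)
  qed
  have "PiM ?I ?W = PiM ?I (\<lambda>i. density (?q i) (\<lambda>y. ennreal (exp (?r i y))))"
    by (simp add: output_col_density)
  also have "\<dots> = density (PiM ?I ?q) (\<lambda>y. \<Prod>i\<in>?I. ennreal (exp (?r i (y i))))"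
    by (rule PiM_density) (use prob_space_output_col in \<open>auto simp: prob_space_ref_col
        output_col_density[symmetric]\<close>)
  also have "\<dots> = density (PiM ?I ?q) (\<lambda>y. ennreal (exp (?S y)))"
    by (simp add: prod_ennreal exp_sum)
  finally have W: "PiM ?I ?W = density (PiM ?I ?q) (\<lambda>y. ennreal (exp (?S y)))" .
  let ?T = "real n * \<theta>"
  have pw: "ennreal (exp (?S y)) * indicator B y
     \<le> ennreal (exp ?T) * indicator B y + ennreal (exp (?S y)) * ennreal (exp (l * (?S y - ?T)))" for y
  proof (cases "?S y \<le> ?T")
    case True
    then have "ennreal (exp (?S y)) * indicator B y \<le> ennreal (exp ?T) * indicator B y"
      by (intro mult_right_mono ennreal_leI) auto
    then show ?thesis by (rule order_trans) simp
  next
    case False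
    then have "ennreal (exp (?S y)) * indicator B y \<le> ennreal (exp (?S y)) * ennreal (exp (l * (?S y - ?T)))"
      using l by (intro mult_left_mono) (auto simp: indicator_def)
    then show ?thesis by (rule order_trans) simp
  qed
  have "emeasure (PiM ?I ?W) B = (\<integral>\<^sup>+y. ennreal (exp (?S y)) * indicator B y \<partial>PiM ?I ?q)"
    unfolding W using B by (subst emeasure_density) (auto simp: sq simp del: One_nat_def)
  also have "\<dots> \<le> (\<integral>\<^sup>+y. ennreal (exp ?T) * indicator B y + ennreal (exp (?S y)) * ennreal (exp (l * (?S y -
      ?T))) \<partial>PiM ?I ?q)"
    by (intro nn_integral_mono pw)
  also have "\<dots> = ennreal (exp ?T) * emeasure (PiM ?I ?q) B + (\<integral>\<^sup>+y. ennreal (exp (?S y)) * ennreal (exp (l *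
      (?S y - ?T))) \<partial>PiM ?I ?q)"
    using B by (subst nn_integral_add) (auto simp: nn_integral_cmult sq simp del: One_nat_def)
  also have "(\<integral>\<^sup>+y. ennreal (exp (?S y)) * ennreal (exp (l * (?S y - ?T))) \<partial>PiM ?I ?q) = (\<integral>\<^sup>+y. ennreal (exp
      (l * (?S y - ?T))) \<partial>PiM ?I ?W)"
    unfolding W by (subst nn_integral_density) (auto simp del: One_nat_def)
  also have "\<dots> = (\<integral>\<^sup>+y. (\<Prod>i\<in>?I. ennreal (exp (l * (?r i (y i) - \<theta>)))) \<partial>PiM ?I ?W)"
    by (intro nn_integral_cong) (subst prod_ennreal, simp, simp add: exp_sum[symmetric]
        sum_distrib_left[symmetric] sum_subtractf)
  also have "\<dots> = (\<Prod>i\<in>?I. \<integral>\<^sup>+y. ennreal (exp (l * (?r i y - \<theta>))) \<partial>?W i)"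
    by (rule nn_integral_PiM_prod[OF prob_space_output_col]) auto
  also have "\<dots> \<le> (\<Prod>i\<in>?I. ennreal (exp (l * (ln (1 + \<Gamma> / c) / 2 - \<theta>) + l\<^sup>2 / 4 + ((x i)\<^sup>2 - \<Gamma>) * (l / (2 * (c
      + \<Gamma>))) + (x i)\<^sup>2 * (l\<^sup>2 / (2 * \<Gamma>)))))"
    by (intro prod_mono_ennreal nn_integral_output_col_le l)
  also have "\<dots> = ennreal (exp (\<Sum>i\<in>?I. l * (ln (1 + \<Gamma> / c) / 2 - \<theta>) + l\<^sup>2 / 4 + ((x i)\<^sup>2 - \<Gamma>) * (l / (2 * (c
      + \<Gamma>))) + (x i)\<^sup>2 * (l\<^sup>2 / (2 * \<Gamma>))))"
    by (subst prod_ennreal) (auto simp: exp_sum)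
  \<comment> \<open>By the power constraint the terms in \<open>x\<^sup>2 - \<Gamma>\<close> sum to
    at most 0 and those in \<open>x\<^sup>2\<close> to at most \<open>n * l\<^sup>2 / 2\<close>;
    with \<open>n * l\<^sup>2 / 4\<close> this gives the factor 3/4.\<close>
  also have "\<dots> \<le> ennreal (exp (l * (ln (1 + \<Gamma> / c) / 2 - \<theta>) + 3 / 4 * l\<^sup>2) ^ n)"
  proof (intro ennreal_leI)
    define a where "a = l * (ln (1 + \<Gamma> / c) / 2 - \<theta>)"
    define d where "d = l / (2 * (c + \<Gamma>))"
    define e where "e = l\<^sup>2 / (2 * \<Gamma>)"
    define X where "X = (\<Sum>i=1..n. (x i)\<^sup>2)"
    have d: "0 \<le> d" and e: "0 \<le> e" using l c \<Gamma> by (auto simp: d_def e_def)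
    have "(\<Sum>i\<in>?I. a + l\<^sup>2 / 4 + ((x i)\<^sup>2 - \<Gamma>) * d + (x i)\<^sup>2 * e) = real n * (a + l\<^sup>2 / 4) + (X - real n * \<Gamma>)
        * d + X * e"
      by (simp add: sum.distrib sum_subtractf sum_distrib_right[symmetric] X_def ring_distribs)
    also have "\<dots> \<le> real n * (a + l\<^sup>2 / 4) + 0 + real n * \<Gamma> * e"
      using pow d e unfolding X_def[symmetric] by (intro add_mono mult_right_mono mult_nonpos_nonneg
          order_refl) auto
    also have "\<dots> = real n * (a + 3 / 4 * l\<^sup>2)" using \<Gamma> by (simp add: e_def field_simps)
    finally show "exp (\<Sum>i\<in>?I. l * (ln (1 + \<Gamma> / c) / 2 - \<theta>) + l\<^sup>2 / 4 + ((x i)\<^sup>2 - \<Gamma>) * (l / (2 * (c + \<Gamma>))) +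
        (x i)\<^sup>2 * (l\<^sup>2 / (2 * \<Gamma>)))
        \<le> exp (l * (ln (1 + \<Gamma> / c) / 2 - \<theta>) + 3 / 4 * l\<^sup>2) ^ n"
      unfolding a_def[symmetric] d_def[symmetric] e_def[symmetric] by (simp add: exp_of_nat_mult[symmetric])
  qed
  finally show ?thesis by (simp add: exp_of_nat_mult[symmetric] add_left_mono)
qed

text \<open>The hopping sequence is taken extensional, so that it belongs to a finite set over which
  one can sum.\<close>

lemma codeword_hopE:
  assumes "u \<in> codewords n"
  obtains x and \<kappa> :: "nat \<Rightarrow> 'k" where "\<kappa> \<in> {1..n} \<rightarrow>\<^sub>E UNIV" "\<And>i. i \<in> {1..n} \<Longrightarrow> u i = hop (x i) (\<kappa> i)"
proof -
  have "\<forall>i\<in>{1..n}. \<exists>p. u i = hop (fst p) (snd p)"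
    using assms by (fastforce simp: codewords_def hop_def)
  then obtain p where p: "\<And>i. i \<in> {1..n} \<Longrightarrow> u i = hop (fst (p i)) (snd (p i))" by metis
  show ?thesis
    by (rule that[of "restrict (snd \<circ> p) {1..n}" "fst \<circ> p"]) (auto simp: p simp del: One_nat_def)
qed

text \<open>Decoding sets are disjoint, but the reference law changes with the message. Each
  reference probability is therefore enlarged to the sum over all hopping sequences; after
  exchanging the sums, each hopping sequence contributes at most 1.\<close>

lemma sum_success_le:
  assumes l: "0 \<le> l" and code: "(f, \<phi>) \<in> codes n \<Gamma> M"
  shows "(\<Sum>m=1..M. emeasure (PiM {1..n} (\<lambda>i. output_col v (f m i))) {y \<in> space (signal_space n). \<phi> y = m})
    \<le> ennreal (real CARD('k) ^ n * exp \<theta> ^ n + real M * exp (l * (ln (1 + \<Gamma> / c) / 2 - \<theta>) + 3 / 4 * l\<^sup>2) ^ n)"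
proof -
  let ?D = "\<lambda>m. {y \<in> space (signal_space n). \<phi> y = m}" and ?H = "{1..n} \<rightarrow>\<^sub>E (UNIV :: 'k set)"
  let ?q = "\<lambda>\<kappa>. PiM {1..n} (\<lambda>i. ref_col v \<Gamma> (\<kappa> i))"
  let ?t = "exp (l * (ln (1 + \<Gamma> / c) / 2 - \<theta>) + 3 / 4 * l\<^sup>2) ^ n"
  have \<phi>: "\<phi> \<in> measurable (signal_space n) (count_space {1..M})" using code by (simp add: codes_def)
  have D: "?D m \<in> sets (signal_space n)" if "m \<in> {1..M}" for m
  proof -
    have "\<phi> -` {m} \<inter> space (signal_space n) \<in> sets (signal_space n)"
      using that by (intro measurable_sets[OF \<phi>]) auto
    also have "\<phi> -` {m} \<inter> space (signal_space n) = ?D m" by auto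
    finally show ?thesis .
  qed
  have H: "finite ?H" "card ?H = CARD('k) ^ n" by (auto simp: finite_PiE card_PiE)
  have sq: "sets (?q \<kappa>) = sets (signal_space n)" for \<kappa> by (intro sets_PiM_borel_signal) simp
  have each: "emeasure (PiM {1..n} (\<lambda>i. output_col v (f m i))) (?D m)
      \<le> ennreal (exp \<theta> ^ n) * (\<Sum>\<kappa>\<in>?H. emeasure (?q \<kappa>) (?D m)) + ennreal ?t" if m: "m \<in> {1..M}" for m
  proof -
    have "f m \<in> codewords n" using code m by (auto simp: codes_def)
    then obtain x \<kappa> where \<kappa>: "\<kappa> \<in> ?H" and fm: "\<And>i. i \<in> {1..n} \<Longrightarrow> f m i = hop (x i) (\<kappa> i)"
      by (rule codeword_hopE) blast
    have "(\<Sum>i=1..n. (x i)\<^sup>2) = (\<Sum>i=1..n. (norm (f m i))\<^sup>2)"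
      by (intro sum.cong refl) (simp add: fm)
    then have pow: "(\<Sum>i=1..n. (x i)\<^sup>2) \<le> real n * \<Gamma>" using code m by (auto simp: codes_def)
    have "PiM {1..n} (\<lambda>i. output_col v (f m i)) = PiM {1..n} (\<lambda>i. output_col v (hop (x i) (\<kappa> i)))"
      by (intro PiM_cong refl) (simp add: fm)
    then have "emeasure (PiM {1..n} (\<lambda>i. output_col v (f m i))) (?D m)
        \<le> ennreal (exp \<theta> ^ n) * emeasure (?q \<kappa>) (?D m) + ennreal ?t"
      using emeasure_output_le[OF l D[OF m] pow] by simp
    also have "emeasure (?q \<kappa>) (?D m) \<le> (\<Sum>\<kappa>\<in>?H. emeasure (?q \<kappa>) (?D m))"
      using \<kappa> H(1) by (intro member_le_sum) auto
    finally show ?thesis by (simp add: add_right_mono mult_left_mono)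
  qed
  have "(\<Sum>m=1..M. emeasure (PiM {1..n} (\<lambda>i. output_col v (f m i))) (?D m))
      \<le> (\<Sum>m=1..M. ennreal (exp \<theta> ^ n) * (\<Sum>\<kappa>\<in>?H. emeasure (?q \<kappa>) (?D m)) + ennreal ?t)"
    by (intro sum_mono each)
  also have "\<dots> = ennreal (exp \<theta> ^ n) * (\<Sum>m=1..M. \<Sum>\<kappa>\<in>?H. emeasure (?q \<kappa>) (?D m)) + ennreal (real M * ?t)"
    by (simp add: sum.distrib sum_distrib_left[symmetric] ennreal_mult ennreal_of_nat_eq_real_of_nat)
  also have "(\<Sum>m=1..M. \<Sum>\<kappa>\<in>?H. emeasure (?q \<kappa>) (?D m)) = (\<Sum>\<kappa>\<in>?H. \<Sum>m=1..M. emeasure (?q \<kappa>) (?D m))"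
    by (rule sum.swap)
  also have "ennreal (exp \<theta> ^ n) * (\<Sum>\<kappa>\<in>?H. \<Sum>m=1..M. emeasure (?q \<kappa>) (?D m)) + ennreal (real M * ?t)
      \<le> ennreal (exp \<theta> ^ n) * (\<Sum>\<kappa>\<in>?H. 1) + ennreal (real M * ?t)"
  proof (intro add_right_mono mult_left_mono sum_mono)
    fix \<kappa>
    interpret q: prob_space "?q \<kappa>" by (intro prob_space_PiM prob_space_ref_col)
    have "(\<Sum>m=1..M. emeasure (?q \<kappa>) (?D m)) = emeasure (?q \<kappa>) (\<Union>m\<in>{1..M}. ?D m)"
      using D sq by (intro sum_emeasure) (auto simp: disjoint_family_on_def)
    also have "\<dots> \<le> 1" by (rule q.emeasure_le_1)
    finally show "(\<Sum>m=1..M. emeasure (?q \<kappa>) (?D m)) \<le> 1" .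
  qed simp
  also have "\<dots> = ennreal (real CARD('k) ^ n * exp \<theta> ^ n + real M * ?t)"
    using H(2) by (simp add: ennreal_of_nat_eq_real_of_nat ennreal_mult[symmetric] ennreal_plus[symmetric]
        mult.commute del: ennreal_plus)
  finally show ?thesis .
qed

end

section \<open>Gaussian jamming and its power\<close>

lemma nn_integral_gauss0_square:
  assumes "0 \<le> v" shows "(\<integral>\<^sup>+x. ennreal (x\<^sup>2) \<partial>gauss0 v) = ennreal v"
proof (cases "v = 0")
  case True
  then show ?thesis by (simp add: gauss0_def nn_integral_return)
next
  case False
  then have v: "0 < v" using assms by simp
  then show ?thesis using gauss_moments[OF v] by (simp add: gauss0_def nn_integral_eq_integral)
qed

text \<open>Independence over time and over subchannels reduces the claim to the addition of two
  centered Gaussian variances.\<close>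

lemma received_law:
  fixes \<delta> s2 v :: "'k::finite \<Rightarrow> real"
  assumes nonneg: "\<And>k. 0 \<le> \<delta> k" "\<And>k. 0 \<le> s2 k" and v: "\<And>k. v k = \<delta> k + s2 k" "\<And>k. 0 < v k"
  shows "distr (PiM {1..n} (\<lambda>_. vlaw (\<lambda>k. gauss0 (\<delta> k))) \<Otimes>\<^sub>M PiM {1..n} (\<lambda>_. vlaw (\<lambda>k. gauss0 (s2 k))))
      (signal_space n)
      (\<lambda>(s, z). received n u s z) = PiM {1..n} (\<lambda>i. output_col v (u i))"
proof -
  let ?J = "vlaw (\<lambda>k. gauss0 (\<delta> k))" and ?N = "vlaw (\<lambda>k. gauss0 (s2 k))"
  have p: "prob_space ?J" "prob_space ?N" using nonneg by (intro prob_space_vlaw prob_space_gauss0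
      sets_gauss0; simp)+
  have "distr (PiM {1..n} (\<lambda>_. ?J) \<Otimes>\<^sub>M PiM {1..n} (\<lambda>_. ?N)) (PiM {1..n} (\<lambda>_. borel)) (\<lambda>(s, z). \<lambda>i\<in>{1..n}. u
      i + fst (s i, z i) + snd (s i, z i))
      = PiM {1..n} (\<lambda>i. distr (?J \<Otimes>\<^sub>M ?N) borel (\<lambda>p. u i + fst p + snd p))"
    by (rule distr_pair_PiM) (auto intro: p)
  moreover have "distr (?J \<Otimes>\<^sub>M ?N) borel (\<lambda>p. u i + fst p + snd p) = output_col v (u i)" for i
    using nonneg v unfolding output_col_def
    by (subst vlaw_add) (auto intro!: prob_space_gauss0 arg_cong[where f=vlaw] ext distr_gauss0_add)
  ultimately show ?thesis by (simp add: signal_space_def received_def[abs_def])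
qed

text \<open>
  A signal with excess below 1 satisfies the power constraint and vanishes off the support of
  the jamming variances.  The factor \<open>\<top>\<close> is harmless since \<open>\<top> * 0 = 0\<close> in \<open>ennreal\<close>.
\<close>

definition excess :: "('k::finite \<Rightarrow> real) \<Rightarrow> nat \<Rightarrow> real \<Rightarrow> 'k signal \<Rightarrow> ennreal" where
  "excess \<delta> n \<Lambda> s = (\<Sum>i=1..n. \<Sum>k\<in>UNIV. (if \<delta> k = 0 then \<top> else ennreal (1 / (real n * \<Lambda>))) * ennreal ((s i $
      k)\<^sup>2))"

context
  fixes \<delta> s2 v :: "'k::finite \<Rightarrow> real" and n M J :: nat and c \<Gamma> \<Lambda> :: real and Q :: "'k code measure"
  assumes nonneg: "\<And>k. 0 \<le> \<delta> k" "\<And>k. 0 \<le> s2 k" and v: "\<And>k. v k = \<delta> k + s2 k" "\<And>k. c \<le> v k"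
    and c: "0 < c" and \<Gamma>: "0 < \<Gamma>" and \<Lambda>: "0 < \<Lambda>" and n: "1 \<le> n"
    and J: "card {k. 0 < \<delta> k} \<le> J" "J \<le> CARD('k)"
    and Q: "cr_code n \<Gamma> M Q"
begin

abbreviation (input) "jam \<equiv> vlaw (\<lambda>k. gauss0 (\<delta> k))"
abbreviation (input) "noise \<equiv> vlaw (\<lambda>k. gauss0 (s2 k))"

lemma prob_space_jam: "prob_space jam" and prob_space_noise: "prob_space noise"
  using nonneg by (intro prob_space_vlaw prob_space_gauss0 sets_gauss0; simp)+

lemma sets_PiM_jam: "sets (PiM {1..n} (\<lambda>_. jam)) = sets (signal_space n)"
  and sets_PiM_noise: "sets (PiM {1..n} (\<lambda>_. noise)) = sets (signal_space n)"
  by (intro sets_PiM_signal sets_vlaw)+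

text \<open>Averaged over the Gaussian jamming, the channel is additive Gaussian with variances
  \<open>v\<close>, so the estimates for \<open>output_col\<close> apply to each single
  code.\<close>

lemma nn_integral_success:
  assumes m: "m \<in> {1..M}" and k: "k \<in> space Q"
  shows "(\<integral>\<^sup>+s. ennreal (1 - msg_error noise n k s m) \<partial>PiM {1..n} (\<lambda>_. jam))
    = emeasure (PiM {1..n} (\<lambda>i. output_col v (fst k m i))) {y \<in> space (signal_space n). snd k y = m}"
proof -
  let ?J = "PiM {1..n} (\<lambda>_. jam)" and ?N = "PiM {1..n} (\<lambda>_. noise)"
  let ?D = "{y \<in> space (signal_space n). snd k y = m}"
  note [measurable_cong] = sets_PiM_jam sets_PiM_noise
  have "k \<in> codes n \<Gamma> M" using Q k unfolding cr_code_def by blast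
  then have "fst k \<in> {1..M} \<rightarrow>\<^sub>E codewords n" and \<phi>: "snd k \<in> measurable (signal_space n) (count_space {1..M})"
    unfolding codes_def by (simp_all add: case_prod_unfold)
  then have u: "fst k m \<in> space (signal_space n)" using m codewords_subset by blast
  have "snd k -` {m} \<inter> space (signal_space n) \<in> sets (signal_space n)"
    using m by (intro measurable_sets[OF \<phi>]) auto
  also have "snd k -` {m} \<inter> space (signal_space n) = ?D" by auto
  finally have D [measurable]: "?D \<in> sets (signal_space n)" .
  have rec [measurable]: "(\<lambda>(s, z). received n (fst k m) s z) \<in> measurable (?J \<Otimes>\<^sub>M ?N) (signal_space n)"
    using u by measurable
  interpret N: prob_space ?N by (intro prob_space_PiM prob_space_noise)
  have one: "ennreal (1 - msg_error noise n k s m) = (\<integral>\<^sup>+z. indicator ?D (received n (fst k m) s z) \<partial>?N)"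
    if "s \<in> space ?J" for s
  proof -
    have s: "s \<in> space (signal_space n)" using that sets_eq_imp_space_eq[OF sets_PiM_jam] by simp
    have r [measurable]: "(\<lambda>z. received n (fst k m) s z) \<in> measurable ?N (signal_space n)"
      using u s by measurable
    have eq: "{z \<in> space ?N. snd k (received n (fst k m) s z) = m} = (\<lambda>z. received n (fst k m) s z) -` ?D \<inter>
        space ?N"
      using measurable_space[OF r] by auto
    have ev: "{z \<in> space ?N. snd k (received n (fst k m) s z) = m} \<in> sets ?N"
      unfolding eq by (rule measurable_sets[OF r D])
    have "1 - msg_error noise n k s m = measure ?N {z \<in> space ?N. snd k (received n (fst k m) s z) = m}"
      using N.prob_neg[OF ev] by (simp add: msg_error_def)
    then have "ennreal (1 - msg_error noise n k s m) = emeasure ?N ((\<lambda>z. received n (fst k m) s z) -` ?D \<inter>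
        space ?N)"
      by (simp only: eq N.emeasure_eq_measure)
    also have "\<dots> = emeasure (distr ?N (signal_space n) (\<lambda>z. received n (fst k m) s z)) ?D"
      by (rule emeasure_distr[symmetric]) (use r D in auto)
    also have "\<dots> = (\<integral>\<^sup>+z. indicator ?D (received n (fst k m) s z) \<partial>?N)"
      by (rule emeasure_distr_nn_integral[OF r D])
    finally show ?thesis .
  qed
  have "(\<integral>\<^sup>+s. ennreal (1 - msg_error noise n k s m) \<partial>?J) = (\<integral>\<^sup>+s. \<integral>\<^sup>+z. indicator ?D (received n (fst k m)
      s z) \<partial>?N \<partial>?J)"
    by (intro nn_integral_cong one)
  also have "\<dots> = (\<integral>\<^sup>+p. indicator ?D ((\<lambda>(s, z). received n (fst k m) s z) p) \<partial>(?J \<Otimes>\<^sub>M ?N))"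
    using measurable_compose[OF rec borel_measurable_indicator[OF D]]
    by (subst sigma_finite_measure.nn_integral_fst[OF prob_space_imp_sigma_finite[OF N.prob_space_axioms],
        symmetric]) auto
  also have "\<dots> = emeasure (distr (?J \<Otimes>\<^sub>M ?N) (signal_space n) (\<lambda>(s, z). received n (fst k m) s z)) ?D"
    by (rule emeasure_distr_nn_integral[OF rec D, symmetric])
  also have "distr (?J \<Otimes>\<^sub>M ?N) (signal_space n) (\<lambda>(s, z). received n (fst k m) s z) = PiM {1..n} (\<lambda>i.
      output_col v (fst k m i))"
    using order.strict_trans2[OF c v(2)] by (intro received_law nonneg v(1))
  finally show ?thesis .
qed

lemma one_minus_code_error:
  assumes "1 \<le> M"
  shows "ennreal (1 - code_error noise n M k s) = ennreal (1 / real M) * (\<Sum>m=1..M. ennreal (1 - msg_error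
      noise n k s m))"
proof -
  have "1 - code_error noise n M k s = 1 / real M * (\<Sum>m=1..M. 1 - msg_error noise n k s m)"
    using assms by (simp add: code_error_eq sum_subtractf field_simps)
  moreover have "0 \<le> 1 - msg_error noise n k s m" for m
    using msg_error_le_1[OF prob_space_noise] by simp
  ultimately show ?thesis
    by (simp only: sum_ennreal) (simp add: ennreal_mult[symmetric] sum_nonneg)
qed

lemma nn_integral_code_success:
  assumes l: "0 \<le> l" and k: "k \<in> space Q"
  shows "(\<integral>\<^sup>+s. ennreal (1 - code_error noise n M k s) \<partial>PiM {1..n} (\<lambda>_. jam))
    \<le> ennreal (real CARD('k) ^ n * exp \<theta> ^ n / real M + exp (l * (ln (1 + \<Gamma> / c) / 2 - \<theta>) + 3 / 4 * l\<^sup>2) ^ n)"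
proof -
  let ?J = "PiM {1..n} (\<lambda>_. jam)" and ?t = "exp (l * (ln (1 + \<Gamma> / c) / 2 - \<theta>) + 3 / 4 * l\<^sup>2) ^ n"
  have M: "1 \<le> M" using Q by (simp add: cr_code_def)
  note [measurable_cong] = sets_PiM_jam
  have me [measurable]: "(\<lambda>s. msg_error noise n k s m) \<in> borel_measurable ?J" if "m \<in> {1..M}" for m
    using measurable_compose[OF measurable_Pair1'[OF k] measurable_msg_error[OF prob_space_noise sets_vlaw Q
        that]]
    by (simp add: measurable_cong_sets[OF sets_PiM_jam refl] del: One_nat_def)
  have "(\<integral>\<^sup>+s. ennreal (1 - code_error noise n M k s) \<partial>?J)
      = (\<integral>\<^sup>+s. ennreal (1 / real M) * (\<Sum>m=1..M. ennreal (1 - msg_error noise n k s m)) \<partial>?J)"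
    by (simp only: one_minus_code_error[OF M])
  also have "\<dots> = ennreal (1 / real M) * (\<Sum>m=1..M. \<integral>\<^sup>+s. ennreal (1 - msg_error noise n k s m) \<partial>?J)"
    by (subst nn_integral_cmult) (auto simp: nn_integral_sum simp del: One_nat_def)
  also have "(\<Sum>m=1..M. \<integral>\<^sup>+s. ennreal (1 - msg_error noise n k s m) \<partial>?J)
      = (\<Sum>m=1..M. emeasure (PiM {1..n} (\<lambda>i. output_col v (fst k m i))) {y \<in> space (signal_space n). snd k y
          = m})"
    by (intro sum.cong refl nn_integral_success k)
  also have "\<dots> \<le> ennreal (real CARD('k) ^ n * exp \<theta> ^ n + real M * ?t)"
    using Q k by (intro sum_success_le[OF c \<Gamma> v(2) l]) (auto simp: cr_code_def)
  also have "ennreal (1 / real M) * \<dots> = ennreal (real CARD('k) ^ n * exp \<theta> ^ n / real M + ?t)"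
    using M by (subst ennreal_mult[symmetric]) (auto simp: field_simps simp del: ennreal_plus)
  finally show ?thesis by (simp add: mult_left_mono)
qed

text \<open>The weights are scaled so that the mean does not depend on \<open>n\<close>: it is the
  ratio of the spent to the allowed power.\<close>

lemma nn_integral_excess:
  "(\<integral>\<^sup>+s. excess \<delta> n \<Lambda> s \<partial>PiM {1..n} (\<lambda>_. jam)) = ennreal ((\<Sum>k\<in>UNIV. \<delta> k) / \<Lambda>)"
proof -
  let ?J = "PiM {1..n} (\<lambda>_. jam)"
  let ?w = "\<lambda>k. if \<delta> k = 0 then \<top> else ennreal (1 / (real n * \<Lambda>))"
  have sq: "(\<integral>\<^sup>+s. ennreal ((s i $ k)\<^sup>2) \<partial>?J) = ennreal (\<delta> k)" if i: "i \<in> {1..n}" for i k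
  proof -
    have "(\<integral>\<^sup>+s. ennreal ((s i $ k)\<^sup>2) \<partial>?J) = (\<integral>\<^sup>+y. ennreal ((y $ k)\<^sup>2) \<partial>jam)"
      by (rule nn_integral_PiM_component[where M = "\<lambda>_. jam", OF prob_space_jam i]) simp
    also have "\<dots> = (\<integral>\<^sup>+x. ennreal (x\<^sup>2) \<partial>gauss0 (\<delta> k))"
      using nonneg by (intro nn_integral_vlaw_component[where m = "\<lambda>k. gauss0 (\<delta> k)"] prob_space_gauss0
          sets_gauss0) auto
    finally show ?thesis using nonneg by (simp add: nn_integral_gauss0_square)
  qed
  have meas [measurable]: "(\<lambda>s. ennreal ((s i $ k)\<^sup>2)) \<in> borel_measurable ?J" if i: "i \<in> {1..n}" for i k
    by (rule measurable_compose[OF measurable_component_singleton[OF i]]) simp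
  have "(\<integral>\<^sup>+s. excess \<delta> n \<Lambda> s \<partial>?J) = (\<Sum>i=1..n. \<Sum>k\<in>UNIV. ?w k * (\<integral>\<^sup>+s. ennreal ((s i $ k)\<^sup>2) \<partial>?J))"
    unfolding excess_def
    by (subst nn_integral_sum, (intro borel_measurable_sum borel_measurable_times_ennreal meas; simp), intro
        sum.cong refl,
        subst nn_integral_sum, (intro borel_measurable_times_ennreal meas; simp), intro sum.cong refl
            nn_integral_cmult meas)
  also have "\<dots> = (\<Sum>i=1..n. \<Sum>k\<in>UNIV. ennreal (\<delta> k / (real n * \<Lambda>)))"
  proof (intro sum.cong refl)
    fix i k assume "i \<in> {1..n}"
    then show "?w k * (\<integral>\<^sup>+s. ennreal ((s i $ k)\<^sup>2) \<partial>?J) = ennreal (\<delta> k / (real n * \<Lambda>))"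
      using nonneg \<Lambda> by (subst sq) (auto simp: ennreal_mult[symmetric])
  qed
  also have "\<dots> = ennreal (\<Sum>i=1..n. \<Sum>k\<in>UNIV. \<delta> k / (real n * \<Lambda>))"
    using nonneg \<Lambda> by (simp add: sum_ennreal sum_nonneg del: sum_constant)
  also have "(\<Sum>i=1..n. \<Sum>k\<in>UNIV. \<delta> k / (real n * \<Lambda>)) = (\<Sum>k\<in>UNIV. \<delta> k) / \<Lambda>"
    using n by (simp add: sum_divide_distrib[symmetric])
  finally show ?thesis .
qed

lemma jamming_signal_or_excess:
  assumes s: "s \<in> space (signal_space n)" and less: "excess \<delta> n \<Lambda> s < 1"
  shows "s \<in> jamming_signals n J \<Lambda>"
proof -
  let ?w = "\<lambda>k. if \<delta> k = 0 then \<top> else ennreal (1 / (real n * \<Lambda>))"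
  \<comment> \<open>Jammer actions need sets of exactly \<open>J\<close> subchannels, so the support
    of the jamming variances is padded; the same set serves at all times.\<close>
  obtain I where I: "{k. 0 < \<delta> k} \<subseteq> I" "card I = J"
    using exists_subset_between[of "{k. 0 < \<delta> k}" J UNIV] J by auto
  have small: "?w k * ennreal ((s i $ k)\<^sup>2) < 1" if i: "i \<in> {1..n}" for i k
  proof -
    have "?w k * ennreal ((s i $ k)\<^sup>2) \<le> (\<Sum>k\<in>UNIV. ?w k * ennreal ((s i $ k)\<^sup>2))"
      by (intro member_le_sum) auto
    also have "\<dots> \<le> excess \<delta> n \<Lambda> s"
      unfolding excess_def using i by (intro member_le_sum[where f = "\<lambda>i. \<Sum>k\<in>UNIV. ?w k * ennreal ((s i $
          k)\<^sup>2)"]) auto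
    finally show ?thesis using less by (rule order.strict_trans1)
  qed
  have zero: "s i $ k = 0" if i: "i \<in> {1..n}" and k: "\<delta> k = 0" for i k
  proof (rule ccontr)
    assume "s i $ k \<noteq> 0"
    then have "\<top> * ennreal ((s i $ k)\<^sup>2) = \<top>" by (simp add: ennreal_top_mult)
    then show False using small[OF i, of k] k by simp
  qed
  have "ennreal ((\<Sum>i=1..n. (norm (s i))\<^sup>2) / (real n * \<Lambda>)) = (\<Sum>i=1..n. \<Sum>k\<in>UNIV. ennreal ((s i $ k)\<^sup>2 / (real
      n * \<Lambda>)))"
    using \<Lambda> by (simp add: sum_ennreal sum_nonneg norm_vec_square sum_divide_distrib)
  also have "\<dots> = excess \<delta> n \<Lambda> s"
    unfolding excess_def
  proof (intro sum.cong refl)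
    fix i k assume "i \<in> {1..n}"
    then show "ennreal ((s i $ k)\<^sup>2 / (real n * \<Lambda>)) = ?w k * ennreal ((s i $ k)\<^sup>2)"
      using \<Lambda> by (cases "\<delta> k = 0") (simp_all add: zero ennreal_mult[symmetric] del: One_nat_def)
  qed
  finally have "ennreal ((\<Sum>i=1..n. (norm (s i))\<^sup>2) / (real n * \<Lambda>)) < 1" using less by simp
  then have "(\<Sum>i=1..n. (norm (s i))\<^sup>2) / (real n * \<Lambda>) < 1"
    by (subst (asm) ennreal_1[symmetric], subst (asm) ennreal_less_iff) (use \<Lambda> in \<open>auto intro!:
        divide_nonneg_nonneg sum_nonneg\<close>)
  then have pow: "(\<Sum>i=1..n. (norm (s i))\<^sup>2) \<le> real n * \<Lambda>"
    using n \<Lambda> by (simp add: divide_less_eq)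
  have out: "s i $ k = 0" if "i \<in> {1..n}" "k \<notin> I" for i k
    using zero[OF that(1), of k] that(2) I(1) nonneg(1)[of k] by (auto simp: less_le)
  have "s = restrict (\<lambda>i. s i * set_vec I) {1..n}"
  proof
    fix i show "s i = restrict (\<lambda>i. s i * set_vec I) {1..n} i"
    proof (cases "i \<in> {1..n}")
      case True
      then have "s i = s i * set_vec I" by (auto simp: vec_eq_iff set_vec_def out simp del: One_nat_def)
      then show ?thesis using True by simp
    next
      case False
      then show ?thesis using s by (auto simp: space_signal_space PiE_def extensional_def)
    qed
  qed
  then show ?thesis
    unfolding jamming_signals_def using pow I(2) out
    by (intro CollectI exI[of _ "\<lambda>i. (I, s i)"]) (simp add: jammer_actions_def del: One_nat_def)
qed

text \<open>Markov's inequality in integrated form: for an admissible signal the mean success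
  probability is at least \<open>1 - cr_error\<close>, and for any other signal
  \<open>excess\<close> is at least 1. Without conditioning on admissibility the jamming keeps its
  product law, and Fubini's theorem reduces the estimate to single codes.\<close>

lemma cr_error_lower_bound:
  assumes l: "0 \<le> l"
  shows "1 - cr_error noise J \<Lambda> n M Q
    \<le> real CARD('k) ^ n * exp \<theta> ^ n / real M + exp (l * (ln (1 + \<Gamma> / c) / 2 - \<theta>) + 3 / 4 * l\<^sup>2) ^ n
      + (\<Sum>k\<in>UNIV. \<delta> k) / \<Lambda>" (is "?lhs \<le> ?e + ?r")
proof -
  let ?J = "PiM {1..n} (\<lambda>_. jam)"
  note [measurable_cong] = sets_PiM_jam
  interpret Q: prob_space Q using Q by (simp add: cr_code_def)
  interpret J: prob_space ?J by (intro prob_space_PiM prob_space_jam)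
  interpret QJ: pair_sigma_finite Q ?J ..
  have M: "1 \<le> M" using Q by (simp add: cr_code_def)
  have \<Lambda>0: "0 \<le> \<Lambda>" using \<Lambda> by simp
  have me [measurable]: "(\<lambda>p. msg_error noise n (fst p) (snd p) m) \<in> borel_measurable (Q \<Otimes>\<^sub>M ?J)" if "m \<in>
      {1..M}" for m
    using measurable_msg_error[OF prob_space_noise sets_vlaw Q that]
    by (simp add: case_prod_unfold measurable_cong_sets[OF sets_pair_measure_cong[OF refl sets_PiM_jam]
        refl] del: One_nat_def)
  have ce [measurable]: "(\<lambda>(k, s). ennreal (1 - code_error noise n M k s)) \<in> borel_measurable (Q \<Otimes>\<^sub>M ?J)"
    unfolding code_error_eq case_prod_unfold by measurable
  have pw: "ennreal ?lhs \<le> (\<integral>\<^sup>+k. ennreal (1 - code_error noise n M k s) \<partial>Q) + excess \<delta> n \<Lambda> s"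
    if s: "s \<in> space ?J" for s
  proof (cases "excess \<delta> n \<Lambda> s < 1")
    case True
    have sp: "s \<in> space (signal_space n)" using s sets_eq_imp_space_eq[OF sets_PiM_jam] by simp
    have jam: "s \<in> jamming_signals n J \<Lambda>" by (rule jamming_signal_or_excess[OF sp True])
    have int: "integrable Q (\<lambda>k. code_error noise n M k s)"
      by (rule integrable_code_error[OF prob_space_noise sets_vlaw Q sp])
    have "?lhs \<le> 1 - (LINT k|Q. code_error noise n M k s)"
      using cr_error_upper[OF prob_space_noise sets_vlaw Q jam] by simp
    also have "\<dots> = (LINT k|Q. 1 - code_error noise n M k s)"
      using int by (simp add: Q.prob_space)
    finally have "ennreal ?lhs \<le> ennreal (LINT k|Q. 1 - code_error noise n M k s)" by (rule ennreal_leI)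
    also have "\<dots> = (\<integral>\<^sup>+k. ennreal (1 - code_error noise n M k s) \<partial>Q)"
      using int code_error_le_1[OF prob_space_noise] by (intro nn_integral_eq_integral[symmetric] AE_I2) auto
    finally show ?thesis by (rule order_trans) simp
  next
    case False
    have "ennreal ?lhs \<le> ennreal 1"
      using cr_error_nonneg[OF prob_space_noise sets_vlaw Q J(2) \<Lambda>0] by (intro ennreal_leI) simp
    also have "\<dots> \<le> excess \<delta> n \<Lambda> s" using False by simp
    finally show ?thesis by (rule order_trans) simp
  qed
  have "ennreal ?lhs = (\<integral>\<^sup>+s. ennreal ?lhs \<partial>?J)" by (simp add: J.emeasure_space_1 del: One_nat_def)
  also have "\<dots> \<le> (\<integral>\<^sup>+s. (\<integral>\<^sup>+k. ennreal (1 - code_error noise n M k s) \<partial>Q) + excess \<delta> n \<Lambda> s \<partial>?J)"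
    by (intro nn_integral_mono pw)
  also have "\<dots> = (\<integral>\<^sup>+s. \<integral>\<^sup>+k. ennreal (1 - code_error noise n M k s) \<partial>Q \<partial>?J) + (\<integral>\<^sup>+s. excess \<delta> n \<Lambda> s \<partial>?J)"
  proof (rule nn_integral_add)
    show "(\<lambda>s. \<integral>\<^sup>+k. ennreal (1 - code_error noise n M k s) \<partial>Q) \<in> borel_measurable ?J"
      using ce by measurable
    have "(\<lambda>s. ennreal ((s i $ k)\<^sup>2)) \<in> borel_measurable ?J" if i: "i \<in> {1..n}" for i k
      by (rule measurable_compose[OF measurable_component_singleton[OF i]]) simp
    then show "excess \<delta> n \<Lambda> \<in> borel_measurable ?J"
      unfolding excess_def[abs_def] by (intro borel_measurable_sum borel_measurable_times_ennreal) auto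
  qed
  also have "(\<integral>\<^sup>+s. \<integral>\<^sup>+k. ennreal (1 - code_error noise n M k s) \<partial>Q \<partial>?J) = (\<integral>\<^sup>+k. \<integral>\<^sup>+s. ennreal (1 -
      code_error noise n M k s) \<partial>?J \<partial>Q)"
    by (rule QJ.Fubini'[OF ce])
  also have "\<dots> \<le> (\<integral>\<^sup>+k. ennreal ?e \<partial>Q)"
    by (intro nn_integral_mono nn_integral_code_success l)
  also have "\<dots> = ennreal ?e" by (simp add: Q.emeasure_space_1)
  also have "(\<integral>\<^sup>+s. excess \<delta> n \<Lambda> s \<partial>?J) = ennreal ?r" by (rule nn_integral_excess)
  finally have "ennreal ?lhs \<le> ennreal ?e + ennreal ?r" by (simp add: add_right_mono)
  also have "\<dots> = ennreal (?e + ?r)"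
    using nonneg \<Lambda> by (intro ennreal_plus[symmetric]) (auto intro!: divide_nonneg_pos sum_nonneg)
  finally show ?thesis
    using nonneg \<Lambda> by (subst (asm) ennreal_le_iff) (auto intro!: add_nonneg_nonneg divide_nonneg_nonneg
        sum_nonneg)
qed

end

text \<open>A rate above the bound leaves room to lower the water level. Then
  \<open>cr_error_lower_bound\<close> becomes, in the limit, the statement that the lowered level
  costs power at least \<Lambda>, while it costs strictly less.\<close>

lemma cr_achievable_le:
  fixes s2 :: "'k::finite \<Rightarrow> real" and b c \<Gamma> \<Lambda> R :: real
  assumes b: "1 < b" and \<Gamma>: "0 < \<Gamma>" and \<Lambda>: "0 < \<Lambda>" and c: "0 < c" and s2: "\<And>k. 0 \<le> s2 k"
    and J: "card {k. s2 k < c} \<le> J" "J \<le> CARD('k)"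
    and fill: "(\<Sum>k\<in>UNIV. max 0 (c - s2 k)) = \<Lambda>"
    and ach: "cr_achievable b (vlaw (\<lambda>k. gauss0 (s2 k))) J \<Gamma> \<Lambda> R"
  shows "R \<le> 1 / 2 * log b (1 + \<Gamma> / c) + log b (real CARD('k))"
proof (rule ccontr)
  let ?N = "vlaw (\<lambda>k. gauss0 (s2 k))"
  let ?K = "real CARD('k)"
  assume "\<not> ?thesis"
  then have R: "1 / 2 * log b (1 + \<Gamma> / c) + log b ?K < R" by simp
  have lnb: "0 < ln b" using b by simp
  \<comment> \<open>The rate in natural units after deducting the cost of summing over all hopping
    sequences.\<close>
  define a where "a = R * ln b - ln ?K"
  have a: "ln (1 + \<Gamma> / c) / 2 < a"
  proof -
    have "(1 / 2 * log b (1 + \<Gamma> / c) + log b ?K) * ln b < R * ln b"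
      using R lnb by (rule mult_strict_right_mono)
    moreover have "(1 / 2 * log b (1 + \<Gamma> / c) + log b ?K) * ln b = ln (1 + \<Gamma> / c) / 2 + ln ?K"
      using lnb by (simp add: log_def field_simps)
    ultimately show ?thesis unfolding a_def by linarith
  qed
  have "1 + \<Gamma> / c = exp (2 * (ln (1 + \<Gamma> / c) / 2))"
    using c \<Gamma> by (simp add: add_pos_pos)
  also have "\<dots> < exp (2 * a)" using a by simp
  finally have ea: "\<Gamma> / c < exp (2 * a) - 1" by simp
  then have ea0: "0 < exp (2 * a) - 1" using c \<Gamma> by (intro order.strict_trans[OF _ ea]) simp
  \<comment> \<open>The water level at which the Gaussian rate equals \<open>a\<close>; every level
    between \<open>d\<close> and \<open>c\<close> still has a rate below \<open>a\<close>.\<close>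
  define d where "d = \<Gamma> / (exp (2 * a) - 1)"
  define c' where "c' = (c + d) / 2"
  have "d < c" "0 < d" using ea ea0 c \<Gamma> by (simp_all add: d_def field_simps)
  then have c': "0 < c'" "c' < c" "d < c'"
    using c unfolding c'_def by auto
  define L where "L = ln (1 + \<Gamma> / c') / 2"
  have "1 + \<Gamma> / c' < exp (2 * a)" using c' ea0 by (simp add: d_def field_simps)
  then have "ln (1 + \<Gamma> / c') < ln (exp (2 * a))"
    using c' \<Gamma> by (subst ln_less_cancel_iff) (auto intro!: add_pos_pos)
  then have La: "L < a" by (simp add: L_def)
  \<comment> \<open>One third of the gap lifts the threshold above \<open>L\<close>, one third is
    lost to the liminf of the rates, and the last one gives the decay
    \<open>exp (- \<epsilon>) ^ n\<close>.\<close>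
  define \<epsilon> where "\<epsilon> = (a - L) / 3"
  have \<epsilon>: "0 < \<epsilon>" using La by (simp add: \<epsilon>_def)
  define \<delta> where "\<delta> k = max 0 (c' - s2 k)" for k
  define v where "v k = \<delta> k + s2 k" for k
  have \<delta>0: "0 \<le> \<delta> k" for k by (simp add: \<delta>_def)
  have v: "c' \<le> v k" for k by (simp add: v_def \<delta>_def)
  have "(\<Sum>k\<in>UNIV. \<delta> k) < (\<Sum>k\<in>UNIV. max 0 (c - s2 k))"
  proof (rule sum_strict_mono_ex1)
    have "\<exists>k. 0 < max 0 (c - s2 k)"
    proof (rule ccontr)
      assume "\<not> ?thesis"
      then have "(\<Sum>k\<in>UNIV. max 0 (c - s2 k)) \<le> 0" by (intro sum_nonpos) (auto simp: not_less)
      then show False using fill \<Lambda> by simp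
    qed
    then obtain k where "0 < max 0 (c - s2 k)" ..
    then have "\<delta> k < max 0 (c - s2 k)" using c' by (auto simp: \<delta>_def)
    then show "\<exists>k\<in>UNIV. \<delta> k < max 0 (c - s2 k)" by blast
  qed (use c' in \<open>auto simp: \<delta>_def\<close>)
  then have \<rho>: "(\<Sum>k\<in>UNIV. \<delta> k) / \<Lambda> < 1" using fill \<Lambda> by simp
  have "card {k. 0 < \<delta> k} \<le> card {k. s2 k < c}" using c' by (intro card_mono) (auto simp: \<delta>_def)
  then have J': "card {k. 0 < \<delta> k} \<le> J" using J by simp
  obtain M Q where Q: "\<And>n. 1 \<le> n \<Longrightarrow> cr_code n \<Gamma> (M n) (Q n)"
    and rate: "ereal R \<le> liminf (\<lambda>n. ereal (1 / real n * log b (real (M n))))"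
    and err: "(\<lambda>n. cr_error ?N J \<Lambda> n (M n) (Q n)) \<longlonglongrightarrow> 0"
    using ach unfolding cr_achievable_def by blast
  \<comment> \<open>The minimizer of \<open>- l * \<epsilon> + 3 / 4 * l\<^sup>2\<close>, with value
    \<open>- \<epsilon>\<^sup>2 / 3\<close>.\<close>
  define l where "l = 2 * \<epsilon> / 3"
  have l: "0 \<le> l" using \<epsilon> by (simp add: l_def)
  have tail: "l * (L - (L + \<epsilon>)) + 3 / 4 * l\<^sup>2 = - \<epsilon>\<^sup>2 / 3" by (simp add: l_def power2_eq_square)
  \<comment> \<open>Division by \<open>ln b\<close> converts the natural unit of \<epsilon> to the
    base of the rates.\<close>
  have "ereal (R - \<epsilon> / ln b) < liminf (\<lambda>n. ereal (1 / real n * log b (real (M n))))"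
    using \<epsilon> lnb by (intro less_le_trans[OF _ rate]) simp
  then have "\<forall>\<^sub>F n in sequentially. ereal (R - \<epsilon> / ln b) < ereal (1 / real n * log b (real (M n)))"
    by (rule less_LiminfD)
  then have ev: "\<forall>\<^sub>F n in sequentially. 1 - cr_error ?N J \<Lambda> n (M n) (Q n)
      \<le> exp (- \<epsilon>) ^ n + exp (- \<epsilon>\<^sup>2 / 3) ^ n + (\<Sum>k\<in>UNIV. \<delta> k) / \<Lambda>"
    using eventually_ge_at_top[of 1]
  proof eventually_elim
    case (elim n)
    then have n: "1 \<le> n" by simp
    have M: "0 < real (M n)" using Q[OF n] by (simp add: cr_code_def)
    have "R - \<epsilon> / ln b < 1 / real n * log b (real (M n))" using elim by simp
    then have "(R - \<epsilon> / ln b) * (real n * ln b) < 1 / real n * log b (real (M n)) * (real n * ln b)"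
      using n lnb by (intro mult_strict_right_mono) auto
    then have "real n * (R * ln b - \<epsilon>) < ln (real (M n))"
      using n lnb by (simp add: log_def algebra_simps)
    then have "exp (real n * (R * ln b - \<epsilon>)) \<le> real (M n)"
      using M by (subst ln_ge_iff[symmetric]) auto
    then have "?K ^ n * exp (L + \<epsilon>) ^ n / real (M n) \<le> ?K ^ n * exp (L + \<epsilon>) ^ n / exp (real n * (R * ln b - \<epsilon>))"
      using M by (intro divide_left_mono) auto
    also have "\<dots> = exp (real n * (ln ?K + (L + \<epsilon>) - (R * ln b - \<epsilon>)))"
    proof -
      have "?K ^ n = exp (real n * ln ?K)" by (simp add: exp_of_nat_mult)
      then show ?thesis by (simp only: exp_of_nat_mult[symmetric] exp_add[symmetric] exp_diff[symmetric])
          (simp add: algebra_simps)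
    qed
    also have "ln ?K + (L + \<epsilon>) - (R * ln b - \<epsilon>) = - \<epsilon>" by (simp add: \<epsilon>_def a_def field_simps)
    finally have 1: "?K ^ n * exp (L + \<epsilon>) ^ n / real (M n) \<le> exp (- \<epsilon>) ^ n"
      by (simp add: exp_of_nat_mult[symmetric])
    have "1 - cr_error ?N J \<Lambda> n (M n) (Q n)
        \<le> ?K ^ n * exp (L + \<epsilon>) ^ n / real (M n) + exp (l * (ln (1 + \<Gamma> / c') / 2 - (L + \<epsilon>)) + 3 / 4 * l\<^sup>2) ^ n
          + (\<Sum>k\<in>UNIV. \<delta> k) / \<Lambda>"
      by (rule cr_error_lower_bound[OF \<delta>0 s2 v_def v c'(1) \<Gamma> \<Lambda> n J' J(2) Q[OF n] l])
    then show ?case using 1 unfolding L_def[symmetric] tail by linarith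
  qed
  have "1 - 0 \<le> 0 + 0 + (\<Sum>k\<in>UNIV. \<delta> k) / \<Lambda>"
  proof (rule tendsto_le[OF sequentially_bot _ _ ev])
    show "(\<lambda>n. 1 - cr_error ?N J \<Lambda> n (M n) (Q n)) \<longlonglongrightarrow> 1 - 0" by (intro tendsto_diff tendsto_const err)
    show "(\<lambda>n. exp (- \<epsilon>) ^ n + exp (- \<epsilon>\<^sup>2 / 3) ^ n + (\<Sum>k\<in>UNIV. \<delta> k) / \<Lambda>) \<longlonglongrightarrow> 0 + 0 + (\<Sum>k\<in>UNIV. \<delta> k) / \<Lambda>"
      using \<epsilon> by (intro tendsto_add tendsto_const LIMSEQ_power_zero) auto
  qed
  then show False using \<rho> by simp
qed

theorem theorem2:
  fixes P :: "'w measure" and N :: "'k::finite \<Rightarrow> 'w \<Rightarrow> real"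
    and \<sigma> \<Lambda>s :: "'k \<Rightarrow> real" and J :: nat and b \<Gamma> \<Lambda> c :: real
  assumes "b > 1"
    and "1 \<le> J" and "J \<le> CARD('k)"
    and "\<Gamma> > 0" and "\<Lambda> > 0"
    and "prob_space P"
    and "prob_space.indep_vars P (\<lambda>_. borel) N UNIV"
    and "\<And>k. integrable P (\<lambda>\<omega>. (N k \<omega>)\<^sup>2)"
    and "\<And>k. prob_space.expectation P (N k) = 0"
    and "\<And>k. prob_space.variance P (N k) = (\<sigma> k)\<^sup>2"
    and "\<And>k. \<Lambda>s k \<ge> 0"
    and "\<And>k. (\<sigma> k)\<^sup>2 < c \<Longrightarrow> (\<sigma> k)\<^sup>2 + \<Lambda>s k = c"
    and "\<And>k. (\<sigma> k)\<^sup>2 \<ge> c \<Longrightarrow> \<Lambda>s k = 0"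
    and "(\<Sum>k\<in>UNIV. \<Lambda>s k) = \<Lambda>"
  shows "cr_capacity b (noise_law P N) J \<Gamma> \<Lambda> \<ge> ereal (1 / 2 * log b (1 + \<Gamma> / c)) \<and>
    cr_capacity b (noise_law P N) J \<Gamma> \<Lambda> > 0 \<and>
    ((\<forall>k. centered_gaussian P (N k) (\<sigma> k)) \<and> J \<ge> card {k. (\<sigma> k)\<^sup>2 < c} \<longrightarrow>
      cr_capacity b (noise_law P N) J \<Gamma> \<Lambda>
        \<le> ereal (1 / 2 * log b (1 + \<Gamma> / c) + log b (real CARD('k))))"
proof -
  note b = assms(1) and J = assms(3) and \<Gamma> = assms(4) and \<Lambda> = assms(5) and P = assms(6) and ind = assms(7)
    and water = assms(12) and dry = assms(13) and total = assms(14)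
  interpret P: prob_space P by (rule P)
  have N [measurable]: "N k \<in> borel_measurable P" for k
    using ind by (simp add: P.indep_vars_def)
  have NI: "integrable P (N k)" for k
    by (rule P.square_integrable_imp_integrable[OF N assms(8)])
  have vec [measurable]: "(\<lambda>\<omega>. \<chi> k. N k \<omega>) \<in> borel_measurable P"
  proof -
    have "(\<lambda>\<omega>. \<lambda>k\<in>UNIV. N k \<omega>) \<in> measurable P (PiM UNIV (\<lambda>_. borel))"
      by (intro measurable_restrict N)
    from measurable_compose[OF this measurable_vec_lambda] show ?thesis by simp
  qed
  let ?\<mu> = "noise_law P N"
  have mu: "prob_space ?\<mu>" "sets ?\<mu> = sets borel"
    unfolding noise_law_def by (rule P.prob_space_distr[OF vec]) simp
  have mom: "integrable ?\<mu> (\<lambda>z. z $ k)" "integrable ?\<mu> (\<lambda>z. (z $ k)\<^sup>2)" "(\<integral>z. z $ k \<partial>?\<mu>) = 0" "(\<integral>z. (z $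
      k)\<^sup>2 \<partial>?\<mu>) = (\<sigma> k)\<^sup>2" for k
    unfolding noise_law_def using NI[of k] assms(8)[of k] assms(9)[of k] assms(10)[of k]
    by (simp_all add: integrable_distr_eq integral_distr)
  define A where "A = {k. (\<sigma> k)\<^sup>2 < c}"
  have \<Lambda>s: "\<Lambda>s k = max 0 (c - (\<sigma> k)\<^sup>2)" for k
    using water[of k] dry[of k] by (cases "(\<sigma> k)\<^sup>2 < c") auto
  have sumA: "(\<Sum>k\<in>A. \<Lambda>s k) = \<Lambda>"
    unfolding total[symmetric] by (rule sum.mono_neutral_left) (auto simp: A_def dry not_less)
  \<comment> \<open>Positivity of \<open>c\<close> is derived: since \<Lambda> > 0, some subchannel
    receives power and hence has variance below \<open>c\<close>.\<close>
  then have A: "A \<noteq> {}" using \<Lambda> by auto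
  then obtain k where "(\<sigma> k)\<^sup>2 < c" by (auto simp: A_def)
  then have c: "0 < c" by (rule le_less_trans[OF zero_le_power2])
  have "(\<Sum>k\<in>A. (\<sigma> k)\<^sup>2) + \<Lambda> = (\<Sum>k\<in>A. (\<sigma> k)\<^sup>2 + \<Lambda>s k)" by (simp add: sumA sum.distrib)
  also have "\<dots> = (\<Sum>k\<in>A. c)" by (intro sum.cong refl water) (simp add: A_def)
  finally have fill: "(\<Sum>k\<in>A. (\<sigma> k)\<^sup>2) + \<Lambda> \<le> card A * c" by simp
  have pos: "0 < 1 / 2 * log b (1 + \<Gamma> / c)"
    unfolding log_def using b c \<Gamma> by (intro mult_pos_pos divide_pos_pos ln_gt_zero) auto
  have ge: "ereal (1 / 2 * log b (1 + \<Gamma> / c)) \<le> cr_capacity b ?\<mu> J \<Gamma> \<Lambda>"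
  \<comment> \<open>The supremum attains the bound even though only rates strictly below it are
    shown achievable. Using \<open>max y 0\<close> keeps the chosen rate nonnegative.\<close>
  proof (rule dense_le)
    fix y assume y: "y < ereal (1 / 2 * log b (1 + \<Gamma> / c))"
    have "max y 0 < ereal (1 / 2 * log b (1 + \<Gamma> / c))" using y pos by simp
    then obtain R where R: "max y 0 < ereal R" "ereal R < ereal (1 / 2 * log b (1 + \<Gamma> / c))"
      using ereal_dense2 by blast
    have "0 < ereal R" by (rule le_less_trans[OF _ R(1)]) simp
    then have R0: "0 \<le> R" by simp
    have "cr_achievable b ?\<mu> J \<Gamma> \<Lambda> R"
      by (rule cr_achievable_hopping[OF b mu mom A c \<Gamma> _ J fill R0]) (use \<Lambda> R in auto)
    then have "ereal R \<le> cr_capacity b ?\<mu> J \<Gamma> \<Lambda>" unfolding cr_capacity_def by (intro Sup_upper) auto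
    moreover have "y \<le> ereal R" using R(1) by (auto simp: less_imp_le)
    ultimately show "y \<le> cr_capacity b ?\<mu> J \<Gamma> \<Lambda>" by (rule order_trans[rotated])
  qed
  moreover have "0 < cr_capacity b ?\<mu> J \<Gamma> \<Lambda>" using pos by (intro less_le_trans[OF _ ge]) simp
  moreover have "cr_capacity b ?\<mu> J \<Gamma> \<Lambda> \<le> ereal (1 / 2 * log b (1 + \<Gamma> / c) + log b (real CARD('k)))"
    if gaussian: "\<And>k. centered_gaussian P (N k) (\<sigma> k)" and J': "card {k. (\<sigma> k)\<^sup>2 < c} \<le> J"
  proof -
    have "?\<mu> = vlaw (\<lambda>k. gauss0 ((\<sigma> k)\<^sup>2))"
      using noise_law_vlaw[OF P ind] distr_centered_gaussian[OF P gaussian] by simp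
    then show ?thesis
      unfolding cr_capacity_def
      using cr_achievable_le[OF b \<Gamma> \<Lambda> c zero_le_power2 J' J total[unfolded \<Lambda>s]]
      by (intro Sup_least) auto
  qed
  ultimately show ?thesis by blast
qed

end
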